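(* Let $a>0$ and, for $z\in\mathbb C$, let $\varphi_z=L\psi_z=\Phi\sum_{n\ge0}a_nz^n\varphi_n$, with $\Phi=e^{-z\bar z/2}$, $a_n=(n!)^{-1/2}$, $\varphi_n=L\psi_n$, and $L$, $\psi_n$, $\psi_z$ as in the context. Then the states $\varphi_z$, $z\in\mathbb C$, satisfy all the conditions of a system of coherent states: they belong to $H_1$, lie in the domain of the Hamiltonian $h_1=-\partial_x^2-2a^2\,\mathrm{sech}^2(ax)$ and solve $(i\partial_t-h_1)\varphi_z=0$, and there is a measure $d\mu_\varphi=d\mu_\varphi(z,\bar z)$ on $\mathbb C$ realizing the resolution of the identity $\int_{\mathbb C}d\mu_\varphi\,|\varphi_z\rangle\langle\varphi_z|=\mathbb I$ on $H_1$. This measure gives a solution of the moment problem in the complex plane $$a_na_k\int d\mu_\varphi\,|\Phi|^2z^n\bar z^k=S^{-1}_{nk},\qquad n,k=0,1,2,\dots,$$ and has the form $d\mu_\varphi=dy\,d\nu(x)$, $z=x+iy$, where the measure $d\nu(x)$ is defined by its Fourier transform $d\tilde\nu(t)=\rho(t)\,dt$ with $\rho(t)=\exp(t^2/8-a|t|)/(2\pi a)$.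
   Context: Fix $a>0$; functions depend on $(x,t)$, Hilbert-space statements are at fixed $t$ (the variable $t$ in $\rho(t)$ is the Fourier variable, not time). $H_0=L^2(\mathbb R)$ with $\langle f|g\rangle_0=\int\bar f g\,dx$. Let $A=(i-t)\partial_x+ix/2$, $A^+=(i+t)\partial_x-ix/2$; $\psi_0$ the normalized solution of $i\partial_t\psi=-\partial_x^2\psi$ with $A\psi_0=0$; $\psi_n=(n!)^{-1/2}(A^+)^n\psi_0$ (orthonormal basis of $H_0$). The free-particle coherent states are $\psi_z=e^{-|z|^2/2}\sum_n(n!)^{-1/2}z^n\psi_n$ ($A\psi_z=z\psi_z$). $\mathcal L_0=\mathrm{span}\{\psi_n\}$. $\bar h_0$ is the closure of $-\partial_x^2$ on $\mathcal L_0$ (self-adjoint) with domain $D_0$; $\bar g_0=\bar h_0+a^2$. $L=-a\tanh(ax)+\partial_x$, $\varphi_n=L\psi_n$, $\mathcal L_1=\mathrm{span}\{\varphi_n\}$ with scalar product $\langle L\psi_a|L\psi_b\rangle_1=\langle\psi_a|\bar g_0|\psi_b\rangle_0$ ($\psi_a,\psi_b\in\mathcal L_0$), and $H_1$ the completion of $\mathcal L_1$; bras $\langle\varphi_z|$ are taken with respect to $\langle\cdot|\cdot\rangle_1$. $S_{nk}=\langle\psi_n|\bar g_0|\psi_k\rangle_0$ and $S^{-1}_{nk}$ denotes the entries of the inverse matrix, i.e. $S^{-1}_{nk}=\langle\psi_n|\bar g_0^{-1}|\psi_k\rangle_0$.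
   Formalization: No genuine measure dν has Fourier transform ρ(t) growing like exp(t²/8), so dμ = dy dν(x) is read as the linear functional given by Parseval pairing with ρ; the resolution of the identity is stated weakly, for matrix elements between vectors of the dense subspace L_1 of H_1. *)

theory Defs
  imports "HOL-Analysis.Analysis"
begin

text \<open>Functions of (x,t) are modelled as real \<Rightarrow> real \<Rightarrow> complex (first argument x, second t).
  Hilbert-space objects live at a fixed time t and are functions real \<Rightarrow> complex.\<close>

definition dx :: "(real \<Rightarrow> real \<Rightarrow> complex) \<Rightarrow> real \<Rightarrow> real \<Rightarrow> complex" where
  "dx f x t = vector_derivative (\<lambda>s. f s t) (at x)"

definition dt :: "(real \<Rightarrow> real \<Rightarrow> complex) \<Rightarrow> real \<Rightarrow> real \<Rightarrow> complex" where
  "dt f x t = vector_derivative (\<lambda>s. f x s) (at t)"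

definition Aop :: "(real \<Rightarrow> real \<Rightarrow> complex) \<Rightarrow> real \<Rightarrow> real \<Rightarrow> complex" where
  "Aop f x t = (\<i> - of_real t) * dx f x t + \<i> * of_real (x / 2) * f x t"

definition Aplus :: "(real \<Rightarrow> real \<Rightarrow> complex) \<Rightarrow> real \<Rightarrow> real \<Rightarrow> complex" where
  "Aplus f x t = (\<i> + of_real t) * dx f x t - \<i> * of_real (x / 2) * f x t"

definition psin :: "(real \<Rightarrow> real \<Rightarrow> complex) \<Rightarrow> nat \<Rightarrow> real \<Rightarrow> real \<Rightarrow> complex" where
  "psin \<psi>0 n x t = of_real (1 / sqrt (fact n)) * (Aplus ^^ n) \<psi>0 x t"

definition Lop :: "real \<Rightarrow> (real \<Rightarrow> real \<Rightarrow> complex) \<Rightarrow> real \<Rightarrow> real \<Rightarrow> complex" where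
  "Lop a f x t = - of_real (a * tanh (a * x)) * f x t + dx f x t"

definition psiz :: "(real \<Rightarrow> real \<Rightarrow> complex) \<Rightarrow> complex \<Rightarrow> real \<Rightarrow> real \<Rightarrow> complex" where
  "psiz \<psi>0 z x t = exp (- of_real ((cmod z)\<^sup>2 / 2)) *
      (\<Sum>n. of_real (1 / sqrt (fact n)) * z ^ n * psin \<psi>0 n x t)"

definition phiz :: "real \<Rightarrow> (real \<Rightarrow> real \<Rightarrow> complex) \<Rightarrow> complex \<Rightarrow> real \<Rightarrow> real \<Rightarrow> complex" where
  "phiz a \<psi>0 z = Lop a (psiz \<psi>0 z)"

definition phin :: "real \<Rightarrow> (real \<Rightarrow> real \<Rightarrow> complex) \<Rightarrow> nat \<Rightarrow> real \<Rightarrow> real \<Rightarrow> complex" where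
  "phin a \<psi>0 n = Lop a (psin \<psi>0 n)"

definition slice :: "(real \<Rightarrow> real \<Rightarrow> complex) \<Rightarrow> real \<Rightarrow> real \<Rightarrow> complex" where
  "slice f t = (\<lambda>x. f x t)"

definition d1 :: "(real \<Rightarrow> complex) \<Rightarrow> real \<Rightarrow> complex" where
  "d1 f x = vector_derivative f (at x)"

definition ip0 :: "(real \<Rightarrow> complex) \<Rightarrow> (real \<Rightarrow> complex) \<Rightarrow> complex" where
  "ip0 f g = (LINT x|lborel. cnj (f x) * g x)"

definition sq_int :: "(real \<Rightarrow> complex) \<Rightarrow> bool" where
  "sq_int f \<longleftrightarrow> f \<in> borel_measurable lborel \<and> integrable lborel (\<lambda>x. (cmod (f x))\<^sup>2)"

definition l2conv :: "(nat \<Rightarrow> real \<Rightarrow> complex) \<Rightarrow> (real \<Rightarrow> complex) \<Rightarrow> bool" where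
  "l2conv F f \<longleftrightarrow> (\<lambda>j. LINT x|lborel. (cmod (F j x - f x))\<^sup>2) \<longlonglongrightarrow> 0"

definition L0 :: "(real \<Rightarrow> real \<Rightarrow> complex) \<Rightarrow> real \<Rightarrow> (real \<Rightarrow> complex) set" where
  "L0 \<psi>0 t = {(\<lambda>x. \<Sum>n<N. c n * psin \<psi>0 n x t) | c N. True}"

text \<open>g_0 = -d^2/dx^2 + a^2 acting on L_0 (where it coincides with its closure)\<close>
definition g0op :: "real \<Rightarrow> (real \<Rightarrow> complex) \<Rightarrow> real \<Rightarrow> complex" where
  "g0op a f x = - d1 (d1 f) x + of_real (a\<^sup>2) * f x"

definition g0ip :: "real \<Rightarrow> (real \<Rightarrow> complex) \<Rightarrow> (real \<Rightarrow> complex) \<Rightarrow> complex" where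
  "g0ip a u v = ip0 u (g0op a v)"

text \<open>graph of the closure bar g_0 of g_0 restricted to L_0: u in D_0 and bar g_0 u = v\<close>
definition g0bar_graph :: "real \<Rightarrow> (real \<Rightarrow> real \<Rightarrow> complex) \<Rightarrow> real \<Rightarrow>
    (real \<Rightarrow> complex) \<Rightarrow> (real \<Rightarrow> complex) \<Rightarrow> bool" where
  "g0bar_graph a \<psi>0 t u v \<longleftrightarrow> sq_int u \<and> sq_int v \<and>
     (\<exists>F. (\<forall>j. F j \<in> L0 \<psi>0 t) \<and> l2conv F u \<and> l2conv (\<lambda>j. g0op a (F j)) v)"

text \<open>S^{-1}_{nk} = <psi_n | bar g_0^{-1} | psi_k>_0\<close>
definition Sinv :: "real \<Rightarrow> (real \<Rightarrow> real \<Rightarrow> complex) \<Rightarrow> real \<Rightarrow> nat \<Rightarrow> nat \<Rightarrow> complex" where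
  "Sinv a \<psi>0 t n k = ip0 (slice (psin \<psi>0 n) t)
      (SOME u. g0bar_graph a \<psi>0 t u (slice (psin \<psi>0 k) t))"

definition L1op :: "real \<Rightarrow> (real \<Rightarrow> complex) \<Rightarrow> real \<Rightarrow> complex" where
  "L1op a u x = - of_real (a * tanh (a * x)) * u x + d1 u x"

definition L1 :: "real \<Rightarrow> (real \<Rightarrow> real \<Rightarrow> complex) \<Rightarrow> real \<Rightarrow> (real \<Rightarrow> complex) set" where
  "L1 a \<psi>0 t = L1op a ` L0 \<psi>0 t"

definition ip1 :: "real \<Rightarrow> (real \<Rightarrow> real \<Rightarrow> complex) \<Rightarrow> real \<Rightarrow>
    (real \<Rightarrow> complex) \<Rightarrow> (real \<Rightarrow> complex) \<Rightarrow> complex" where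
  "ip1 a \<psi>0 t f g = g0ip a (SOME u. u \<in> L0 \<psi>0 t \<and> L1op a u = f)
                            (SOME v. v \<in> L0 \<psi>0 t \<and> L1op a v = g)"

definition norm1 :: "real \<Rightarrow> (real \<Rightarrow> real \<Rightarrow> complex) \<Rightarrow> real \<Rightarrow> (real \<Rightarrow> complex) \<Rightarrow> real" where
  "norm1 a \<psi>0 t f = sqrt (Re (ip1 a \<psi>0 t f f))"

text \<open>membership in H_1 (completion of L_1): limit (realised in L^2) of a
  ||.||_1-Cauchy sequence from L_1\<close>
definition in_H1 :: "real \<Rightarrow> (real \<Rightarrow> real \<Rightarrow> complex) \<Rightarrow> real \<Rightarrow> (real \<Rightarrow> complex) \<Rightarrow> bool" where
  "in_H1 a \<psi>0 t f \<longleftrightarrow> (\<exists>F. (\<forall>j. F j \<in> L1 a \<psi>0 t) \<and>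
      (\<forall>e>0. \<exists>N. \<forall>m\<ge>N. \<forall>n\<ge>N. norm1 a \<psi>0 t (\<lambda>x. F m x - F n x) < e) \<and>
      l2conv F f)"

text \<open>bra <phi_z| f>_1 for f in L_1, phi_z = Phi sum a_n z^n phi_n\<close>
definition braphi :: "real \<Rightarrow> (real \<Rightarrow> real \<Rightarrow> complex) \<Rightarrow> real \<Rightarrow> complex \<Rightarrow> (real \<Rightarrow> complex) \<Rightarrow> complex" where
  "braphi a \<psi>0 t z f = (\<Sum>n. cnj (exp (- of_real ((cmod z)\<^sup>2 / 2)) * of_real (1 / sqrt (fact n)) * z ^ n)
                             * ip1 a \<psi>0 t (slice (phin a \<psi>0 n) t) f)"

text \<open>domain of h_1 = -d^2/dx^2 - 2 a^2 sech^2(a x): H^2(R) (for C^2 functions: f, f'' in L^2)\<close>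
definition in_dom_h1 :: "(real \<Rightarrow> complex) \<Rightarrow> bool" where
  "in_dom_h1 f \<longleftrightarrow> (\<forall>x. f differentiable (at x) \<and> d1 f differentiable (at x)) \<and>
                    sq_int f \<and> sq_int (d1 (d1 f))"

definition rho :: "real \<Rightarrow> real \<Rightarrow> real" where
  "rho a \<tau> = exp (\<tau>\<^sup>2 / 8 - a * \<bar>\<tau>\<bar>) / (2 * pi * a)"

text \<open>the (generalised) measure nu defined by its Fourier transform
  d nu~(tau) = rho(tau) d tau, nu~(tau) = (1/(2 pi)) int e^{-i tau x} d nu(x);
  by Parseval: int g d nu = int g^(tau) rho(tau) d tau with g^(tau) = int g(x) e^{-i tau x} dx\<close>
definition nu_int :: "real \<Rightarrow> (real \<Rightarrow> complex) \<Rightarrow> complex" where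
  "nu_int a g = (LINT \<tau>|lborel. (LINT x|lborel. g x * exp (- \<i> * of_real (\<tau> * x))) * of_real (rho a \<tau>))"

definition mu_int :: "real \<Rightarrow> (complex \<Rightarrow> complex) \<Rightarrow> complex" where
  "mu_int a F = nu_int a (\<lambda>x. LINT y|lborel. F (Complex x y))"

end

theory Submission
  imports Defs
    "HOL-Probability.Characteristic_Functions"
    "HOL-Probability.Sinc_Integral"
    "HOL-Complex_Analysis.Complex_Analysis"
begin

text \<open>The vacuum is the Gaussian \<open>C(t) exp(-x\<^sup>2/(4s))\<close> with \<open>s = 1 + i t\<close>, and
  \<open>\<xi> = A + A\<^sup>+ = 2i d/dx\<close> is symmetric, so that \<open>P \<mapsto> P(\<xi>) \<psi>\<^sub>0\<close> carries the polynomials with the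
  standard normal weight isometrically onto \<open>L\<^sub>0\<close>. Under it \<open>\<psi>\<^sub>n\<close> is a Hermite polynomial and
  \<open>g\<^sub>0\<close> is multiplication by \<open>W = a\<^sup>2 + \<xi>\<^sup>2/4\<close>, hence \<open>S\<inverse>\<close> is the matrix of \<open>1/W\<close>.

  The moments \<open>\<integral> z\<^sup>n (cnj z)\<^sup>k exp(-|z|\<^sup>2 - i \<tau> x) dx dy\<close> and the integrals of the Hermite products
  \<open>He\<^sub>n He\<^sub>k\<close> against \<open>exp(-i \<tau> \<xi>/2)\<close> satisfy the same recursion and differ by the factor
  \<open>\<pi> exp(-\<tau>\<^sup>2/8)\<close>. The Gaussian in \<open>\<rho>\<close> cancels this factor, and integrating the remaining
  \<open>exp(-a |\<tau>|)/(2a)\<close> over \<open>\<tau>\<close> produces \<open>1/W\<close>: this is the moment problem.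
  Since the bra of \<open>\<phi>\<^sub>z\<close> applied to \<open>L P(\<xi>) \<psi>\<^sub>0\<close> is the polynomial in \<open>cnj z\<close> whose coefficients are the
  Hermite coefficients of \<open>W P\<close>, the resolution of the identity reads
  \<open>\<integral> cnj(W P) (W Q) / W = \<integral> cnj P W Q\<close>.

  Finally, the series for \<open>\<psi>\<^sub>z\<close> is the Hermite generating function. In closed form \<open>\<psi>\<^sub>z\<close> is a
  Gaussian, and domain, equation of motion and membership in \<open>H\<^sub>1\<close> can be read off.\<close>

subsection \<open>Functions of Gaussian decay\<close>

text \<open>Since \<open>rho\<close> grows like exp(\<tau>^2/8), \<open>nu_int\<close> and
  \<open>mu_int\<close> are iterated integrals, and their order of integration matters: the
  y-integral and the Fourier transform in x have to be known exactly, as functions of \<tau>, before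
  Fubini can be used between \<tau> and \<xi>. The second obstacle is \<open>Sinv\<close>, where a
  choice operator picks some u in the graph of the closure of g_0. Such a u has to exist for every
  psi_k, and its scalar products with L_0 must not depend on the choice. The latter follows by
  testing against G/W. Existence amounts to approximating polynomials by multiples of W in the
  Gaussian norm. The device is cos(T\<xi>/2): bounded by 1 on the real axis, it has the large value
  cosh(aT) at the zeros 2ia and -2ia of W, so that a small multiple of it corrects the values there
  at little cost in norm. For H_1 the factorisation of g_0 through L turns the norm of L_1 into the
  plain L^2 norm, so dominated convergence suffices.\<close>

definition gdec :: "(real \<Rightarrow> complex) \<Rightarrow> bool" where
  "gdec f \<longleftrightarrow> continuous_on UNIV f \<and> (\<exists>K c. c > 0 \<and> (\<forall>x. cmod (f x) \<le> K * exp (- c * x\<^sup>2)))"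

lemma gdecI:
  "continuous_on UNIV f \<Longrightarrow> c > 0 \<Longrightarrow> (\<And>x. cmod (f x) \<le> K * exp (- c * x\<^sup>2)) \<Longrightarrow> gdec f"
  unfolding gdec_def by blast

lemma gdecE:
  assumes "gdec f"
  obtains K c where "K \<ge> 0" "c > 0" "\<And>x. cmod (f x) \<le> K * exp (- c * x\<^sup>2)"
proof -
  obtain K c where Kc: "c > 0" "\<And>x. cmod (f x) \<le> K * exp (- c * x\<^sup>2)"
    using assms unfolding gdec_def by blast
  have "K \<ge> 0" using Kc(2)[of 0] norm_ge_zero[of "f 0"] by (simp del: norm_ge_zero) 
  with Kc that show ?thesis by blast
qed

lemma gdec_cont: "gdec f \<Longrightarrow> continuous_on UNIV f"
  unfolding gdec_def by blast

lemma gdec_meas [measurable_dest]: "gdec f \<Longrightarrow> f \<in> borel_measurable borel"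
  by (rule borel_measurable_continuous_onI[OF gdec_cont])

lemma gdec_0 [simp]: "gdec (\<lambda>x. 0)"
  by (rule gdecI[where c=1 and K=0]) auto

lemma gdec_add:
  assumes "gdec f" "gdec g" shows "gdec (\<lambda>x. f x + g x)"
proof -
  from assms(1) obtain K c where 1: "K \<ge> 0" "c > 0" "\<And>x. cmod (f x) \<le> K * exp (- c * x\<^sup>2)"
    by (rule gdecE) blast
  from assms(2) obtain K' c' where 2: "K' \<ge> 0" "c' > 0" "\<And>x. cmod (g x) \<le> K' * exp (- c' * x\<^sup>2)"
    by (rule gdecE) blast
  show ?thesis
  proof (rule gdecI[where c="min c c'" and K="K + K'"])
    show "continuous_on UNIV (\<lambda>x. f x + g x)"
      using assms by (intro continuous_intros gdec_cont)
    fix x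
    have "cmod (f x + g x) \<le> K * exp (- c * x\<^sup>2) + K' * exp (- c' * x\<^sup>2)"
      using 1(3)[of x] 2(3)[of x] norm_triangle_ineq[of "f x" "g x"] by linarith
    also have "\<dots> \<le> K * exp (- min c c' * x\<^sup>2) + K' * exp (- min c c' * x\<^sup>2)"
      using 1 2 by (intro add_mono mult_left_mono) (auto intro!: mult_right_mono)
    finally show "cmod (f x + g x) \<le> (K + K') * exp (- min c c' * x\<^sup>2)"
      by (simp add: algebra_simps)
  qed (use 1 2 in auto)
qed

text \<open>Completing the square in c|x| - b: half of the decay rate absorbs the linear
  exponent.\<close>

lemma exp_linear_gauss:
  assumes "c > 0"
  shows "exp (b * \<bar>x\<bar>) * exp (- c * x\<^sup>2) \<le> exp (b\<^sup>2 / (2 * c)) * exp (- (c / 2) * (x::real)\<^sup>2)"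
proof -
  have "0 \<le> (c * \<bar>x\<bar> - b)\<^sup>2 / (2 * c)" using assms by simp
  also have "\<dots> = c / 2 * x\<^sup>2 - b * \<bar>x\<bar> + b\<^sup>2 / (2 * c)"
    using assms by (simp add: power2_eq_square field_simps)
  finally show ?thesis by (simp add: exp_add[symmetric] algebra_simps)
qed

text \<open>The closure property behind most others: bounded factors, x and exp(x w) all grow at
  most exponentially.\<close>

lemma gdec_mult_exp:
  assumes "gdec f" "continuous_on UNIV g" "\<And>x. cmod (g x) \<le> K * exp (b * \<bar>x\<bar>)"
  shows "gdec (\<lambda>x. g x * f x)"
proof -
  from assms(1) obtain K' c where 1: "K' \<ge> 0" "c > 0" "\<And>x. cmod (f x) \<le> K' * exp (- c * x\<^sup>2)"
    by (rule gdecE) blast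
  have K: "K \<ge> 0" using assms(3)[of 0] norm_ge_zero[of "g 0"] by (simp del: norm_ge_zero)
  show ?thesis
  proof (rule gdecI[where c="c/2" and K="K * K' * exp (b\<^sup>2 / (2 * c))"])
    show "continuous_on UNIV (\<lambda>x. g x * f x)"
      using assms(2) gdec_cont[OF assms(1)] by (intro continuous_intros)
    fix x
    have "cmod (g x * f x) \<le> (K * exp (b * \<bar>x\<bar>)) * (K' * exp (- c * x\<^sup>2))"
      unfolding norm_mult using assms(3) 1 K by (intro mult_mono) auto
    also have "\<dots> = K * K' * (exp (b * \<bar>x\<bar>) * exp (- c * x\<^sup>2))" by simp
    also have "\<dots> \<le> K * K' * (exp (b\<^sup>2 / (2 * c)) * exp (- (c / 2) * x\<^sup>2))"
      using K 1 exp_linear_gauss[OF 1(2)] by (intro mult_left_mono) auto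
    finally show "cmod (g x * f x) \<le> K * K' * exp (b\<^sup>2 / (2 * c)) * exp (- (c / 2) * x\<^sup>2)"
      by simp
  qed (use 1 in auto)
qed

lemma gdec_mult_bdd:
  assumes "gdec f" "continuous_on UNIV g" "\<And>x. cmod (g x) \<le> K"
  shows "gdec (\<lambda>x. g x * f x)"
  by (rule gdec_mult_exp[where K=K and b=0, OF assms(1)]) (use assms in auto)

lemma gdec_cmult: "gdec f \<Longrightarrow> gdec (\<lambda>x. c * f x)"
  by (rule gdec_mult_bdd[where K="cmod c"]) auto

lemma gdec_uminus: "gdec f \<Longrightarrow> gdec (\<lambda>x. - f x)"
  using gdec_cmult[of f "-1"] by simp

lemma gdec_diff: "gdec f \<Longrightarrow> gdec g \<Longrightarrow> gdec (\<lambda>x. f x - g x)"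
  using gdec_add[OF _ gdec_uminus, of f g] by simp

lemma gdec_bounded:
  assumes "gdec f" obtains K where "\<And>x. cmod (f x) \<le> K"
proof -
  from assms obtain K c where 1: "K \<ge> 0" "c > 0" "\<And>x. cmod (f x) \<le> K * exp (- c * x\<^sup>2)"
    by (rule gdecE) blast
  have "cmod (f x) \<le> K" for x
  proof -
    have "K * exp (- c * x\<^sup>2) \<le> K * 1" using 1 by (intro mult_left_mono) auto
    with 1(3)[of x] show ?thesis by simp
  qed
  with that show ?thesis by blast
qed

lemma gdec_mult:
  assumes "gdec f" "gdec g" shows "gdec (\<lambda>x. f x * g x)"
proof -
  obtain K where K: "\<And>x. cmod (f x) \<le> K" using gdec_bounded[OF assms(1)] by blast
  show ?thesis by (rule gdec_mult_bdd[OF assms(2) gdec_cont[OF assms(1)] K])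
qed

lemma gdec_cnj: "gdec f \<Longrightarrow> gdec (\<lambda>x. cnj (f x))"
  unfolding gdec_def by (auto intro: continuous_intros)

lemma gdec_x: assumes "gdec f" shows "gdec (\<lambda>x. of_real x * f x)"
proof (rule gdec_mult_exp[where K=1 and b=1, OF assms])
  show "cmod (of_real x) \<le> 1 * exp (1 * \<bar>x\<bar>)" for x
    using exp_ge_add_one_self[of "\<bar>x\<bar>"] by (simp del: exp_ge_add_one_self)
qed (auto intro: continuous_intros)

lemma gdec_poly:
  assumes "gdec f" shows "gdec (\<lambda>x. poly p (of_real x) * f x)"
proof (induction p)
  case (pCons c p)
  have "gdec (\<lambda>x. c * f x + of_real x * (poly p (of_real x) * f x))"
    by (intro gdec_add gdec_cmult gdec_x pCons assms)
  then show ?case by (simp add: algebra_simps)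
qed auto

lemma gdec_gauss:
  assumes "Re k > 0"
  shows "gdec (\<lambda>x. exp (of_real x * w - k * of_real (x\<^sup>2)))"
proof -
  have "gdec (\<lambda>x. exp (- k * of_real (x\<^sup>2)))"
    by (rule gdecI[where K=1 and c="Re k"]) (use assms in \<open>auto intro!: continuous_intros\<close>)
  then have "gdec (\<lambda>x. exp (of_real x * w) * exp (- k * of_real (x\<^sup>2)))"
  proof (rule gdec_mult_exp[where K=1 and b="cmod w"])
    fix x 
    have "x * Re w \<le> \<bar>x\<bar> * \<bar>Re w\<bar>" by (metis abs_ge_self abs_mult)
    also have "\<dots> \<le> \<bar>x\<bar> * cmod w" using abs_Re_le_cmod by (intro mult_left_mono) auto
    finally show "cmod (exp (of_real x * w)) \<le> 1 * exp (cmod w * \<bar>x\<bar>)"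
      by (simp add: mult_ac)
  qed (auto intro!: continuous_intros)
  then show ?thesis by (simp add: exp_diff exp_minus field_simps)
qed

lemma integrable_gauss: "c > 0 \<Longrightarrow> integrable lborel (\<lambda>x::real. exp (- c * x\<^sup>2))"
proof -
  assume c: "c > 0"
  have "integrable lborel (\<lambda>x. normal_density 0 (1 / sqrt (2 * c)) x)"
    using c by (intro integrable_normal_density) auto
  then have "integrable lborel (\<lambda>x. sqrt (2 * pi * (1 / sqrt (2 * c))\<^sup>2) * normal_density 0 (1 / sqrt (2 * c)) x)"
    by simp
  moreover have "(\<lambda>x. sqrt (2 * pi * (1 / sqrt (2 * c))\<^sup>2) * normal_density 0 (1 / sqrt (2 * c)) x) = (\<lambda>x. exp (- c * x\<^sup>2))"
    unfolding normal_density_def using c by (auto simp: power_divide fun_eq_iff field_simps)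
  ultimately show ?thesis by simp
qed

lemma gdec_integrable: assumes "gdec f" shows "integrable lborel f"
proof -
  from assms obtain K c where 1: "K \<ge> 0" "c > 0" "\<And>x. cmod (f x) \<le> K * exp (- c * x\<^sup>2)"
    by (rule gdecE) blast
  show ?thesis
  proof (rule Bochner_Integration.integrable_bound)
    show "integrable lborel (\<lambda>x. K * exp (- c * x\<^sup>2))"
      using integrable_gauss[OF 1(2)] by simp
    show "f \<in> borel_measurable lborel" using gdec_meas[OF assms] by simp
    show "AE x in lborel. norm (f x) \<le> norm (K * exp (- c * x\<^sup>2))"
      using 1 by (intro AE_I2) simp
  qed
qed

lemma gdec_norm_sq: "gdec f \<Longrightarrow> gdec (\<lambda>x. of_real ((cmod (f x))\<^sup>2))"
  using gdec_mult[OF gdec_cnj, of f f] by (simp add: complex_norm_square mult.commute del: of_real_power)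

lemma gdec_integrable_sq: assumes "gdec f" shows "integrable lborel (\<lambda>x. (cmod (f x))\<^sup>2)"
  using integrable_Re[OF gdec_integrable[OF gdec_norm_sq[OF assms]]] by simp

lemma gdec_sq_int: "gdec f \<Longrightarrow> sq_int f"
  unfolding sq_int_def using gdec_meas gdec_integrable_sq by simp

lemma gauss_tendsto:
  assumes "c > 0"
  shows "((\<lambda>x::real. K * exp (- c * x\<^sup>2)) \<longlongrightarrow> 0) at_top" "((\<lambda>x::real. K * exp (- c * x\<^sup>2)) \<longlongrightarrow> 0) at_bot"
  using assms by real_asymp+

lemma gdec_tendsto:
  assumes "gdec f" shows "(f \<longlongrightarrow> 0) at_top" "(f \<longlongrightarrow> 0) at_bot"
proof -
  from assms obtain K c where 1: "K \<ge> 0" "c > 0" "\<And>x. cmod (f x) \<le> K * exp (- c * x\<^sup>2)"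
    by (rule gdecE) blast
  show "(f \<longlongrightarrow> 0) at_top"
    by (rule Lim_null_comparison[OF _ gauss_tendsto(1)[OF 1(2), of K]]) (use 1 in auto)
  show "(f \<longlongrightarrow> 0) at_bot"
    by (rule Lim_null_comparison[OF _ gauss_tendsto(2)[OF 1(2), of K]]) (use 1 in auto)
qed

text \<open>Source of the integrations by parts over the whole line: Gaussian decay kills both
  boundary terms.\<close>

lemma gdec_integral_deriv:
  assumes F: "gdec F" and f: "gdec f" and d: "\<And>x. (F has_vector_derivative f x) (at x)"
  shows "(LINT x|lborel. f x) = 0"
proof -
  have "(LBINT x=-\<infinity>..\<infinity>. f x) = 0 - 0"
  proof (rule interval_integral_FTC_integrable[where F=F])
    show "isCont f x" for x using gdec_cont[OF f] by (simp add: continuous_on_eq_continuous_at)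
    show "set_integrable lborel (einterval (- \<infinity>) \<infinity>) f"
      using gdec_integrable[OF f] by (simp add: set_integrable_def)
    show "((F \<circ> real_of_ereal) \<longlongrightarrow> 0) (at_right (- \<infinity>))"
      using gdec_tendsto(2)[OF F] by (simp add: ereal_tendsto_simps)
    show "((F \<circ> real_of_ereal) \<longlongrightarrow> 0) (at_left \<infinity>)"
      using gdec_tendsto(1)[OF F] by (simp add: ereal_tendsto_simps)
  qed (use d in auto)
  then show ?thesis by (simp add: interval_lebesgue_integral_def set_lebesgue_integral_def)
qed

section \<open>Integration by parts and linearity for the L^2 scalar product\<close>

lemma ip0_ibp:
  assumes "gdec f" "gdec g" "gdec f'" "gdec g'"
    and "\<And>x. (f has_vector_derivative f' x) (at x)" "\<And>x. (g has_vector_derivative g' x) (at x)"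
  shows "ip0 f' g = - ip0 f g'"
proof -
  have "(LINT x|lborel. cnj (f' x) * g x + cnj (f x) * g' x) = 0"
  proof (rule gdec_integral_deriv[where F="\<lambda>x. cnj (f x) * g x"])
    show "((\<lambda>x. cnj (f x) * g x) has_vector_derivative cnj (f' x) * g x + cnj (f x) * g' x) (at x)" for x
      using has_vector_derivative_mult[OF has_vector_derivative_cnj[OF assms(5)] assms(6), of x]
      by (simp add: algebra_simps)
  qed (use assms in \<open>auto intro!: gdec_add gdec_mult gdec_cnj\<close>)
  then show ?thesis unfolding ip0_def
    by (subst (asm) Bochner_Integration.integral_add)
       (use assms in \<open>auto intro!: gdec_integrable gdec_mult gdec_cnj simp: eq_neg_iff_add_eq_0\<close>)
qed

lemma ip0_add_right: "gdec f \<Longrightarrow> gdec g \<Longrightarrow> gdec h \<Longrightarrow> ip0 f (\<lambda>x. g x + h x) = ip0 f g + ip0 f h"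
  unfolding ip0_def
  by (subst Bochner_Integration.integral_add[symmetric])
     (auto intro!: gdec_integrable gdec_mult gdec_cnj simp: algebra_simps)

lemma ip0_cmult_right: "ip0 f (\<lambda>x. c * g x) = c * ip0 f g"
  unfolding ip0_def by (simp add: mult.left_commute)

lemma ip0_cmult_left: "ip0 (\<lambda>x. c * f x) g = cnj c * ip0 f g"
  unfolding ip0_def by (simp add: mult.assoc)

lemma ip0_cnj: "ip0 g f = cnj (ip0 f g)"
  unfolding ip0_def by (simp add: mult.commute flip: Bochner_Integration.integral_cnj)

lemma ip0_self: "ip0 f f = of_real (LINT x|lborel. (cmod (f x))\<^sup>2)"
  unfolding ip0_def integral_complex_of_real[symmetric]
  by (intro Bochner_Integration.integral_cong) (auto simp: complex_norm_square mult.commute simp del: of_real_power)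

subsection \<open>Gaussian moments of polynomials\<close>

definition gw :: "real \<Rightarrow> complex" where
  "gw x = of_real (exp (- x\<^sup>2 / 2) / sqrt (2 * pi))"

definition gm :: "complex poly \<Rightarrow> complex" where
  "gm P = (LINT x|lborel. poly P (of_real x) * gw x)"

definition cpoly :: "complex poly \<Rightarrow> complex poly" where
  "cpoly P = map_poly cnj P"

text \<open>The probabilists' Hermite polynomials, generated by P -> \<xi> P - P' because this is
  how A^+ acts on P(\<xi>) psi_0 (\<open>el_Aplus\<close>).\<close>

fun He :: "nat \<Rightarrow> complex poly" where
  "He 0 = 1"
| "He (Suc n) = pCons 0 (He n) - pderiv (He n)"

lemma gw_gdec: "gdec gw"
proof -
  have "gdec (\<lambda>x. of_real (1 / sqrt (2 * pi)) * exp (of_real x * 0 - (1/2) * of_real (x\<^sup>2)))"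
    by (intro gdec_cmult gdec_gauss) simp
  then show ?thesis unfolding gw_def by (simp add: exp_of_real[symmetric] field_simps)
qed

lemma gw_std: "gw x = of_real (std_normal_density x)"
  by (simp add: gw_def normal_density_def)

lemma gw_int: "(LINT x|lborel. gw x) = 1"
  unfolding gw_std integral_complex_of_real using integral_std_normal_moment_even[of 0] by simp

lemma gw_deriv: "(gw has_vector_derivative - of_real x * gw x) (at x)"
proof -
  have gw: "gw = (\<lambda>x. of_real (1 / sqrt (2 * pi)) * exp (- (of_real x)\<^sup>2 / 2))"
    by (simp add: gw_def fun_eq_iff exp_of_real[symmetric])
  show ?thesis unfolding gw
    by (rule has_vector_derivative_real_field) (auto intro!: derivative_eq_intros)
qed

lemma poly_deriv_real:
  "((\<lambda>x. poly p (of_real x)) has_vector_derivative poly (pderiv p) (of_real x)) (at (x::real))" for p :: "complex poly"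
  by (rule has_vector_derivative_real_field) (rule poly_DERIV)

lemma gm_add: "gm (P + Q) = gm P + gm Q"
  unfolding gm_def
  by (subst Bochner_Integration.integral_add[symmetric])
     (auto intro!: gdec_integrable gdec_poly gw_gdec simp: distrib_right)

lemma gm_smult: "gm (smult c P) = c * gm P"
  unfolding gm_def by (simp add: mult.assoc)

lemma gm_ibp: "gm (pCons 0 P) = gm (pderiv P)"
proof -
  have "(LINT x|lborel. poly (pderiv P) (of_real x) * gw x - of_real x * poly P (of_real x) * gw x) = 0"
  proof (rule gdec_integral_deriv[where F="\<lambda>x. poly P (of_real x) * gw x"])
    show "((\<lambda>x. poly P (of_real x) * gw x) has_vector_derivative
        poly (pderiv P) (of_real x) * gw x - of_real x * poly P (of_real x) * gw x) (at x)" for x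
      using has_vector_derivative_mult[OF poly_deriv_real[of P] gw_deriv, of x]
      by (simp add: algebra_simps)
    show "gdec (\<lambda>x. poly (pderiv P) (of_real x) * gw x - of_real x * poly P (of_real x) * gw x)"
      using gdec_diff[OF gdec_poly[OF gw_gdec, of "pderiv P"] gdec_poly[OF gw_gdec, of "pCons 0 P"]] by simp
  qed (intro gdec_poly gw_gdec)
  moreover have "(LINT x|lborel. poly (pderiv P) (of_real x) * gw x - of_real x * poly P (of_real x) * gw x)
     = gm (pderiv P) - gm (pCons 0 P)"
    unfolding gm_def
    by (subst Bochner_Integration.integral_diff[symmetric])
       (use gdec_poly[OF gw_gdec, of "pCons 0 P"] in \<open>auto intro!: gdec_integrable gdec_poly gw_gdec\<close>)
  ultimately show ?thesis by simp
qed

text \<open>For P = c + \<xi> Q the last rule trades \<xi> Q for Q', which has smaller degree, so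
  the value at 1 decides everything. This will identify vacuum expectations with Gaussian moments
  without evaluating the amplitude of the vacuum.\<close>

lemma gm_unique:
  fixes l :: "complex poly \<Rightarrow> complex"
  assumes add: "\<And>P Q. l (P + Q) = l P + l Q" and smult: "\<And>c P. l (smult c P) = c * l P"
    and one: "l 1 = 1" and ibp: "\<And>P. l (pCons 0 P) = l (pderiv P)"
  shows "l P = gm P"
proof (induction "degree P" arbitrary: P rule: less_induct)
  case less
  have 0: "l 0 = 0" "gm 0 = 0" using smult[of 0 0] gm_smult[of 0 0] by auto
  have 1: "gm 1 = 1" unfolding gm_def using gw_int by simp
  obtain c Q where P: "P = pCons c Q" by (cases P)
  have eq: "P = smult c 1 + pCons 0 Q" unfolding P by simp
  have "l (pderiv Q) = gm (pderiv Q)"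
  proof (cases "Q = 0")
    case False
    then show ?thesis using less[of "pderiv Q"] by (simp add: P degree_pderiv)
  qed (simp add: 0)
  then show ?case unfolding eq add gm_add smult gm_smult ibp gm_ibp one 1 by simp
qed

lemma cpoly_0 [simp]: "cpoly 0 = 0" unfolding cpoly_def by simp

lemma cpoly_pCons [simp]: "cpoly (pCons c P) = pCons (cnj c) (cpoly P)"
  unfolding cpoly_def by (cases "c = 0 \<and> P = 0") (auto simp: map_poly_pCons)

lemma poly_cpoly: "poly (cpoly P) (of_real x) = cnj (poly P (of_real x))"
  by (induction P) auto

lemma cpoly_add: "cpoly (P + Q) = cpoly P + cpoly Q"
  by (rule poly_eqI) (simp add: cpoly_def coeff_map_poly)

lemma cpoly_smult: "cpoly (smult c P) = smult (cnj c) (cpoly P)"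
  by (rule poly_eqI) (simp add: cpoly_def coeff_map_poly)

lemma He_real: "cpoly (He n) = He n"
proof -
  have pd: "pderiv (cpoly P) = cpoly (pderiv P)" for P
    by (rule poly_eqI) (simp add: cpoly_def coeff_pderiv coeff_map_poly)
  have df: "cpoly (P - Q) = cpoly P - cpoly Q" for P Q
    by (rule poly_eqI) (simp add: cpoly_def coeff_map_poly)
  show ?thesis
    by (induction n) (simp_all add: one_pCons pd[symmetric] df)
qed

lemma pderiv_He: "pderiv (He (Suc n)) = smult (of_nat (Suc n)) (He n)"
proof (induction n)
  case (Suc n)
  have "pderiv (He (Suc (Suc n))) = He (Suc n) + pCons 0 (pderiv (He (Suc n))) - pderiv (pderiv (He (Suc n)))"
    by (simp only: He.simps(2)[of "Suc n"] pderiv_diff pderiv_pCons)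
  also have "\<dots> = He (Suc n) + smult (of_nat (Suc n)) (pCons 0 (He n) - pderiv (He n))"
    by (simp only: Suc) (simp add: pderiv_smult smult_diff_right)
  also have "pCons 0 (He n) - pderiv (He n) = He (Suc n)" by simp
  also have "He (Suc n) + smult (of_nat (Suc n)) (He (Suc n)) = smult (of_nat (Suc (Suc n))) (He (Suc n))"
    by (metis smult_add_left smult_1_left of_nat_Suc)
  finally show ?case .
qed (simp add: pderiv_pCons one_pCons)

text \<open>With respect to the Gaussian weight P -> \<xi> P - P' is the adjoint of differentiation
  (\<open>gm_ibp\<close>), so n raising steps become n derivatives of the other factor.\<close>

lemma He_adj: "gm (He n * P) = gm ((pderiv ^^ n) P)"
proof (induction n arbitrary: P)
  case (Suc n)
  have "gm (He (Suc n) * P) = gm (pCons 0 (He n * P)) - gm (pderiv (He n) * P)"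
    using gm_add[of "He (Suc n) * P" "pderiv (He n) * P"] by (simp add: algebra_simps)
  also have "gm (pCons 0 (He n * P)) = gm (pderiv (He n) * P) + gm (He n * pderiv P)"
    unfolding gm_ibp pderiv_mult gm_add by (simp add: mult.commute)
  finally show ?case by (simp add: Suc funpow_Suc_right del: funpow.simps He.simps)
qed auto

text \<open>The span contains 1 and is stable under multiplication by \<xi>, by the three-term
  recurrence \<xi> He_n = He_(n+1) + n He_(n-1).\<close>

lemma He_span: "\<exists>N c. P = (\<Sum>n<N. smult (c n) (He n))"
proof -
  define S where "S = {P. \<exists>N c. P = (\<Sum>n<N. smult (c n) (He n))}"
  have He: "smult d (He n) \<in> S" for d n
    unfolding S_def
    by (rule CollectI, rule exI[of _ "Suc n"], rule exI[of _ "\<lambda>k. if k = n then d else 0"])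
       (simp add: if_distrib[of "\<lambda>c. smult c _"] cong: if_cong)
  \<comment> \<open>Padding with zero coefficients brings two expansions to a common length before
    they are added.\<close>
  have ext: "\<exists>c'. \<forall>M\<ge>N. (\<Sum>n<N. smult (c n) (He n)) = (\<Sum>n<M. smult (c' n) (He n))" for N c
  proof (rule exI[of _ "\<lambda>n. if n < N then c n else 0"], intro allI impI)
    fix M assume M: "N \<le> M"
    show "(\<Sum>n<N. smult (c n) (He n)) = (\<Sum>n<M. smult (if n < N then c n else 0) (He n))"
      by (rule sum.mono_neutral_cong_left) (use M in auto)
  qed
  have add: "P + Q \<in> S" if PQ: "P \<in> S" "Q \<in> S" for P Q
  proof -
    obtain N c M d where P: "P = (\<Sum>n<N. smult (c n) (He n))" and Q: "Q = (\<Sum>n<M. smult (d n) (He n))"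
      using PQ unfolding S_def by auto
    obtain c' d' where c': "\<forall>K\<ge>N. P = (\<Sum>n<K. smult (c' n) (He n))" and
      d': "\<forall>K\<ge>M. Q = (\<Sum>n<K. smult (d' n) (He n))" using ext[of N c] ext[of M d] unfolding P Q by blast
    have P': "P = (\<Sum>n<max N M. smult (c' n) (He n))" and Q': "Q = (\<Sum>n<max N M. smult (d' n) (He n))"
      using c' d' by auto
    have "P + Q = (\<Sum>n<max N M. smult (c' n + d' n) (He n))"
      by (subst P', subst Q') (simp add: smult_add_left sum.distrib)
    then show ?thesis unfolding S_def mem_Collect_eq by (intro exI)
  qed
  have sm: "(\<Sum>n<N. F n) \<in> S" if "\<And>n. n < N \<Longrightarrow> F n \<in> S" for N :: nat and F
    using that
  proof (induction N)
    case 0 show ?case using He[of 0 0] by simp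
  qed (simp add: add)
  have xi: "pCons 0 P \<in> S" if P: "P \<in> S" for P
  proof -
    obtain N c where P: "P = (\<Sum>n<N. smult (c n) (He n))"
      using P unfolding S_def by auto
    have "pCons 0 (smult (c n) (He n)) \<in> S" for n
    proof (cases n)
      case 0
      have "pCons 0 (smult (c n) (He n)) = smult (c n) (He 1)" by (simp add: 0 one_pCons)
      then show ?thesis using He by metis
    next
      case (Suc m)
      have "pCons 0 (smult (c n) (He n)) = smult (c n) (He (Suc n)) + smult (c n * of_nat n) (He m)"
        using pderiv_He[of m] by (simp add: Suc smult_diff_right del: He.simps(2)) (simp add: smult_diff_right)
      then show ?thesis using add He by metis
    qed
    then have "(\<Sum>n<N. pCons 0 (smult (c n) (He n))) \<in> S" by (intro sm)
    moreover have "(\<Sum>n<N. pCons 0 (smult (c n) (He n))) = pCons 0 P"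
      unfolding P by (induction N) auto
    ultimately show ?thesis by simp
  qed
  have "P \<in> S"
  proof (induction P)
    case 0 show ?case using He[of 0 0] by simp
  next
    case (pCons c P)
    have "pCons c P = smult c (He 0) + pCons 0 P" by simp
    then show ?case using add[OF He xi[OF pCons(2)]] by metis
  qed
  then show ?thesis unfolding S_def by blast
qed

text \<open>Orthogonality with squared norm m!: by \<open>He_adj\<close> the pairing with He_n is
  the mean of its m-th derivative, a multiple of He_(n-m) if m <= n and 0 otherwise, and He_k has
  mean 0 for k > 0. The value 0 for m >= N will make the series in \<open>braphi\<close>
  finite.\<close>

lemma He_coeff:
  assumes "P = (\<Sum>n<N. smult (c n) (He n))"
  shows "gm (He m * P) = (if m < N then fact m * c m else 0)"
proof -
  have D: "gm ((pderiv ^^ m) (He n)) = (if m = n then fact m else 0)" for m n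
  proof (induction m arbitrary: n)
    case 0
    show ?case
    proof (cases n)
      case (Suc k)
      have "gm (He (Suc k)) = 0"
        using gm_add[of "He (Suc k)" "pderiv (He k)"] gm_ibp[of "He k"] by simp
      then show ?thesis by (simp add: Suc del: He.simps)
    qed (use gm_unique[where l=gm] gw_int in \<open>simp add: gm_def\<close>)
  next
    case (Suc m)
    show ?case
    proof (cases n)
      case 0
      have "(pderiv ^^ m) 0 = (0::complex poly)" by (induction m) auto
      then show ?thesis using gm_smult[of 0 0] by (simp add: 0 funpow_Suc_right del: funpow.simps)
    next
      case (Suc k)
      have sm: "(pderiv ^^ m) (smult c Q) = smult c ((pderiv ^^ m) Q)" for c and Q :: "complex poly"
        by (induction m) (auto simp: pderiv_smult)
      show ?thesis using Suc.IH[of k]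
        by (simp add: \<open>n = Suc k\<close> funpow_Suc_right pderiv_He sm gm_smult del: funpow.simps He.simps)
    qed
  qed
  have "gm (He m * P) = (\<Sum>n<N. c n * gm (He m * He n))"
    unfolding assms
  proof (induction N)
    case 0 show ?case using gm_smult[of 0 0] by simp
  qed (simp add: gm_add gm_smult algebra_simps)
  also have "\<dots> = (\<Sum>n<N. if n = m then fact m * c m else 0)"
    by (rule sum.cong) (auto simp: He_adj D)
  finally show ?thesis by simp
qed

subsection \<open>The free states as polynomials in \<open>\<xi> = A + A\<^sup>+ = 2i d/dx\<close> applied to the vacuum\<close>

text \<open>Everything at one fixed time. The amplitude C remains unknown: here it is controlled by
  the normalisation alone, and later only its time derivative is computed.\<close>

locale gaussian_vacuum =
  fixes \<psi>0 :: "real \<Rightarrow> real \<Rightarrow> complex" and t :: real and C :: complex and a :: real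
  assumes a_pos: "a > 0"
    and psi0: "\<And>x. \<psi>0 x t = C * exp (- of_real (x\<^sup>2) / (4 * Complex 1 t))"
    and psi0_norm: "ip0 (slice \<psi>0 t) (slice \<psi>0 t) = 1"
begin

abbreviation s :: complex where "s \<equiv> Complex 1 t"

definition g :: "real \<Rightarrow> complex" where
  "g x = C * exp (- of_real (x\<^sup>2) / (4 * s))"

text \<open>2i d/dx conjugated by the Gaussian: 2i (q g)' = (\<open>Xi\<close> q) g, because g' =
  -x/(2s) g.\<close>

definition Xi :: "complex poly \<Rightarrow> complex poly" where
  "Xi q = smult (2 * \<i>) (pderiv q) - smult (\<i> / s) (pCons 0 q)"

text \<open>\<open>el P = P(\<xi>) \<psi>\<^sub>0\<close>, whose polynomial factor in \<open>x\<close> is \<open>U P\<close>\<close>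
definition U :: "complex poly \<Rightarrow> complex poly" where
  "U P = fold_coeffs (\<lambda>c q. [:c:] + Xi q) P 0"

definition el :: "complex poly \<Rightarrow> real \<Rightarrow> complex" where
  "el P x = poly (U P) (of_real x) * g x"

lemma s_nz [simp]: "s \<noteq> 0"
  by (simp add: complex_eq_iff)

lemma Re_inv_s: "Re (1 / (4 * s)) > 0"
  by (simp add: Re_divide field_simps power2_eq_square add_pos_nonneg)

lemma g_slice: "slice \<psi>0 t = g"
  by (auto simp: slice_def g_def psi0)

lemma g_gdec: "gdec g"
proof -
  have "gdec (\<lambda>x. C * exp (of_real x * 0 - 1 / (4 * s) * of_real (x\<^sup>2)))"
    by (intro gdec_cmult gdec_gauss Re_inv_s)
  then show ?thesis unfolding g_def by simp
qed

lemma g_deriv: "(g has_vector_derivative - of_real x / (2 * s) * g x) (at x)"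
proof -
  have "((\<lambda>x. C * exp (- (of_real x)\<^sup>2 / (4 * s))) has_vector_derivative
      - of_real x / (2 * s) * (C * exp (- (of_real x)\<^sup>2 / (4 * s)))) (at x)"
    by (rule has_vector_derivative_real_field) (auto intro!: derivative_eq_intros simp: field_simps)
  then show ?thesis unfolding g_def[abs_def] by simp
qed

lemma Xi_0 [simp]: "Xi 0 = 0" by (simp add: Xi_def)

lemma Xi_add: "Xi (p + q) = Xi p + Xi q"
  by (rule poly_eqI) (simp add: Xi_def pderiv_add coeff_pCons algebra_simps split: nat.split)

lemma Xi_smult: "Xi (smult c p) = smult c (Xi p)"
  by (simp add: Xi_def pderiv_smult smult_diff_right mult.commute)

lemma U_0 [simp]: "U 0 = 0" by (simp add: U_def)

lemma U_pCons: "U (pCons c P) = [:c:] + Xi (U P)"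
  by (cases "c = 0 \<and> P = 0") (auto simp: U_def fold_coeffs_pCons_coeff_not_0_eq fold_coeffs_pCons_not_0_0_eq)

lemma U_1 [simp]: "U 1 = 1" by (simp add: one_pCons U_pCons)

lemma U_add: "U (P + Q) = U P + U Q"
proof (induction P arbitrary: Q)
  case (pCons c P)
  obtain d Q' where Q: "Q = pCons d Q'" by (cases Q)
  show ?case unfolding Q add_pCons U_pCons pCons(2) Xi_add by (simp add: algebra_simps)
qed simp

lemma U_smult: "U (smult c P) = smult c (U P)"
  by (induction P) (auto simp: U_pCons Xi_smult smult_add_right)

text \<open>On polynomial factors A acts as i s d/dx, and its commutator with \<open>Xi\<close> is
  1. As A annihilates the vacuum, it therefore acts as differentiation with respect to
  \<xi>.\<close>

lemma pderiv_U: "smult (\<i> * s) (pderiv (U P)) = U (pderiv P)"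
proof (induction P)
  case (pCons c P)
  have X: "smult (\<i> * s) (pderiv (Xi q)) = Xi (smult (\<i> * s) (pderiv q)) + q" for q
    by (simp add: Xi_def pderiv_diff pderiv_smult pderiv_pCons smult_diff_right smult_add_right mult.commute algebra_simps)
  show ?case unfolding U_pCons pderiv_add pderiv_pCons U_add
    using X[of "U P"] by (simp add: pCons(2) pderiv_pCons algebra_simps)
qed simp

lemma el_add: "el (P + Q) x = el P x + el Q x"
  by (simp add: el_def U_add distrib_right)

lemma el_smult: "el (smult c P) x = c * el P x"
  by (simp add: el_def U_smult)

lemma el_0 [simp]: "el 0 x = 0" by (simp add: el_def)

lemma el_1: "el 1 = g" by (simp add: el_def fun_eq_iff)

lemma el_diff: "el (P - Q) x = el P x - el Q x"
  using el_add[of "P - Q" Q x] by simp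

lemma el_sum: "el (\<Sum>i\<in>A. f i) x = (\<Sum>i\<in>A. el (f i) x)"
  by (induction A rule: infinite_finite_induct) (auto simp: el_add)

lemma el_gdec: "gdec (el P)"
  unfolding el_def[abs_def] by (intro gdec_poly g_gdec)

lemma el_deriv: "(el P has_vector_derivative (- \<i> / 2) * el (pCons 0 P) x) (at x)"
proof -
  have "(el P has_vector_derivative poly (U P) (of_real x) * (- of_real x / (2 * s) * g x) +
      poly (pderiv (U P)) (of_real x) * g x) (at x)"
    unfolding el_def[abs_def] by (rule has_vector_derivative_mult[OF poly_deriv_real g_deriv])
  moreover have "poly (U P) (of_real x) * (- of_real x / (2 * s) * g x) +
      poly (pderiv (U P)) (of_real x) * g x = (- \<i> / 2) * el (pCons 0 P) x"
    by (simp add: el_def U_pCons Xi_def field_simps)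
  ultimately show ?thesis by simp
qed

lemma el_d1: "d1 (el P) = (\<lambda>x. (- \<i> / 2) * el (pCons 0 P) x)"
  unfolding d1_def by (rule ext, rule vector_derivative_at, rule el_deriv)

lemma el_d1_deriv: "(el P has_vector_derivative d1 (el P) x) (at x)"
  unfolding el_d1 by (rule el_deriv)

lemma el_d1': "d1 (el P) = el (smult (- \<i> / 2) (pCons 0 P))"
  unfolding el_d1 el_smult[abs_def] by simp

text \<open>A^+ = \<xi> - A, with A acting as d/d\<xi>.\<close>

lemma el_Aplus:
  "(\<i> + of_real t) * d1 (el P) x - \<i> * of_real (x / 2) * el P x = el (pCons 0 P - pderiv P) x"
proof -
  have t: "\<i> + of_real t = \<i> * (2 - s)" by (simp add: complex_eq_iff)
  have "\<i> * s * (poly (pderiv (U P)) (of_real x)) = poly (U (pderiv P)) (of_real x)"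
    by (simp flip: pderiv_U)
  then show ?thesis unfolding t el_d1 el_diff
    by (simp add: el_def U_pCons Xi_def field_simps)
qed

lemma psin_el: "psin \<psi>0 n x t = of_real (1 / sqrt (fact n)) * el (He n) x"
proof -
  have "(\<lambda>x. (Aplus ^^ n) \<psi>0 x t) = el (He n)"
  proof (induction n)
    case 0 then show ?case using g_slice by (simp add: slice_def el_1)
  next
    case (Suc n)
    have "(Aplus ^^ Suc n) \<psi>0 x t = el (He (Suc n)) x" for x
      using fun_cong[OF Suc, of x] Suc el_Aplus[of "He n" x]
      by (simp add: Aplus_def[of "(Aplus ^^ n) \<psi>0"] dx_def d1_def)
    then show ?case by blast
  qed
  then show ?thesis by (simp add: psin_def fun_eq_iff)
qed

lemma slice_psin: "slice (psin \<psi>0 n) t = el (smult (of_real (1 / sqrt (fact n))) (He n))"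
  by (auto simp: slice_def psin_el el_smult[abs_def])

lemma el_xi_sym: "ip0 (el (pCons 0 P)) (el Q) = ip0 (el P) (el (pCons 0 Q))"
proof -
  have "ip0 (\<lambda>x. (- \<i> / 2) * el (pCons 0 P) x) (el Q) = - ip0 (el P) (\<lambda>x. (- \<i> / 2) * el (pCons 0 Q) x)"
    by (rule ip0_ibp) (intro el_gdec gdec_cmult el_deriv)+
  then show ?thesis unfolding ip0_cmult_left ip0_cmult_right by simp
qed

lemma ip0_el_add: "ip0 f (el (P + Q)) = ip0 f (el P) + ip0 f (el Q)" if "gdec f"
  unfolding el_add[abs_def] by (intro ip0_add_right that el_gdec)

lemma ip0_el_smult: "ip0 f (el (smult c P)) = c * ip0 f (el P)"
  unfolding el_smult[abs_def] by (rule ip0_cmult_right)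

text \<open>The rule required by \<open>gm_unique\<close> says that psi_0 is orthogonal to A^+ f for
  f in L_0, which holds because A^+ is the adjoint of A and A psi_0 = 0.\<close>

lemma ip0_vacuum: "ip0 g (el P) = gm P"
proof (rule gm_unique)
  show "ip0 g (el 1) = 1" using psi0_norm by (simp add: el_1 g_slice)
  show "ip0 g (el (pCons 0 P)) = ip0 g (el (pderiv P))" for P
  proof -
    define f where "f = el P"
    define f' where "f' = (\<lambda>x. (- \<i> / 2) * el (pCons 0 P) x)"
    have f': "gdec f'" "f' = d1 f" unfolding f'_def f_def by (intro gdec_cmult el_gdec) (simp add: el_d1)
    have "ip0 (\<lambda>x. (- 1 / (2 * s)) * (of_real x * g x)) f = - ip0 g f'"
    proof (rule ip0_ibp)
      show "(g has_vector_derivative (- 1 / (2 * s)) * (of_real x * g x)) (at x)" for x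
        using g_deriv by simp
      show "(f has_vector_derivative f' x) (at x)" for x
        unfolding f_def f'_def by (rule el_deriv)
      show "gdec f" unfolding f_def by (rule el_gdec)
    qed (intro f' gdec_cmult gdec_x g_gdec)+
    then have 1: "cnj (- 1 / (2 * s)) * ip0 (\<lambda>x. of_real x * g x) f = - ip0 g f'"
      unfolding ip0_cmult_left .
    have 2: "ip0 g (\<lambda>x. of_real x * f x) = ip0 (\<lambda>x. of_real x * g x) f"
      unfolding ip0_def by (simp add: mult_ac)
    have "ip0 g (el (pCons 0 P)) + (- 1) * ip0 g (el (pderiv P)) = ip0 g (el (pCons 0 P - pderiv P))"
      using ip0_el_add[OF g_gdec, of "pCons 0 P - pderiv P" "pderiv P"] by simp
    also have "el (pCons 0 P - pderiv P) = (\<lambda>x. (\<i> + of_real t) * f' x + (- \<i> / 2) * (of_real x * f x))"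
      using el_Aplus[of P] by (auto simp: fun_eq_iff f'_def f_def el_d1 mult.assoc)
    also have "ip0 g \<dots> = (\<i> + of_real t) * ip0 g f' + (- \<i> / 2) * ip0 g (\<lambda>x. of_real x * f x)"
      unfolding f_def by (subst ip0_add_right) (intro gdec_cmult gdec_x g_gdec f' el_gdec | simp only: ip0_cmult_right)+
    also have "ip0 g f' = ip0 (\<lambda>x. of_real x * g x) f / (2 * cnj s)"
      using 1 by (simp add: field_simps)
    \<comment> \<open>Hence the first term has the coefficient (i + t)/(2 cnj s) = i/2, which
      cancels the -i/2 in front of the x-term.\<close>
    also have "\<i> + of_real t = \<i> * cnj s" by (simp add: complex_eq_iff)
    finally show ?thesis using 2 by simp
  qed
qed (auto simp: ip0_el_add g_gdec ip0_el_smult)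

text \<open>Symmetry of \<xi> moves the left polynomial over one power at a time, with conjugated
  coefficients, until only the vacuum remains on the left.\<close>

lemma ip0_el: "ip0 (el P) (el Q) = gm (cpoly P * Q)"
proof (induction P arbitrary: Q)
  case 0
  then show ?case using gm_smult[of 0 0] by (simp add: ip0_def)
next
  case (pCons c P)
  have "el (pCons c P) = (\<lambda>x. c * g x + el (pCons 0 P) x)"
    using el_add[of "[:c:]" "pCons 0 P"] by (auto simp: fun_eq_iff el_def U_pCons)
  then have "ip0 (el (pCons c P)) (el Q) = ip0 (\<lambda>x. c * g x + el (pCons 0 P) x) (el Q)" by simp
  also have "\<dots> = cnj (ip0 (el Q) (\<lambda>x. c * g x + el (pCons 0 P) x))" by (rule ip0_cnj)
  also have "\<dots> = cnj (c * ip0 (el Q) g + ip0 (el Q) (el (pCons 0 P)))"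
    by (subst ip0_add_right) (auto intro!: el_gdec gdec_cmult g_gdec simp: ip0_cmult_right)
  also have "\<dots> = cnj c * ip0 g (el Q) + ip0 (el (pCons 0 P)) (el Q)"
    by (simp add: ip0_cnj[symmetric])
  also have "\<dots> = gm (smult (cnj c) Q) + gm (cpoly P * pCons 0 Q)"
    by (simp add: ip0_vacuum el_xi_sym pCons gm_smult)
  finally show ?case by (simp add: gm_add[symmetric])
qed

lemma L0_eq: "L0 \<psi>0 t = range el"
proof (intro set_eqI iffI)
  fix f assume "f \<in> L0 \<psi>0 t"
  then obtain c N where f: "f = (\<lambda>x. \<Sum>n<N. c n * psin \<psi>0 n x t)" unfolding L0_def by blast
  have "f = el (\<Sum>n<N. smult (c n * of_real (1 / sqrt (fact n))) (He n))"
    unfolding f el_sum[abs_def] by (simp add: psin_el el_smult mult.assoc)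
  then show "f \<in> range el" by blast
next
  fix f assume "f \<in> range el"
  then obtain P where f: "f = el P" by blast
  obtain N c where P: "P = (\<Sum>n<N. smult (c n) (He n))" using He_span by blast
  have "f = (\<lambda>x. \<Sum>n<N. (c n * of_real (sqrt (fact n))) * psin \<psi>0 n x t)"
    unfolding f P el_sum[abs_def] by (simp add: psin_el el_smult)
  then show "f \<in> L0 \<psi>0 t" unfolding L0_def by (intro CollectI exI conjI TrueI)
qed

subsection \<open>The operators \<open>g\<^sub>0\<close> and \<open>L\<close>\<close>

definition W :: "complex poly" where "W = [:of_real (a\<^sup>2), 0, 1 / 4:]"

lemma poly_W: "poly W (of_real x) = of_real (a\<^sup>2 + x\<^sup>2 / 4)"
  by (simp add: W_def power2_eq_square)

lemma g0op_el: "g0op a (el P) = el (W * P)"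
proof
  fix x
  have "W * P = smult (of_real (a\<^sup>2)) P + smult (1/4) (pCons 0 (pCons 0 P))"
    by (simp add: W_def)
  moreover have "d1 (d1 (el P)) = el (smult (- 1 / 4) (pCons 0 (pCons 0 P)))"
    unfolding el_d1' by (rule arg_cong[where f=el]) simp
  ultimately show "g0op a (el P) x = el (W * P) x"
    unfolding g0op_def by (simp only: el_add el_smult) simp
qed

lemma g0ip_el: "g0ip a (el P) (el Q) = gm (cpoly P * (W * Q))"
  unfolding g0ip_def g0op_el ip0_el ..

definition wt :: "real \<Rightarrow> complex" where "wt x = of_real (a * tanh (a * x))"

lemma wt_deriv: "(wt has_vector_derivative of_real (a\<^sup>2) - (wt x)\<^sup>2) (at x)"
proof -
  have "((\<lambda>x. a * tanh (a * x)) has_real_derivative (a\<^sup>2 - (a * tanh (a * x))\<^sup>2)) (at x)"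
    by (auto intro!: derivative_eq_intros simp: power2_eq_square algebra_simps)
  then have "((\<lambda>x. complex_of_real (a * tanh (a * x))) has_vector_derivative of_real (a\<^sup>2 - (a * tanh (a * x))\<^sup>2)) (at x)"
    by (rule has_vector_derivative_of_real)
  then show ?thesis unfolding wt_def[abs_def] by simp
qed

lemma wt_cont: "continuous_on UNIV wt"
  unfolding wt_def by (intro continuous_intros) auto

lemma wt_bdd: "cmod (wt x) \<le> a"
  unfolding wt_def norm_of_real abs_mult using a_pos tanh_real_lt_1[of "a * x"] tanh_real_gt_neg1[of "a * x"]
  by (auto simp: abs_le_iff)

lemma gdec_wt: "gdec f \<Longrightarrow> gdec (\<lambda>x. wt x * f x)"
  by (rule gdec_mult_bdd[OF _ wt_cont wt_bdd])

lemma L1op_el: "L1op a (el P) = (\<lambda>x. - wt x * el P x + (- \<i> / 2) * el (pCons 0 P) x)"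
  unfolding L1op_def el_d1 wt_def by (simp add: fun_eq_iff)

lemma L1op_el_gdec: "gdec (L1op a (el P))"
  unfolding L1op_el mult_minus_left by (intro gdec_add gdec_uminus gdec_wt gdec_cmult el_gdec)

text \<open>The factorisation \<open>L\<^sup>* L = g\<^sub>0\<close>, which rests on \<open>w' = a\<^sup>2 - w\<^sup>2\<close> for \<open>w = a tanh(ax)\<close>.\<close>
lemma ip0_L1op: "ip0 (L1op a (el P)) (L1op a (el Q)) = g0ip a (el P) (el Q)"
proof -
  define u v where "u = el P" and "v = el Q"
  define u' v' where "u' = d1 u" and "v' = d1 v"
  have gd: "gdec u" "gdec v" "gdec u'" "gdec v'" "gdec (d1 v')"
    unfolding u_def v_def u'_def v'_def el_d1' by (rule el_gdec)+
  have du: "(u has_vector_derivative u' x) (at x)" and dv: "(v has_vector_derivative v' x) (at x)"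
    and dv': "(v' has_vector_derivative d1 v' x) (at x)" for x
    using el_d1_deriv[of P x] el_d1_deriv[of Q x] el_d1_deriv[of "smult (- \<i> / 2) (pCons 0 Q)" x]
    unfolding u_def v_def u'_def v'_def el_d1'[symmetric] .
  have wc: "cnj (wt x) = wt x" for x by (simp add: wt_def)
  have L: "L1op a u = (\<lambda>x. - wt x * u x + u' x)" "L1op a v = (\<lambda>x. - wt x * v x + v' x)"
    by (auto simp: L1op_def wt_def u'_def v'_def fun_eq_iff)
  \<comment> \<open>Subtracting the derivative of this function replaces w^2 by a^2 in the product
    of L u and L v and removes the cross terms.\<close>
  let ?F = "\<lambda>x. wt x * (cnj (u x) * v x)"
  let ?F' = "\<lambda>x. (of_real (a\<^sup>2) - (wt x)\<^sup>2) * (cnj (u x) * v x) + wt x * (cnj (u' x) * v x + cnj (u x) * v' x)"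
  have dF: "(?F has_vector_derivative ?F' x) (at x)" for x
    using has_vector_derivative_mult[OF wt_deriv has_vector_derivative_mult[OF has_vector_derivative_cnj[OF du] dv], of x]
    by (simp add: algebra_simps)
  have gF': "gdec ?F'"
  proof -
    have uv: "gdec (\<lambda>x. cnj (u x) * v x)" by (intro gdec_mult gdec_cnj gd)
    have "gdec (\<lambda>x. of_real (a\<^sup>2) * (cnj (u x) * v x) - wt x * (wt x * (cnj (u x) * v x)) + wt x * (cnj (u' x) * v x + cnj (u x) * v' x))"
      by (intro gdec_add gdec_diff gdec_cmult gdec_wt gdec_mult gdec_cnj gd)
    then show ?thesis by (simp add: power2_eq_square algebra_simps)
  qed
  have 0: "(LINT x|lborel. ?F' x) = 0"
    by (rule gdec_integral_deriv[OF _ gF' dF]) (intro gdec_wt gdec_mult gdec_cnj gd)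
  have "ip0 (L1op a u) (L1op a v) = (LINT x|lborel. (of_real (a\<^sup>2) * (cnj (u x) * v x) + cnj (u' x) * v' x) - ?F' x)"
    unfolding L ip0_def
    by (rule Bochner_Integration.integral_cong) (auto simp: wc power2_eq_square algebra_simps)
  also have "\<dots> = (LINT x|lborel. of_real (a\<^sup>2) * (cnj (u x) * v x)) + (LINT x|lborel. cnj (u' x) * v' x) - 0"
    by (subst Bochner_Integration.integral_diff, (intro gdec_integrable gdec_add gdec_cmult gdec_mult gdec_cnj gd gF')+,
        subst Bochner_Integration.integral_add, (intro gdec_integrable gdec_add gdec_cmult gdec_mult gdec_cnj gd)+)
       (simp only: 0)
  also have "\<dots> = of_real (a\<^sup>2) * ip0 u v + ip0 u' v'"
    unfolding ip0_def by simp
  also have "ip0 u' v' = - ip0 u (d1 v')"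
    by (rule ip0_ibp) (use gd du dv' in auto)
  also have "of_real (a\<^sup>2) * ip0 u v + - ip0 u (d1 v') = ip0 u (\<lambda>x. (-1) * d1 v' x + of_real (a\<^sup>2) * v x)"
    by (subst ip0_add_right) (intro gdec_cmult gd | simp only: ip0_cmult_right | simp)+
  also have "\<dots> = g0ip a u v"
    by (simp add: g0ip_def g0op_def[abs_def] v'_def)
  finally show ?thesis unfolding u_def v_def .
qed

end

subsection \<open>Complex moments of the Gaussian weight in the plane\<close>

lemma pair_integrable_gauss:
  fixes f :: "real \<times> real \<Rightarrow> complex"
  assumes f: "continuous_on UNIV f"
    and b: "\<And>x y. cmod (f (x, y)) \<le> K * exp (- c * x\<^sup>2) * exp (- c * y\<^sup>2)" and c: "c > 0"
  shows "integrable (lborel \<Otimes>\<^sub>M lborel) f"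
proof (rule Bochner_Integration.integrable_bound)
  show "integrable (lborel \<Otimes>\<^sub>M lborel) (\<lambda>(x, y). K * exp (- c * x\<^sup>2) * exp (- c * y\<^sup>2))"
  proof (rule lborel_pair.Fubini_integrable)
    show "(\<lambda>(x, y). K * exp (- c * x\<^sup>2) * exp (- c * y\<^sup>2)) \<in> borel_measurable (lborel \<Otimes>\<^sub>M lborel)"
      by measurable
    have "integrable lborel (\<lambda>x. exp (- c * x\<^sup>2) * (\<bar>K\<bar> * (LINT y|lborel. exp (- c * y\<^sup>2))))"
      by (intro integrable_mult_left integrable_gauss c)
    then show "integrable lborel (\<lambda>x. LINT y|lborel. norm (case (x, y) of (x, y) \<Rightarrow> K * exp (- c * x\<^sup>2) * exp (- c * y\<^sup>2)))"
      by (simp add: abs_mult mult_ac)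
    show "AE x in lborel. integrable lborel (\<lambda>y. case (x, y) of (x, y) \<Rightarrow> K * exp (- c * x\<^sup>2) * exp (- c * y\<^sup>2))"
      using integrable_gauss[OF c] by (intro AE_I2) simp
  qed
  show "f \<in> borel_measurable (lborel \<Otimes>\<^sub>M lborel)"
    using borel_measurable_continuous_onI[OF f] by (simp add: lborel_prod)
  show "AE x in lborel \<Otimes>\<^sub>M lborel. norm (f x) \<le> norm (case x of (x, y) \<Rightarrow> K * exp (- c * x\<^sup>2) * exp (- c * y\<^sup>2))"
    by (intro AE_I2) (simp only: case_prod_beta real_norm_def, metis b order_trans[OF _ abs_ge_self] prod.collapse)
qed

text \<open>The integrand that \<open>nu_int\<close> sees at frequency \<tau>: the weight |Phi|^2 =
  exp(-|z|^2), a monomial, and the Fourier factor in x = Re z.\<close>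

definition pw :: "real \<Rightarrow> nat \<Rightarrow> nat \<Rightarrow> real \<Rightarrow> real \<Rightarrow> complex" where
  "pw \<tau> n k x y = Complex x y ^ n * cnj (Complex x y) ^ k * exp (- of_real (x\<^sup>2 + y\<^sup>2) - \<i> * of_real (\<tau> * x))"

definition pm :: "real \<Rightarrow> nat \<Rightarrow> nat \<Rightarrow> complex" where
  "pm \<tau> n k = (LINT p|(lborel \<Otimes>\<^sub>M lborel). pw \<tau> n k (fst p) (snd p))"

text \<open>One term of the exponential series gives r^m <= m! exp(r), and r <= 1/2 + r^2/2 then
  spends half of the Gaussian weight.\<close>

lemma pw_bound: "cmod (pw \<tau> n k x y) \<le> fact (n + k) * exp (1/2) * exp (- (1/2) * x\<^sup>2) * exp (- (1/2) * y\<^sup>2)"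
proof -
  define r where "r = sqrt (x\<^sup>2 + y\<^sup>2)"
  have r: "r \<ge> 0" "r\<^sup>2 = x\<^sup>2 + y\<^sup>2" unfolding r_def by auto
  have "r ^ m / fact m \<le> exp r" for m
  proof -
    have "(\<Sum>i\<in>{m}. inverse (fact i) * r ^ i) \<le> (\<Sum>i. inverse (fact i) * r ^ i)"
      using r summable_exp[of r] by (intro sum_le_suminf) auto
    also have "\<dots> = exp r" by (simp add: exp_def divide_inverse mult_ac)
    finally show ?thesis by (simp add: field_simps)
  qed
  then have "r ^ (n + k) / fact (n + k) \<le> exp r" .
  then have 1: "r ^ (n + k) \<le> fact (n + k) * exp r" by (simp add: pos_divide_le_eq mult.commute)
  have "0 \<le> (r - 1)\<^sup>2" by simp
  then have "exp r \<le> exp (1/2 + r\<^sup>2 / 2)" by (simp add: power2_eq_square algebra_simps)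
  with 1 have "r ^ (n + k) \<le> fact (n + k) * exp (1/2 + r\<^sup>2 / 2)"
    by (meson fact_ge_zero mult_left_mono order_trans)
  then have "r ^ (n + k) * exp (- r\<^sup>2) \<le> fact (n + k) * exp (1/2 + r\<^sup>2 / 2) * exp (- r\<^sup>2)"
    by (intro mult_right_mono) auto
  also have "\<dots> = fact (n + k) * exp (1/2) * exp (- (1/2) * x\<^sup>2) * exp (- (1/2) * y\<^sup>2)"
    unfolding r by (simp add: exp_add[symmetric] mult.assoc field_simps)
  also have "r ^ (n + k) * exp (- r\<^sup>2) = cmod (pw \<tau> n k x y)"
  proof -
    have "cmod (Complex x y) = r" by (simp add: cmod_def r_def)
    then show ?thesis by (simp add: pw_def norm_mult norm_power power_add r)
  qed
  finally show ?thesis .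
qed

lemma continuous_on_Complex: "continuous_on S f \<Longrightarrow> continuous_on S g \<Longrightarrow> continuous_on S (\<lambda>x. Complex (f x) (g x))"
  unfolding Complex_eq by (intro continuous_intros)

lemma pw_cont: "continuous_on UNIV (\<lambda>p. pw \<tau> n k (fst p) (snd p))"
  unfolding pw_def by (intro continuous_intros continuous_on_Complex)

lemma pw_integrable: "integrable (lborel \<Otimes>\<^sub>M lborel) (\<lambda>p. pw \<tau> n k (fst p) (snd p))"
  by (rule pair_integrable_gauss[OF pw_cont, where c="1/2" and K="fact (n + k) * exp (1/2)"])
     (use pw_bound in auto)

lemma pw_gdec_fst: "gdec (\<lambda>x. pw \<tau> n k x y)"
proof (rule gdecI[where c="1/2" and K="fact (n + k) * exp (1/2) * exp (- (1/2) * y\<^sup>2)"])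
  show "continuous_on UNIV (\<lambda>x. pw \<tau> n k x y)"
    unfolding pw_def by (intro continuous_intros continuous_on_Complex)
qed (use pw_bound[of \<tau> n k _ y] in \<open>auto simp: mult_ac\<close>)

lemma pw_gdec_snd: "gdec (\<lambda>y. pw \<tau> n k x y)"
proof (rule gdecI[where c="1/2" and K="fact (n + k) * exp (1/2) * exp (- (1/2) * x\<^sup>2)"])
  show "continuous_on UNIV (\<lambda>y. pw \<tau> n k x y)"
    unfolding pw_def by (intro continuous_intros continuous_on_Complex)
qed (use pw_bound[of \<tau> n k x] in \<open>auto simp: mult_ac\<close>)

text \<open>At n = 0 or k = 0 the truncated exponents n - 1 and k - 1 are harmless, since their
  terms carry the factor 0. The same holds in the recursions that follow.\<close>

lemma pw_dx:
  "((\<lambda>x. pw \<tau> n k x y) has_vector_derivative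
    of_nat n * pw \<tau> (n - 1) k x y + of_nat k * pw \<tau> n (k - 1) x y - pw \<tau> (Suc n) k x y
      - pw \<tau> n (Suc k) x y - \<i> * of_real \<tau> * pw \<tau> n k x y) (at x)"
proof -
  define E :: "complex \<Rightarrow> complex" where "E w = exp (- (w\<^sup>2 + of_real (y\<^sup>2)) - \<i> * (of_real \<tau> * w))" for w
  have dE: "(E has_field_derivative (- 2 * w - \<i> * of_real \<tau>) * E w) (at w)" for w
    unfolding E_def by (auto intro!: derivative_eq_intros)
  have eq: "pw \<tau> n k x y = (of_real x + \<i> * of_real y) ^ n * (of_real x - \<i> * of_real y) ^ k * E (of_real x)" for n k x
    by (simp add: pw_def Complex_eq E_def)
  show ?thesis unfolding eq
    by (rule has_vector_derivative_real_field) (auto intro!: derivative_eq_intros dE simp: algebra_simps)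
qed

lemma pw_dy:
  "((\<lambda>y. pw \<tau> n k x y) has_vector_derivative
    \<i> * of_nat n * pw \<tau> (n - 1) k x y - \<i> * of_nat k * pw \<tau> n (k - 1) x y + \<i> * pw \<tau> (Suc n) k x y
      - \<i> * pw \<tau> n (Suc k) x y) (at y)"
proof -
  define E :: "complex \<Rightarrow> complex" where "E w = exp (- (of_real (x\<^sup>2) + w\<^sup>2) - \<i> * (of_real \<tau> * of_real x))" for w
  have dE: "(E has_field_derivative - 2 * w * E w) (at w)" for w
    unfolding E_def by (auto intro!: derivative_eq_intros)
  have eq: "pw \<tau> n k x y = (of_real x + \<i> * of_real y) ^ n * (of_real x - \<i> * of_real y) ^ k * E (of_real y)" for n k y
    by (simp add: pw_def Complex_eq E_def)
  show ?thesis unfolding eq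
    by (rule has_vector_derivative_real_field) (auto intro!: derivative_eq_intros dE simp: algebra_simps)
qed

lemma pm_dx:
  "of_nat n * pm \<tau> (n - 1) k + of_nat k * pm \<tau> n (k - 1) - pm \<tau> (Suc n) k
      - pm \<tau> n (Suc k) - \<i> * of_real \<tau> * pm \<tau> n k = 0"
proof -
  let ?D = "\<lambda>x y. of_nat n * pw \<tau> (n - 1) k x y + of_nat k * pw \<tau> n (k - 1) x y - pw \<tau> (Suc n) k x y
      - pw \<tau> n (Suc k) x y - \<i> * of_real \<tau> * pw \<tau> n k x y"
  have i: "integrable (lborel \<Otimes>\<^sub>M lborel) (\<lambda>(x, y). ?D x y)"
    unfolding case_prod_beta
    by (intro Bochner_Integration.integrable_add Bochner_Integration.integrable_diff integrable_mult_right pw_integrable)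
  have "(LINT x|lborel. ?D x y) = 0" for y
    by (rule gdec_integral_deriv[OF pw_gdec_fst _ pw_dx]) (intro gdec_add gdec_diff gdec_cmult pw_gdec_fst)
  then have "(LINT y|lborel. LINT x|lborel. ?D x y) = 0" by simp
  then have "(LINT p|(lborel \<Otimes>\<^sub>M lborel). (case p of (x, y) \<Rightarrow> ?D x y)) = 0"
    using lborel_pair.integral_snd[OF i] by simp
  moreover have "(LINT p|(lborel \<Otimes>\<^sub>M lborel). (case p of (x, y) \<Rightarrow> ?D x y)) =
     of_nat n * pm \<tau> (n - 1) k + of_nat k * pm \<tau> n (k - 1) - pm \<tau> (Suc n) k
      - pm \<tau> n (Suc k) - \<i> * of_real \<tau> * pm \<tau> n k"
    unfolding case_prod_beta pm_def
    by (simp add: pw_integrable)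
  ultimately show ?thesis by simp
qed

lemma pm_dy:
  "of_nat n * pm \<tau> (n - 1) k - of_nat k * pm \<tau> n (k - 1) + pm \<tau> (Suc n) k - pm \<tau> n (Suc k) = 0"
proof -
  let ?D = "\<lambda>x y. \<i> * of_nat n * pw \<tau> (n - 1) k x y - \<i> * of_nat k * pw \<tau> n (k - 1) x y + \<i> * pw \<tau> (Suc n) k x y
      - \<i> * pw \<tau> n (Suc k) x y"
  have i: "integrable (lborel \<Otimes>\<^sub>M lborel) (\<lambda>(x, y). ?D x y)"
    unfolding case_prod_beta
    by (intro Bochner_Integration.integrable_add Bochner_Integration.integrable_diff integrable_mult_right pw_integrable)
  have "(LINT y|lborel. ?D x y) = 0" for x
    by (rule gdec_integral_deriv[OF pw_gdec_snd _ pw_dy]) (intro gdec_add gdec_diff gdec_cmult pw_gdec_snd)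
  then have "(LINT x|lborel. LINT y|lborel. ?D x y) = 0" by simp
  then have "(LINT p|(lborel \<Otimes>\<^sub>M lborel). (case p of (x, y) \<Rightarrow> ?D x y)) = 0"
    using lborel_pair.integral_fst[OF i] by simp
  moreover have "(LINT p|(lborel \<Otimes>\<^sub>M lborel). (case p of (x, y) \<Rightarrow> ?D x y)) =
     \<i> * (of_nat n * pm \<tau> (n - 1) k - of_nat k * pm \<tau> n (k - 1) + pm \<tau> (Suc n) k - pm \<tau> n (Suc k))"
    unfolding case_prod_beta pm_def
    by (simp add: pw_integrable algebra_simps)
  ultimately show ?thesis by simp
qed

text \<open>Subtracting \<open>pm_dy\<close> from \<open>pm_dx\<close> isolates the raised n, adding
  them the raised k. This amounts to integrating the two Wirtinger derivatives.\<close>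

lemma pm_Suc_left: "pm \<tau> (Suc n) k = of_nat k * pm \<tau> n (k - 1) - \<i> * of_real \<tau> / 2 * pm \<tau> n k"
  using pm_dx[of n \<tau> k] pm_dy[of n \<tau> k] by (simp add: field_simps) algebra

lemma pm_Suc_right: "pm \<tau> n (Suc k) = of_nat n * pm \<tau> (n - 1) k - \<i> * of_real \<tau> / 2 * pm \<tau> n k"
  using pm_dx[of n \<tau> k] pm_dy[of n \<tau> k] by (simp add: field_simps) algebra

section \<open>Gaussian expectations with a Fourier factor\<close>

definition gt :: "real \<Rightarrow> complex poly \<Rightarrow> complex" where
  "gt \<tau> P = (LINT x|lborel. poly P (of_real x) * (gw x * exp (- \<i> * of_real (\<tau> * x / 2))))"

lemma gwe_gdec: "gdec (\<lambda>x. gw x * exp (- \<i> * of_real (\<tau> * x / 2)))"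
proof -
  have "gdec (\<lambda>x. exp (- \<i> * of_real (\<tau> * x / 2)) * gw x)"
    by (rule gdec_mult_bdd[OF gw_gdec, where K=1]) (auto intro!: continuous_intros)
  then show ?thesis by (simp add: mult.commute)
qed

lemma gt_add: "gt \<tau> (P + Q) = gt \<tau> P + gt \<tau> Q"
  unfolding gt_def poly_add distrib_right
  by (intro Bochner_Integration.integral_add gdec_integrable gdec_poly gwe_gdec)

lemma gt_smult: "gt \<tau> (smult c P) = c * gt \<tau> P"
  unfolding gt_def by (simp add: mult.assoc)

lemma gt_ibp: "gt \<tau> (pCons 0 P) = gt \<tau> (pderiv P) - \<i> * of_real \<tau> / 2 * gt \<tau> P"
proof -
  let ?e = "\<lambda>x. gw x * exp (- \<i> * of_real (\<tau> * x / 2))"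
  have de: "((\<lambda>x. exp (- \<i> * of_real (\<tau> * x / 2))) has_vector_derivative
      (- \<i> * of_real \<tau> / 2) * exp (- \<i> * of_real (\<tau> * x / 2))) (at x)" for x
  proof -
    have "((\<lambda>x. exp (- \<i> * (of_real \<tau> * of_real x / 2))) has_vector_derivative
      (- \<i> * of_real \<tau> / 2) * exp (- \<i> * (of_real \<tau> * of_real x / 2))) (at x)"
      by (rule has_vector_derivative_real_field) (auto intro!: derivative_eq_intros)
    then show ?thesis by simp
  qed
  let ?D = "\<lambda>x. (poly (pderiv P) (of_real x) * ?e x - poly (pCons 0 P) (of_real x) * ?e x)
        + poly (smult (- \<i> * of_real \<tau> / 2) P) (of_real x) * ?e x"
  have "(LINT x|lborel. ?D x) = 0"
  proof (rule gdec_integral_deriv[where F="\<lambda>x. poly P (of_real x) * ?e x"])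
    show "((\<lambda>x. poly P (of_real x) * ?e x) has_vector_derivative ?D x) (at x)" for x
      using has_vector_derivative_mult[OF poly_deriv_real[of P] has_vector_derivative_mult[OF gw_deriv de], of x]
      by (simp add: algebra_simps)
  qed (intro gdec_add gdec_diff gdec_poly gwe_gdec)+
  moreover have "(LINT x|lborel. ?D x) = gt \<tau> (pderiv P) - gt \<tau> (pCons 0 P) + gt \<tau> (smult (- \<i> * of_real \<tau> / 2) P)"
    unfolding gt_def
    by (subst Bochner_Integration.integral_add, (intro gdec_integrable gdec_add gdec_diff gdec_poly gwe_gdec)+,
        subst Bochner_Integration.integral_diff, (intro gdec_integrable gdec_add gdec_diff gdec_poly gwe_gdec)+)
       (rule refl)
  ultimately show ?thesis unfolding gt_smult by (simp add: algebra_simps)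
qed

text \<open>The frequency in \<open>gt\<close> is \<tau>/2 because Re z corresponds to \<xi>/2 when
  \<xi> = A + A^+. With this choice the recursion coincides with \<open>pm_Suc_left\<close>.\<close>

lemma gt_He_Suc: "gt \<tau> (He (Suc n) * He k) = of_nat k * gt \<tau> (He n * He (k - 1)) - \<i> * of_real \<tau> / 2 * gt \<tau> (He n * He k)"
proof -
  have "pderiv (He k) = smult (of_nat k) (He (k - 1))"
    by (cases k) (auto simp: pderiv_He simp del: He.simps(2))
  then have k: "gt \<tau> (He n * pderiv (He k)) = of_nat k * gt \<tau> (He n * He (k - 1))" by (simp add: gt_smult)
  have "gt \<tau> (He (Suc n) * He k) = gt \<tau> (pCons 0 (He n * He k)) - gt \<tau> (pderiv (He n) * He k)"
    using gt_add[of \<tau> "He (Suc n) * He k" "pderiv (He n) * He k"] by (simp add: algebra_simps)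
  also have "gt \<tau> (pCons 0 (He n * He k)) =
      gt \<tau> (He n * pderiv (He k)) + gt \<tau> (pderiv (He n) * He k) - \<i> * of_real \<tau> / 2 * gt \<tau> (He n * He k)"
    unfolding gt_ibp pderiv_mult gt_add by (simp add: mult.commute)
  finally show ?thesis using k by simp
qed

lemma gt_1: "gt \<tau> 1 = of_real (exp (- \<tau>\<^sup>2 / 8))"
proof -
  have "gt \<tau> 1 = (LINT x|lborel. std_normal_density x *\<^sub>R iexp ((- \<tau> / 2) * x))"
    unfolding gt_def gw_std by (simp add: scaleR_conv_of_real)
  also have "\<dots> = char std_normal_distribution (- \<tau> / 2)"
    unfolding char_def by (subst integral_density) auto
  also have "\<dots> = of_real (exp (- \<tau>\<^sup>2 / 8))"
    unfolding char_std_normal_distribution by (simp add: power2_eq_square field_simps)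
  finally show ?thesis .
qed

text \<open>The substitution x -> x / sqrt 2 produces the standard normal weight and reduces the
  claim to \<open>gt_1\<close> at the frequency sqrt 2 * \<tau>.\<close>

lemma gauss_fourier: "(LINT x|lborel. exp (- of_real (x\<^sup>2) - \<i> * of_real (\<tau> * x))) = of_real (sqrt pi * exp (- \<tau>\<^sup>2 / 4))"
proof -
  have "(LINT x|lborel. exp (- of_real (x\<^sup>2) - \<i> * of_real (\<tau> * x)))
     = \<bar>1 / sqrt 2\<bar> *\<^sub>R (LINT x|lborel. exp (- of_real ((0 + 1 / sqrt 2 * x)\<^sup>2) - \<i> * of_real (\<tau> * (0 + 1 / sqrt 2 * x))))"
    by (rule lborel_integral_real_affine) simp
  also have "(\<lambda>x. exp (- complex_of_real ((0 + 1 / sqrt 2 * x)\<^sup>2) - \<i> * of_real (\<tau> * (0 + 1 / sqrt 2 * x))))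
     = (\<lambda>x. of_real (sqrt (2 * pi)) * (poly 1 (of_real x) * (gw x * exp (- \<i> * of_real ((sqrt 2 * \<tau>) * x / 2)))))"
  proof
    fix x :: real
    have s: "\<tau> * (x / sqrt 2) = sqrt 2 * \<tau> * x / 2" by (simp add: field_simps)
    have "exp (- complex_of_real ((0 + 1 / sqrt 2 * x)\<^sup>2) - \<i> * of_real (\<tau> * (0 + 1 / sqrt 2 * x)))
      = exp (of_real (- x\<^sup>2 / 2)) * exp (- \<i> * of_real (\<tau> * (x / sqrt 2)))"
      by (simp add: exp_add[symmetric] power_divide)
    also have "exp (of_real (- x\<^sup>2 / 2)) = of_real (sqrt (2 * pi)) * gw x"
      unfolding gw_def exp_of_real by simp
    finally show "exp (- complex_of_real ((0 + 1 / sqrt 2 * x)\<^sup>2) - \<i> * of_real (\<tau> * (0 + 1 / sqrt 2 * x)))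
      = of_real (sqrt (2 * pi)) * (poly 1 (of_real x) * (gw x * exp (- \<i> * of_real ((sqrt 2 * \<tau>) * x / 2))))"
      unfolding s by (simp add: mult.assoc)
  qed
  also have "\<bar>1 / sqrt 2\<bar> *\<^sub>R (LINT x|lborel. of_real (sqrt (2 * pi)) * (poly 1 (of_real x) * (gw x * exp (- \<i> * of_real ((sqrt 2 * \<tau>) * x / 2)))))
     = \<bar>1 / sqrt 2\<bar> *\<^sub>R (of_real (sqrt (2 * pi)) * gt (sqrt 2 * \<tau>) 1)"
    unfolding gt_def by simp
  also have "\<dots> = of_real (sqrt pi * exp (- \<tau>\<^sup>2 / 4))"
    unfolding gt_1 scaleR_conv_of_real of_real_mult[symmetric]
    by (rule arg_cong[where f=of_real]) (simp add: real_sqrt_mult power_mult_distrib)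
  finally show ?thesis .
qed

lemma pm_0: "pm \<tau> 0 0 = of_real (pi * exp (- \<tau>\<^sup>2 / 4))"
proof -
  have "pm \<tau> 0 0 = (LINT x|lborel. LINT y|lborel. pw \<tau> 0 0 x y)"
    unfolding pm_def using lborel_pair.integral_fst[of "\<lambda>x y. pw \<tau> 0 0 x y"] pw_integrable[of \<tau> 0 0]
    unfolding case_prod_beta by simp
  also have "\<dots> = (LINT x|lborel. (LINT y|lborel. exp (- of_real (x\<^sup>2) - \<i> * of_real (\<tau> * x)) * exp (- of_real (y\<^sup>2) - \<i> * of_real (0 * y))))"
    by (intro Bochner_Integration.integral_cong) (auto simp: pw_def exp_add[symmetric] algebra_simps)
  also have "\<dots> = of_real (sqrt pi * exp (- \<tau>\<^sup>2 / 4)) * of_real (sqrt pi * exp (- 0\<^sup>2 / 4))"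
    by (simp only: integral_mult_right_zero integral_mult_left_zero gauss_fourier)
  also have "\<dots> = of_real (pi * exp (- \<tau>\<^sup>2 / 4))"
    by (simp flip: of_real_mult)
  finally show ?thesis .
qed

lemma pm_gt: "pm \<tau> n k = of_real (pi * exp (- \<tau>\<^sup>2 / 8)) * gt \<tau> (He n * He k)"
proof (induction n arbitrary: k)
  case 0
  show ?case
  proof (induction k)
    case 0
    have "exp (- \<tau>\<^sup>2 / 8) * exp (- \<tau>\<^sup>2 / 8) = exp (- \<tau>\<^sup>2 / 4)" by (simp flip: exp_add)
    then show ?case using gt_1[of \<tau>] by (simp add: pm_0 flip: of_real_mult)
  next
    case (Suc k)
    \<comment> \<open>In the row n = 0 the terms with \<open>of_nat\<close> vanish, and each side
      merely acquires the factor -i \<tau>/2.\<close>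
    then show ?case using gt_He_Suc[of \<tau> k 0] pm_Suc_right[of \<tau> 0 k] by (simp del: He.simps(2))
  qed
next
  case (Suc n)
  show ?case unfolding pm_Suc_left gt_He_Suc Suc by (simp add: algebra_simps)
qed

section \<open>Integration over the Fourier variable against \<open>rho\<close>\<close>

lemma two_sided_exp_integrable:
  fixes a :: real
  assumes "a > 0" shows "integrable lborel (\<lambda>\<tau>. exp (- a * \<bar>\<tau>\<bar>))"
proof -
  have 1: "integrable lborel (\<lambda>\<tau>. indicator {0<..} \<tau> * exp (- (\<tau> * a)))"
    using integrable_I0i_exp_mscale[OF assms] by (simp add: set_integrable_def)
  have 2: "integrable lborel (\<lambda>\<tau>. indicator {0<..} (0 + (-1) * \<tau>) * exp (- ((0 + (-1) * \<tau>) * a)))"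
    by (rule lborel_integrable_real_affine[OF 1]) simp
  have "integrable lborel (\<lambda>\<tau>. indicator {0<..} \<tau> * exp (- (\<tau> * a)) +
      indicator {0<..} (0 + (-1) * \<tau>) * exp (- ((0 + (-1) * \<tau>) * a)))"
    by (rule Bochner_Integration.integrable_add[OF 1 2])
  then show ?thesis
    by (rule integrable_discrete_difference[where X="{0}", THEN iffD1, rotated -1])
       (auto simp: indicator_def mult.commute)
qed

text \<open>The two half-lines contribute 1/(a + i w) and 1/(a - i w).\<close>

lemma laplace_fourier:
  fixes a w :: real
  assumes "a > 0"
  shows "(LINT \<tau>|lborel. of_real (exp (- a * \<bar>\<tau>\<bar>)) * exp (- \<i> * of_real (\<tau> * w))) = of_real (2 * a / (a\<^sup>2 + w\<^sup>2))"
proof -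
  let ?f = "\<lambda>\<tau>. complex_of_real (exp (- a * \<bar>\<tau>\<bar>)) * exp (- \<i> * of_real (\<tau> * w))"
  have half: "(LBINT \<tau>:{0<..}. exp (- c * of_real \<tau>)) = 1 / c" "integrable lborel (\<lambda>\<tau>. indicator {0<..} \<tau> *\<^sub>R exp (- c * of_real \<tau>))"
    if c: "Re c = a" for c
  proof -
    show i: "integrable lborel (\<lambda>\<tau>. indicator {0<..} \<tau> *\<^sub>R exp (- c * of_real \<tau>))"
      by (rule Bochner_Integration.integrable_bound[OF two_sided_exp_integrable[OF assms]])
         (use c in \<open>auto simp: indicator_def\<close>)
    have c0: "c \<noteq> 0" using c assms by auto
    have "(LBINT \<tau>=0..\<infinity>. exp (- c * of_real \<tau>)) = 0 - (- 1 / c)"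
    proof (rule interval_integral_FTC_integrable[where F="\<lambda>\<tau>. - exp (- c * of_real \<tau>) / c"])
      show "((\<lambda>\<tau>. - exp (- c * of_real \<tau>) / c) has_vector_derivative exp (- c * of_real x)) (at x)" for x
        by (rule has_vector_derivative_real_field) (use c0 in \<open>auto intro!: derivative_eq_intros\<close>)
      show "set_integrable lborel (einterval 0 \<infinity>) (\<lambda>\<tau>. exp (- c * of_real \<tau>))"
        using i by (simp add: set_integrable_def zero_ereal_def)
      have e: "(F \<circ> real_of_ereal) \<circ> ereal = F" for F :: "real \<Rightarrow> complex" by auto
      have "((\<lambda>\<tau>. - exp (- c * of_real \<tau>) / c) \<longlongrightarrow> - exp (- c * of_real 0) / c) (at_right 0)"
        using c0 by (intro tendsto_intros) 
      then show "(((\<lambda>\<tau>. - exp (- c * of_real \<tau>) / c) \<circ> real_of_ereal) \<longlongrightarrow> - 1 / c) (at_right 0)"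
        by (simp add: zero_ereal_def ereal_tendsto_simps e)
      have "((\<lambda>\<tau>. - exp (- c * of_real \<tau>) / c) \<longlongrightarrow> 0) at_top"
      proof (rule tendsto_norm_zero_cancel)
        have "((\<lambda>\<tau>. exp (- a * \<tau>) / cmod c) \<longlongrightarrow> 0) at_top"
          using assms c0 by real_asymp
        then show "((\<lambda>\<tau>. norm (- exp (- c * of_real \<tau>) / c)) \<longlongrightarrow> 0) at_top"
          by (simp add: norm_divide c)
      qed
      then show "(((\<lambda>\<tau>. - exp (- c * of_real \<tau>) / c) \<circ> real_of_ereal) \<longlongrightarrow> 0) (at_left \<infinity>)"
        by (simp add: ereal_tendsto_simps e)
    qed (auto intro!: continuous_intros)
    then show "(LBINT \<tau>:{0<..}. exp (- c * of_real \<tau>)) = 1 / c"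
      by (simp add: interval_lebesgue_integral_0_infty)
  qed
  define c1 c2 where "c1 = Complex a w" and "c2 = Complex a (- w)"
  have c12: "c1 = of_real a + \<i> * of_real w" "c2 = of_real a - \<i> * of_real w" by (auto simp: c1_def c2_def complex_eq_iff)
  let ?g = "\<lambda>c \<tau>. indicator {0<..} \<tau> *\<^sub>R exp (- c * of_real \<tau>)"
  have i2: "integrable lborel (\<lambda>\<tau>. ?g c2 (0 + (-1) * \<tau>))"
    by (rule lborel_integrable_real_affine[OF half(2)]) (auto simp: c2_def)
  have "(LINT \<tau>|lborel. ?f \<tau>) = (LINT \<tau>|lborel. ?g c1 \<tau> + ?g c2 (0 + (-1) * \<tau>))"
  proof (rule integral_discrete_difference[where X="{0}"])
    fix \<tau> :: real assume "\<tau> \<notin> {0}"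
    then consider "\<tau> > 0" | "\<tau> < 0" by force
    then show "?f \<tau> = ?g c1 \<tau> + ?g c2 (0 + (-1) * \<tau>)"
    proof cases
      case 1
      have "?f \<tau> = exp (- c1 * of_real \<tau>)"
        unfolding exp_of_real[symmetric] exp_add[symmetric]
        by (rule arg_cong[where f=exp]) (use 1 in \<open>simp add: c12 algebra_simps\<close>)
      with 1 show ?thesis by simp
    next
      case 2
      have "?f \<tau> = exp (- c2 * of_real (- \<tau>))"
        unfolding exp_of_real[symmetric] exp_add[symmetric]
        by (rule arg_cong[where f=exp]) (use 2 in \<open>simp add: c12 algebra_simps\<close>)
      with 2 show ?thesis by simp
    qed
  qed auto
  also have "\<dots> = (LINT \<tau>|lborel. ?g c1 \<tau>) + (LINT \<tau>|lborel. ?g c2 (0 + (-1) * \<tau>))"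
    by (rule Bochner_Integration.integral_add[OF half(2) i2]) (simp add: c1_def)
  also have "(LINT \<tau>|lborel. ?g c2 (0 + (-1) * \<tau>)) = (LINT \<tau>|lborel. ?g c2 \<tau>)"
    using lborel_integral_real_affine[of "-1" "?g c2" 0] by simp
  also have "(LINT \<tau>|lborel. ?g c1 \<tau>) + (LINT \<tau>|lborel. ?g c2 \<tau>) = 1 / c1 + 1 / c2"
    using half(1)[of c1] half(1)[of c2] by (simp add: set_lebesgue_integral_def c1_def c2_def)
  also have "\<dots> = of_real (2 * a / (a\<^sup>2 + w\<^sup>2))"
  proof -
    have "c1 \<noteq> 0" "c2 \<noteq> 0" using assms by (auto simp: c1_def c2_def complex_eq_iff)
    then have "1 / c1 + 1 / c2 = (c1 + c2) / (c1 * c2)" by (simp add: field_simps)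
    also have "c1 + c2 = of_real (2 * a)" by (simp add: c12)
    also have "c1 * c2 = of_real (a\<^sup>2 + w\<^sup>2)" by (simp add: c12 power2_eq_square algebra_simps)
    finally show ?thesis by simp
  qed
  finally show ?thesis .
qed

text \<open>Fubini applies only after the growing Gaussian in \<open>rho\<close> has been cancelled:
  what remains is dominated by |R| \<open>gw\<close> times exp(-a|\<tau>|). The inner integral is
  then \<open>laplace_fourier\<close> at w = \<xi>/2. The constant 1/(2 pi a) in \<open>rho\<close>
  absorbs the pi of \<open>pm_gt\<close> and the 2a produced here.\<close>

lemma gt_rho_integral:
  assumes "a > 0"
  shows "(LINT \<tau>|lborel. of_real (pi * exp (- \<tau>\<^sup>2 / 8)) * gt \<tau> R * of_real (rho a \<tau>)) =
    (LINT x|lborel. poly R (of_real x) * gw x / of_real (a\<^sup>2 + x\<^sup>2 / 4))"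
proof -
  let ?F = "\<lambda>x \<tau>. poly R (of_real x) * gw x * (of_real (exp (- a * \<bar>\<tau>\<bar>)) * exp (- \<i> * of_real (\<tau> * (x / 2))))"
  have gR: "gdec (\<lambda>x. poly R (of_real x) * gw x)" by (intro gdec_poly gw_gdec)
  have n: "norm (?F x \<tau>) = norm (poly R (of_real x) * gw x) * exp (- a * \<bar>\<tau>\<bar>)" for x \<tau>
    by (simp add: norm_mult)
  have int: "integrable (lborel \<Otimes>\<^sub>M lborel) (\<lambda>(x, \<tau>). ?F x \<tau>)"
  proof (rule lborel_pair.Fubini_integrable)
    have "continuous_on UNIV (\<lambda>p. ?F (fst p) (snd p))"
      by (intro continuous_intros continuous_on_compose2[OF gdec_cont[OF gw_gdec]]) auto
    then show "(\<lambda>(x, \<tau>). ?F x \<tau>) \<in> borel_measurable (lborel \<Otimes>\<^sub>M lborel)"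
      unfolding lborel_prod case_prod_beta measurable_cong_sets[OF sets_lborel refl]
      by (rule borel_measurable_continuous_onI)
    have "integrable lborel (\<lambda>x. norm (poly R (of_real x) * gw x) * (LINT \<tau>|lborel. exp (- a * \<bar>\<tau>\<bar>)))"
      using gdec_integrable[OF gR] by (intro integrable_mult_left integrable_norm)
    then show "integrable lborel (\<lambda>x. LINT \<tau>|lborel. norm (case (x, \<tau>) of (x, \<tau>) \<Rightarrow> ?F x \<tau>))"
      unfolding prod.case n by simp
    have "integrable lborel (?F x)" for x
      by (rule Bochner_Integration.integrable_bound[where f="\<lambda>\<tau>. norm (poly R (of_real x) * gw x) * exp (- a * \<bar>\<tau>\<bar>)"])
         (use two_sided_exp_integrable[OF assms] n in auto)
    then show "AE x in lborel. integrable lborel (\<lambda>\<tau>. case (x, \<tau>) of (x, \<tau>) \<Rightarrow> ?F x \<tau>)" by simp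
  qed
  have "(LINT \<tau>|lborel. of_real (pi * exp (- \<tau>\<^sup>2 / 8)) * gt \<tau> R * of_real (rho a \<tau>)) =
    (LINT \<tau>|lborel. of_real (1 / (2 * a)) * (LINT x|lborel. ?F x \<tau>))"
  proof (intro Bochner_Integration.integral_cong refl)
    fix \<tau>
    have e: "exp (- \<tau>\<^sup>2 / 8) * exp (\<tau>\<^sup>2 / 8 - a * \<bar>\<tau>\<bar>) = exp (- a * \<bar>\<tau>\<bar>)"
      by (simp flip: exp_add)
    have "pi * exp (- \<tau>\<^sup>2 / 8) * rho a \<tau> = (exp (- \<tau>\<^sup>2 / 8) * exp (\<tau>\<^sup>2 / 8 - a * \<bar>\<tau>\<bar>)) / (2 * a)"
      unfolding rho_def by simp
    then have pr: "pi * exp (- \<tau>\<^sup>2 / 8) * rho a \<tau> = exp (- a * \<bar>\<tau>\<bar>) / (2 * a)" by (simp only: e)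
    have "of_real (pi * exp (- \<tau>\<^sup>2 / 8)) * gt \<tau> R * of_real (rho a \<tau>) = of_real (pi * exp (- \<tau>\<^sup>2 / 8) * rho a \<tau>) * gt \<tau> R"
      unfolding of_real_mult by (simp only: mult_ac)
    also have "\<dots> = of_real (exp (- a * \<bar>\<tau>\<bar>) / (2 * a)) * gt \<tau> R"
      by (simp only: pr)
    also have "\<dots> = of_real (1 / (2 * a)) * (of_real (exp (- a * \<bar>\<tau>\<bar>)) * gt \<tau> R)" by simp
    also have "of_real (exp (- a * \<bar>\<tau>\<bar>)) * gt \<tau> R = (LINT x|lborel. ?F x \<tau>)"
      unfolding gt_def integral_mult_right_zero[symmetric]
      by (intro Bochner_Integration.integral_cong refl) (simp add: mult_ac)
    finally show "of_real (pi * exp (- \<tau>\<^sup>2 / 8)) * gt \<tau> R * of_real (rho a \<tau>) = of_real (1 / (2 * a)) * (LINT x|lborel. ?F x \<tau>)" .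
  qed
  also have "\<dots> = of_real (1 / (2 * a)) * (LINT \<tau>|lborel. LINT x|lborel. ?F x \<tau>)"
    by (rule integral_mult_right_zero)
  also have "\<dots> = of_real (1 / (2 * a)) * (LINT x|lborel. LINT \<tau>|lborel. ?F x \<tau>)"
    using lborel_pair.Fubini_integral[OF int] by simp
  also have "\<dots> = (LINT x|lborel. of_real (1 / (2 * a)) * (LINT \<tau>|lborel. ?F x \<tau>))"
    by (rule integral_mult_right_zero[symmetric])
  also have "\<dots> = (LINT x|lborel. poly R (of_real x) * gw x / of_real (a\<^sup>2 + x\<^sup>2 / 4))"
  proof (intro Bochner_Integration.integral_cong refl)
    fix x
    have "(LINT \<tau>|lborel. ?F x \<tau>) = poly R (of_real x) * gw x * of_real (2 * a / (a\<^sup>2 + (x / 2)\<^sup>2))"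
      using laplace_fourier[OF assms, of "x / 2"] by simp
    then have "of_real (1 / (2 * a)) * (LINT \<tau>|lborel. ?F x \<tau>) = poly R (of_real x) * gw x * of_real (1 / (2 * a) * (2 * a / (a\<^sup>2 + (x / 2)\<^sup>2)))"
      by (simp only: of_real_mult mult_ac)
    also have "1 / (2 * a) * (2 * a / (a\<^sup>2 + (x / 2)\<^sup>2)) = 1 / (a\<^sup>2 + x\<^sup>2 / 4)"
      using assms by (simp add: power_divide)
    finally show "of_real (1 / (2 * a)) * (LINT \<tau>|lborel. ?F x \<tau>) = poly R (of_real x) * gw x / of_real (a\<^sup>2 + x\<^sup>2 / 4)"
      by simp
  qed
  finally show ?thesis .
qed

text \<open>Finite sums are enough for both uses: the moment problem needs one monomial, and a bra
  applied to an element of L_1 is a polynomial in cnj z up to the Gaussian factor.\<close>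

lemma mu_int_poly:
  fixes e :: "nat \<Rightarrow> nat \<Rightarrow> complex"
  assumes "a > 0"
  shows "mu_int a (\<lambda>z. of_real (exp (- (cmod z)\<^sup>2)) * (\<Sum>n<N. \<Sum>k<M. e n k * (z ^ n * cnj z ^ k))) =
    (LINT x|lborel. poly (\<Sum>n<N. \<Sum>k<M. smult (e n k) (He n * He k)) (of_real x) * gw x / of_real (a\<^sup>2 + x\<^sup>2 / 4))"
proof -
  let ?F = "\<lambda>z. complex_of_real (exp (- (cmod z)\<^sup>2)) * (\<Sum>n<N. \<Sum>k<M. e n k * (z ^ n * cnj z ^ k))"
  let ?R = "\<Sum>n<N. \<Sum>k<M. smult (e n k) (He n * He k)"
  have gtR: "gt \<tau> ?R = (\<Sum>n<N. \<Sum>k<M. e n k * gt \<tau> (He n * He k))" for \<tau>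
  proof -
    have s: "gt \<tau> (\<Sum>i<m. f i) = (\<Sum>i<m. gt \<tau> (f i))" for f and m :: nat
      using gt_smult[of \<tau> 0 0] by (induction m) (auto simp: gt_add)
    show ?thesis by (simp only: s gt_smult)
  qed
  have "(LINT x|lborel. (LINT y|lborel. ?F (Complex x y)) * exp (- \<i> * of_real (\<tau> * x))) =
      of_real (pi * exp (- \<tau>\<^sup>2 / 8)) * gt \<tau> ?R" for \<tau>
  proof -
    let ?G = "\<lambda>x y. \<Sum>n<N. \<Sum>k<M. e n k * pw \<tau> n k x y"
    have eq: "?F (Complex x y) * exp (- \<i> * of_real (\<tau> * x)) = ?G x y" for x y
    proof -
      have "of_real (exp (- (cmod (Complex x y))\<^sup>2)) * exp (- \<i> * of_real (\<tau> * x)) = exp (- of_real (x\<^sup>2 + y\<^sup>2) - \<i> * of_real (\<tau> * x))"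
        by (simp add: cmod_def exp_of_real[symmetric] exp_add[symmetric])
      then show ?thesis unfolding pw_def
        by (simp only: sum_distrib_left sum_distrib_right) (simp add: mult_ac)
    qed
    have int: "integrable (lborel \<Otimes>\<^sub>M lborel) (\<lambda>(x, y). ?G x y)"
      unfolding case_prod_beta by (intro Bochner_Integration.integrable_sum integrable_mult_right pw_integrable)
    have "(LINT x|lborel. (LINT y|lborel. ?F (Complex x y)) * exp (- \<i> * of_real (\<tau> * x))) = (LINT x|lborel. LINT y|lborel. ?G x y)"
      unfolding eq[symmetric] by (simp only: integral_mult_left_zero)
    also have "\<dots> = (LINT p|(lborel \<Otimes>\<^sub>M lborel). (case p of (x, y) \<Rightarrow> ?G x y))"
      by (rule lborel_pair.integral_fst[OF int])
    also have "\<dots> = (\<Sum>n<N. \<Sum>k<M. e n k * pm \<tau> n k)"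
      unfolding case_prod_beta pm_def by (simp add: pw_integrable)
    also have "\<dots> = of_real (pi * exp (- \<tau>\<^sup>2 / 8)) * gt \<tau> ?R"
      unfolding gtR pm_gt sum_distrib_left by (simp add: mult_ac)
    finally show ?thesis .
  qed
  then show ?thesis unfolding mu_int_def nu_int_def using gt_rho_integral[OF assms, of ?R] by simp
qed

subsection \<open>Limits in \<open>L\<^sup>2\<close>\<close>

lemma sq_int_diff:
  assumes "sq_int f" "sq_int g" shows "sq_int (\<lambda>x. f x - g x)"
  unfolding sq_int_def
proof
  have m [measurable]: "f \<in> borel_measurable lborel" "g \<in> borel_measurable lborel"
    and i: "integrable lborel (\<lambda>x. (cmod (f x))\<^sup>2)" "integrable lborel (\<lambda>x. (cmod (g x))\<^sup>2)"
    using assms unfolding sq_int_def by auto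
  show "(\<lambda>x. f x - g x) \<in> borel_measurable lborel" by measurable
  show "integrable lborel (\<lambda>x. (cmod (f x - g x))\<^sup>2)"
  proof (rule Bochner_Integration.integrable_bound)
    show "integrable lborel (\<lambda>x. 2 * (cmod (f x))\<^sup>2 + 2 * (cmod (g x))\<^sup>2)" using i by simp
    have "(cmod (f x - g x))\<^sup>2 \<le> 2 * (cmod (f x))\<^sup>2 + 2 * (cmod (g x))\<^sup>2" for x
    proof -
      have "(cmod (f x - g x))\<^sup>2 \<le> (cmod (f x) + cmod (g x))\<^sup>2"
        by (intro power_mono norm_triangle_ineq4) auto
      also have "\<dots> \<le> 2 * (cmod (f x))\<^sup>2 + 2 * (cmod (g x))\<^sup>2"
        using zero_le_power2[of "cmod (f x) - cmod (g x)"] by (simp add: power2_eq_square algebra_simps)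
      finally show ?thesis .
    qed
    then show "AE x in lborel. norm ((cmod (f x - g x))\<^sup>2) \<le> norm (2 * (cmod (f x))\<^sup>2 + 2 * (cmod (g x))\<^sup>2)"
      by (intro AE_I2) simp
  qed measurable
qed

lemma prod_le_weighted_squares:
  fixes x y e :: real assumes "e > 0" shows "x * y \<le> e / 2 * x\<^sup>2 + 1 / (2 * e) * y\<^sup>2"
proof -
  have "0 \<le> (e * x - y)\<^sup>2 / (2 * e)" using assms by simp
  also have "\<dots> = e / 2 * x\<^sup>2 + 1 / (2 * e) * y\<^sup>2 - x * y"
    using assms by (simp add: power2_eq_square field_simps)
  finally show ?thesis by simp
qed

lemma ip0_integrable:
  assumes "sq_int f" "sq_int g" shows "integrable lborel (\<lambda>x. cnj (f x) * g x)"
proof (rule Bochner_Integration.integrable_bound)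
  have [measurable]: "f \<in> borel_measurable lborel" "g \<in> borel_measurable lborel" using assms unfolding sq_int_def by auto
  have [measurable]: "cnj \<in> borel_measurable borel"
    by (intro borel_measurable_continuous_onI continuous_intros)
  show "(\<lambda>x. cnj (f x) * g x) \<in> borel_measurable lborel" by measurable
  show "integrable lborel (\<lambda>x. 1/2 * (cmod (f x))\<^sup>2 + 1/2 * (cmod (g x))\<^sup>2)"
    using assms unfolding sq_int_def by simp
  show "AE x in lborel. norm (cnj (f x) * g x) \<le> norm (1/2 * (cmod (f x))\<^sup>2 + 1/2 * (cmod (g x))\<^sup>2)"
    using prod_le_weighted_squares[of 1 "cmod (f _)" "cmod (g _)"] by (intro AE_I2) (simp add: norm_mult)
qed

text \<open>The weighted arithmetic-geometric mean inequality stands in for Cauchy-Schwarz: e first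
  makes one term small, and the other term then tends to 0.\<close>

lemma ip0_bound:
  assumes "sq_int f" "sq_int g" "e > 0"
  shows "cmod (ip0 f g) \<le> e / 2 * (LINT x|lborel. (cmod (f x))\<^sup>2) + 1 / (2 * e) * (LINT x|lborel. (cmod (g x))\<^sup>2)"
proof -
  have "cmod (ip0 f g) \<le> (LINT x|lborel. e / 2 * (cmod (f x))\<^sup>2 + 1 / (2 * e) * (cmod (g x))\<^sup>2)"
    unfolding ip0_def
    by (rule Bochner_Integration.integral_norm_bound_integral)
       (use assms ip0_integrable[of f g] prod_le_weighted_squares[OF assms(3)] in \<open>auto simp: sq_int_def norm_mult\<close>)
  also have "\<dots> = e / 2 * (LINT x|lborel. (cmod (f x))\<^sup>2) + 1 / (2 * e) * (LINT x|lborel. (cmod (g x))\<^sup>2)"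
    using assms unfolding sq_int_def by simp
  finally show ?thesis .
qed

lemma ip0_l2conv:
  assumes f: "sq_int f" and F: "\<And>j. sq_int (F j)" and u: "sq_int u" and l: "l2conv F u"
  shows "(\<lambda>j. ip0 f (F j)) \<longlonglongrightarrow> ip0 f u"
proof (rule LIMSEQ_I)
  fix r :: real assume r: "r > 0"
  define A where "A = (LINT x|lborel. (cmod (f x))\<^sup>2)"
  have A: "A \<ge> 0" unfolding A_def by simp
  \<comment> \<open>The 1 in the denominator covers A = 0.\<close>
  define e where "e = r / (A + 1)"
  have e: "e > 0" "e * A < r" using r A by (auto simp: e_def field_simps)
  define B where "B j = (LINT x|lborel. (cmod (F j x - u x))\<^sup>2)" for j
  have "B \<longlonglongrightarrow> 0" using l unfolding l2conv_def B_def .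
  then have "eventually (\<lambda>j. B j < r * e) sequentially"
    using r e by (intro order_tendstoD) auto
  then obtain N where N: "\<And>j. j \<ge> N \<Longrightarrow> B j < r * e" unfolding eventually_sequentially by blast
  show "\<exists>N. \<forall>j\<ge>N. norm (ip0 f (F j) - ip0 f u) < r"
  proof (intro exI allI impI)
    fix j assume "j \<ge> N"
    then have B: "B j < r * e" by (rule N)
    have "ip0 f (F j) - ip0 f u = ip0 f (\<lambda>x. F j x - u x)"
      unfolding ip0_def right_diff_distrib
      by (rule Bochner_Integration.integral_diff[symmetric]) (intro ip0_integrable f F u)+
    then have "norm (ip0 f (F j) - ip0 f u) \<le> e / 2 * A + 1 / (2 * e) * B j"
      using ip0_bound[OF f sq_int_diff[OF F u] e(1), of j] unfolding A_def B_def by simp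
    also have "1 / (2 * e) * B j < r / 2" using B e by (simp add: field_simps)
    also have "e / 2 * A < r / 2" using e by simp
    finally show "norm (ip0 f (F j) - ip0 f u) < r" by simp
  qed
qed

text \<open>Fatou's lemma in the second index. It yields a concrete limit function together with the
  rate e, with no appeal to completeness of L^2.\<close>

lemma l2_limit_of_pointwise:
  assumes F: "\<And>j. sq_int (F j)" and lim: "\<And>x. (\<lambda>j. F j x) \<longlonglongrightarrow> u x"
    and e: "\<And>i j. i \<le> j \<Longrightarrow> (LINT x|lborel. (cmod (F i x - F j x))\<^sup>2) \<le> e i" and e0: "e \<longlonglongrightarrow> 0"
  shows "sq_int u" "l2conv F u"
proof -
  have m [measurable]: "F j \<in> borel_measurable lborel" for j using F unfolding sq_int_def by auto
  have u [measurable]: "u \<in> borel_measurable lborel"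
    by (rule borel_measurable_LIMSEQ_metric[OF m lim])
  have en: "e i \<ge> 0" for i
    using e[of i i] by simp
  have nn: "(\<integral>\<^sup>+x. ennreal ((cmod (F i x - u x))\<^sup>2) \<partial>lborel) \<le> ennreal (e i)" for i
  proof -
    have "(\<integral>\<^sup>+x. ennreal ((cmod (F i x - u x))\<^sup>2) \<partial>lborel)
        = (\<integral>\<^sup>+x. liminf (\<lambda>j. ennreal ((cmod (F i x - F j x))\<^sup>2)) \<partial>lborel)"
    proof (rule nn_integral_cong)
      fix x
      have "(\<lambda>j. ennreal ((cmod (F i x - F j x))\<^sup>2)) \<longlonglongrightarrow> ennreal ((cmod (F i x - u x))\<^sup>2)"
        by (intro tendsto_intros tendsto_ennrealI lim)
      then show "ennreal ((cmod (F i x - u x))\<^sup>2) = liminf (\<lambda>j. ennreal ((cmod (F i x - F j x))\<^sup>2))"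
        using lim_imp_Liminf[OF sequentially_bot] by metis
    qed
    also have "\<dots> \<le> liminf (\<lambda>j. \<integral>\<^sup>+x. ennreal ((cmod (F i x - F j x))\<^sup>2) \<partial>lborel)"
      by (rule nn_integral_liminf) measurable
    also have "\<dots> \<le> liminf (\<lambda>j. ennreal (e i))"
    proof (rule Liminf_mono)
      have "(\<integral>\<^sup>+x. ennreal ((cmod (F i x - F j x))\<^sup>2) \<partial>lborel) \<le> ennreal (e i)" if "j \<ge> i" for j
        using e[OF that] sq_int_diff[OF F F, of i j]
        by (subst nn_integral_eq_integral) (auto simp: sq_int_def ennreal_leI)
      then show "eventually (\<lambda>j. (\<integral>\<^sup>+x. ennreal ((cmod (F i x - F j x))\<^sup>2) \<partial>lborel) \<le> ennreal (e i)) sequentially"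
        unfolding eventually_sequentially by blast
    qed
    also have "\<dots> = ennreal (e i)" by (simp add: Liminf_const)
    finally show ?thesis .
  qed
  have int: "integrable lborel (\<lambda>x. (cmod (F i x - u x))\<^sup>2)" for i
    by (rule integrableI_bounded) (use le_less_trans[OF nn[of i]] in auto)
  then have sq: "sq_int (\<lambda>x. F i x - u x)" for i unfolding sq_int_def by simp
  show "sq_int u" using sq_int_diff[OF F[of 0] sq[of 0]] by simp
  have le: "(LINT x|lborel. (cmod (F i x - u x))\<^sup>2) \<le> e i" for i
    using nn[of i] int[of i] en[of i] by (subst (asm) nn_integral_eq_integral) (auto simp: ennreal_le_iff)
  show "l2conv F u" unfolding l2conv_def
    by (rule tendsto_sandwich[OF _ _ tendsto_const e0]) (auto simp: le)
qed

text \<open>|f(x)|^2 is the integral of (cnj f f)' up to x, whose integrand is at most 2|f||f'|. The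
  bound turns L^2 estimates into convergence at every point.\<close>

lemma sobolev_bound:
  assumes f: "gdec f" and f': "gdec f'" and d: "\<And>x. (f has_vector_derivative f' x) (at x)"
  shows "(cmod (f x))\<^sup>2 \<le> (LINT x|lborel. (cmod (f x))\<^sup>2) + (LINT x|lborel. (cmod (f' x))\<^sup>2)"
proof -
  let ?F = "\<lambda>x. cnj (f x) * f x" and ?F' = "\<lambda>x. cnj (f x) * f' x + cnj (f' x) * f x"
  have gF: "gdec ?F" and gF': "gdec ?F'" by (intro gdec_add gdec_mult gdec_cnj f f')+
  have dF: "(?F has_vector_derivative ?F' y) (at y)" for y
    by (rule has_vector_derivative_mult[OF has_vector_derivative_cnj[OF d] d])
  have "(LBINT y=-\<infinity>..ereal x. ?F' y) = ?F x - 0"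
  proof (rule interval_integral_FTC_integrable[where F="?F"])
    show "isCont ?F' y" for y using gdec_cont[OF gF'] by (simp add: continuous_on_eq_continuous_at)
    show "set_integrable lborel (einterval (- \<infinity>) (ereal x)) ?F'"
      unfolding set_integrable_def by (intro integrable_mult_indicator gdec_integrable gF') auto
    have e: "(G \<circ> real_of_ereal) \<circ> ereal = G" for G :: "real \<Rightarrow> complex" by auto
    show "((?F \<circ> real_of_ereal) \<longlongrightarrow> 0) (at_right (- \<infinity>))"
      using gdec_tendsto(2)[OF gF] by (simp add: ereal_tendsto_simps e)
    have "isCont ?F x" using gdec_cont[OF gF] by (simp add: continuous_on_eq_continuous_at)
    then have "(?F \<longlongrightarrow> ?F x) (at_left x)" by (simp add: isCont_def filterlim_at_split)
    then show "((?F \<circ> real_of_ereal) \<longlongrightarrow> ?F x) (at_left (ereal x))"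
      by (simp add: ereal_tendsto_simps e)
  qed (use dF in auto)
  then have "?F x = (LINT y|lborel. indicator {..<x} y *\<^sub>R ?F' y)"
    by (simp add: interval_lebesgue_integral_def set_lebesgue_integral_def einterval_def lessThan_def)
  moreover have "cmod (?F x) = (cmod (f x))\<^sup>2" by (simp add: norm_mult power2_eq_square)
  moreover have "cmod (LINT y|lborel. indicator {..<x} y *\<^sub>R ?F' y) \<le>
      (LINT y|lborel. (cmod (f y))\<^sup>2 + (cmod (f' y))\<^sup>2)"
  proof (rule Bochner_Integration.integral_norm_bound_integral)
    show "integrable lborel (\<lambda>y. indicator {..<x} y *\<^sub>R ?F' y)"
      by (intro integrable_mult_indicator gdec_integrable gF') auto
    show "integrable lborel (\<lambda>y. (cmod (f y))\<^sup>2 + (cmod (f' y))\<^sup>2)"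
      by (intro Bochner_Integration.integrable_add gdec_integrable_sq f f')
    fix y
    have "cmod (indicator {..<x} y *\<^sub>R ?F' y) \<le> cmod (?F' y)" by (simp add: indicator_def)
    also have "\<dots> \<le> cmod (cnj (f y) * f' y) + cmod (cnj (f' y) * f y)" by (rule norm_triangle_ineq)
    also have "\<dots> \<le> (cmod (f y))\<^sup>2 + (cmod (f' y))\<^sup>2"
      using prod_le_weighted_squares[of 1 "cmod (f y)" "cmod (f' y)"] by (simp add: norm_mult mult.commute)
    finally show "norm (indicator {..<x} y *\<^sub>R ?F' y) \<le> (cmod (f y))\<^sup>2 + (cmod (f' y))\<^sup>2" .
  qed
  ultimately show ?thesis
    by (subst (asm) Bochner_Integration.integral_add) (auto intro: gdec_integrable_sq f f')
qed

subsection \<open>Weighted polynomial approximation\<close>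

definition sgw :: "real \<Rightarrow> complex" where "sgw x = of_real (sqrt (exp (- x\<^sup>2 / 2) / sqrt (2 * pi)))"

lemma sgw_sq: "sgw x * sgw x = gw x"
  unfolding sgw_def gw_def of_real_mult[symmetric] by simp

lemma cnj_sgw [simp]: "cnj (sgw x) = sgw x" by (simp add: sgw_def)

lemma sgw_gdec: "gdec sgw"
proof -
  have "sqrt (exp (- x\<^sup>2 / 2)) = exp (- x\<^sup>2 / 4)" for x :: real
    by (rule real_sqrt_unique) (simp_all add: power2_eq_square flip: exp_add)
  then have s: "sgw = (\<lambda>x. of_real (sqrt (1 / sqrt (2 * pi))) * exp (of_real x * 0 - (1/4) * of_real (x\<^sup>2)))"
    unfolding sgw_def by (auto simp: fun_eq_iff real_sqrt_divide exp_of_real[symmetric])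
  show ?thesis unfolding s by (intro gdec_cmult gdec_gauss) simp
qed

text \<open>Half of the Gaussian weight on each factor gives a copy of L_0 in unweighted L^2,
  isometric to \<open>el\<close>, in which g_0 is multiplication by a positive function. Dividing by
  W makes sense here.\<close>

definition pf :: "complex poly \<Rightarrow> real \<Rightarrow> complex" where "pf P x = poly P (of_real x) * sgw x"

lemma pf_gdec: "gdec (pf P)"
  unfolding pf_def[abs_def] by (intro gdec_poly sgw_gdec)

lemma ip0_pf: "ip0 (pf P) (pf Q) = gm (cpoly P * Q)"
  unfolding ip0_def gm_def pf_def
  by (intro Bochner_Integration.integral_cong refl) (simp add: poly_cpoly sgw_sq[symmetric])

lemma pf_diff: "pf (P - Q) x = pf P x - pf Q x" by (simp add: pf_def algebra_simps)

text \<open>Taylor polynomial of cos(T\<xi>/2). Only even powers of \<xi> occur, so reduction modulo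
  W leaves a constant.\<close>

definition cosp :: "real \<Rightarrow> nat \<Rightarrow> complex poly" where
  "cosp T N = (\<Sum>j<N. smult (of_real ((-1) ^ j / fact (2 * j) * (T / 2) ^ (2 * j))) ([:0, 0, 1:] ^ j))"

lemma poly_cosp: "poly (cosp T N) (of_real x) = of_real (\<Sum>j<N. (-1) ^ j / fact (2 * j) * (T * x / 2) ^ (2 * j))"
proof -
  have "poly (cosp T N) (of_real x) = (\<Sum>j<N. of_real ((-1) ^ j / fact (2 * j) * (T / 2) ^ (2 * j)) * (of_real x * of_real x) ^ j)"
    by (simp add: cosp_def poly_sum poly_power)
  also have "\<dots> = (\<Sum>j<N. of_real ((-1) ^ j / fact (2 * j) * (T * x / 2) ^ (2 * j)))"
    by (intro sum.cong refl) (simp add: power_mult_distrib power_divide power_mult power2_eq_square)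
  finally show ?thesis by simp
qed

lemma even_exp_partial:
  fixes y :: real assumes "y \<ge> 0" shows "(\<Sum>j<N. 1 / fact (2 * j) * y ^ (2 * j)) \<le> exp y"
proof -
  have "(\<Sum>j<N. 1 / fact (2 * j) * y ^ (2 * j)) = (\<Sum>n\<in>(\<lambda>j. 2 * j) ` {..<N}. inverse (fact n) * y ^ n)"
    by (subst sum.reindex) (auto simp: inj_on_def divide_inverse)
  also have "\<dots> \<le> (\<Sum>n. inverse (fact n) * y ^ n)"
    using assms summable_exp[of y] by (intro sum_le_suminf) auto
  also have "\<dots> = exp y" by (simp add: exp_def divide_inverse mult_ac)
  finally show ?thesis .
qed

lemma cosp_bound:
  assumes "T \<ge> 0" shows "cmod (poly (cosp T N) (of_real x)) \<le> exp (T / 2 * \<bar>x\<bar>)"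
proof -
  have "cmod (poly (cosp T N) (of_real x)) \<le> (\<Sum>j<N. \<bar>(-1) ^ j / fact (2 * j) * (T * x / 2) ^ (2 * j)\<bar>)"
    unfolding poly_cosp norm_of_real by (rule sum_abs)
  also have "\<dots> = (\<Sum>j<N. 1 / fact (2 * j) * (T / 2 * \<bar>x\<bar>) ^ (2 * j))"
    using assms by (intro sum.cong refl) (simp add: abs_mult power_mult power_mult_distrib power_divide)
  also have "\<dots> \<le> exp (T / 2 * \<bar>x\<bar>)" using assms by (intro even_exp_partial) auto
  finally show ?thesis .
qed

lemma cosp_tendsto: "(\<lambda>N. poly (cosp T N) (of_real x)) \<longlonglongrightarrow> of_real (cos (T * x / 2))"
  unfolding poly_cosp using cos_paired[of "T * x / 2"] by (intro tendsto_of_real) (simp add: sums_def)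

text \<open>The bound exp(T|x|/2) on the Taylor polynomials is uniform in N and harmless against the
  Gaussian weight.\<close>

lemma cosp_norm_limit:
  assumes T: "T \<ge> 0"
  shows "(\<lambda>N. LINT x|lborel. (cmod (pf (cosp T N * H) x))\<^sup>2) \<longlonglongrightarrow> (LINT x|lborel. (cmod (of_real (cos (T * x / 2)) * pf H x))\<^sup>2)"
proof (rule integral_dominated_convergence[where w="\<lambda>x. (cmod (of_real (exp (T / 2 * \<bar>x\<bar>)) * pf H x))\<^sup>2"])
  have "gdec (\<lambda>x. of_real (exp (T / 2 * \<bar>x\<bar>)) * pf H x)"
    by (rule gdec_mult_exp[OF pf_gdec, where K=1 and b="T/2"]) (auto intro!: continuous_intros)
  then show "integrable lborel (\<lambda>x. (cmod (of_real (exp (T / 2 * \<bar>x\<bar>)) * pf H x))\<^sup>2)"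
    by (rule gdec_integrable_sq)
  have "gdec (\<lambda>x. of_real (cos (T * x / 2)) * pf H x)"
    by (rule gdec_mult_bdd[OF pf_gdec, where K=1]) (auto intro!: continuous_intros)
  then show "(\<lambda>x. (cmod (of_real (cos (T * x / 2)) * pf H x))\<^sup>2) \<in> borel_measurable lborel"
    using gdec_integrable_sq by blast
  show "(\<lambda>x. (cmod (pf (cosp T N * H) x))\<^sup>2) \<in> borel_measurable lborel" for N
    using gdec_integrable_sq[OF pf_gdec] by blast
  have eq: "pf (cosp T N * H) x = poly (cosp T N) (of_real x) * pf H x" for N x by (simp add: pf_def mult.assoc)
  show "AE x in lborel. (\<lambda>N. (cmod (pf (cosp T N * H) x))\<^sup>2) \<longlonglongrightarrow> (cmod (of_real (cos (T * x / 2)) * pf H x))\<^sup>2"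
    unfolding eq by (intro AE_I2 tendsto_intros cosp_tendsto)
  show "AE x in lborel. norm ((cmod (pf (cosp T N * H) x))\<^sup>2) \<le> (cmod (of_real (exp (T / 2 * \<bar>x\<bar>)) * pf H x))\<^sup>2" for N
    unfolding eq norm_mult using cosp_bound[OF T, of N]
    by (intro AE_I2) (auto simp: power_mult_distrib intro!: mult_right_mono power_mono)
qed

text \<open>Modulo \<open>\<xi>\<^sup>2 + 4a\<^sup>2\<close> the Taylor polynomial of \<open>cos(T\<xi>/2)\<close> is a constant \<open>\<kappa>\<close> of size at least \<open>(aT)\<^sup>2/2\<close>,
  so \<open>1 - cosp/\<kappa>\<close> is a multiple of \<open>\<xi>\<^sup>2/4 + a\<^sup>2\<close> and close to \<open>1\<close> for large \<open>T\<close>.\<close>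
lemma weighted_density:
  fixes a :: real
  assumes a: "a > 0" and \<epsilon>: "\<epsilon> > 0" and W: "W = [:of_real (a\<^sup>2), 0, 1 / 4:]"
  shows "\<exists>P. (LINT x|lborel. (cmod (pf (W * P - H) x))\<^sup>2) < \<epsilon>"
proof -
  define A where "A = (LINT x|lborel. (cmod (pf H x))\<^sup>2)"
  have A: "A \<ge> 0" unfolding A_def by simp
  \<comment> \<open>The final error is at most (A + 1)/\<kappa>^2 with \<kappa> >= (aT)^2/2. The 1
    added to A leaves room for replacing the cosine by a Taylor polynomial.\<close>
  have "((\<lambda>T. (A + 1) * 4 / (a * T) ^ 4) \<longlongrightarrow> 0) at_top" using a A by real_asymp
  then have "eventually (\<lambda>T. (A + 1) * 4 / (a * T) ^ 4 < \<epsilon>) at_top" by (rule order_tendstoD) (rule \<epsilon>)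
  then have "eventually (\<lambda>T. (A + 1) * 4 / (a * T) ^ 4 < \<epsilon> \<and> T > 0) at_top"
    by (rule eventually_conj) (rule eventually_gt_at_top)
  then obtain T where T: "(A + 1) * 4 / (a * T) ^ 4 < \<epsilon>" "T > 0"
    using eventually_happens'[OF trivial_limit_at_top_linorder] by blast
  have "(LINT x|lborel. (cmod (of_real (cos (T * x / 2)) * pf H x))\<^sup>2) \<le> A"
    unfolding A_def
  proof (rule integral_mono)
    have "gdec (\<lambda>x. of_real (cos (T * x / 2)) * pf H x)"
      by (rule gdec_mult_bdd[OF pf_gdec, where K=1]) (auto intro!: continuous_intros)
    then show "integrable lborel (\<lambda>x. (cmod (of_real (cos (T * x / 2)) * pf H x))\<^sup>2)" by (rule gdec_integrable_sq)
    show "(cmod (of_real (cos (T * x / 2)) * pf H x))\<^sup>2 \<le> (cmod (pf H x))\<^sup>2" for x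
      by (rule power_mono) (auto simp: norm_mult intro!: mult_left_le_one_le)
  qed (rule gdec_integrable_sq[OF pf_gdec])
  then have "eventually (\<lambda>N. (LINT x|lborel. (cmod (pf (cosp T N * H) x))\<^sup>2) < A + 1) sequentially"
    using T by (intro order_tendstoD(2)[OF cosp_norm_limit]) auto
  then have "eventually (\<lambda>N. (LINT x|lborel. (cmod (pf (cosp T N * H) x))\<^sup>2) < A + 1 \<and> N \<ge> 2) sequentially"
    by (rule eventually_conj) (rule eventually_ge_at_top)
  then obtain N where N: "(LINT x|lborel. (cmod (pf (cosp T N * H) x))\<^sup>2) < A + 1" "N \<ge> 2"
    using eventually_happens'[OF sequentially_bot] by blast
  define \<kappa> where "\<kappa> = (\<Sum>j<N. 1 / fact (2 * j) * (a * T) ^ (2 * j))"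
  \<comment> \<open>N >= 2 puts the term j = 1, equal to (aT)^2/2, into this sum of nonnegative
    terms.\<close>
  have "(\<Sum>j\<in>{1}. 1 / fact (2 * j) * (a * T) ^ (2 * j)) \<le> \<kappa>"
    unfolding \<kappa>_def using N a T by (intro sum_mono2) auto
  then have \<kappa>: "\<kappa> \<ge> (a * T)\<^sup>2 / 2" by simp
  have aT: "(a * T)\<^sup>2 / 2 > 0" using a T by simp
  then have \<kappa>0: "\<kappa> > 0" using \<kappa> by linarith
  have pd: "x - y dvd x ^ n - y ^ n" for x y :: "complex poly" and n
  proof (induction n)
    case (Suc n)
    have "x ^ Suc n - y ^ Suc n = x * (x ^ n - y ^ n) + (x - y) * y ^ n" by (simp add: algebra_simps)
    then show ?case using Suc by simp
  qed simp
  have "W dvd [:of_real \<kappa>:] - cosp T N"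
  proof -
    \<comment> \<open>The value of \<xi>^2 at the zeros of W. As x - y divides x^j - y^j, modulo W
      each \<xi>^2 may be replaced by it.\<close>
    let ?y = "[:of_real (- 4 * a\<^sup>2) :: complex:]"
    have "[:of_real \<kappa>:] = (\<Sum>j<N. smult (of_real ((-1) ^ j / fact (2 * j) * (T / 2) ^ (2 * j))) (?y ^ j))"
    proof -
      have p: "(-1) ^ j / fact (2 * j) * (T / 2) ^ (2 * j) * (- 4 * a\<^sup>2) ^ j = 1 / fact (2 * j) * (a * T) ^ (2 * j)" for j
      proof -
        have "(T / 2) ^ (2 * j) * (- 4 * a\<^sup>2) ^ j = ((T / 2)\<^sup>2 * (- 4 * a\<^sup>2)) ^ j" by (simp only: power_mult power_mult_distrib)
        also have "(T / 2)\<^sup>2 * (- 4 * a\<^sup>2) = (- 1) * (a * T)\<^sup>2" by (simp add: power2_eq_square)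
        also have "\<dots> ^ j = (-1) ^ j * (a * T) ^ (2 * j)" by (simp only: power_mult power_mult_distrib)
        finally show ?thesis by (simp add: mult.assoc)
      qed
      have "[:y:] ^ j = [:y ^ j:]" for y :: complex and j
        by (induction j) (simp_all add: one_pCons)
      then have "smult (of_real c) (?y ^ j) = [:of_real (c * (- 4 * a\<^sup>2) ^ j):]" for c j
        by simp
      then have "(\<Sum>j<N. smult (of_real ((-1) ^ j / fact (2 * j) * (T / 2) ^ (2 * j))) (?y ^ j))
          = (\<Sum>j<N. [:of_real (1 / fact (2 * j) * (a * T) ^ (2 * j)):])" by (simp only: p)
      also have "\<dots> = [:of_real \<kappa>:]" unfolding \<kappa>_def by (induction N) auto
      finally show ?thesis by simp
    qed
    then have eq: "[:of_real \<kappa>:] - cosp T N = (\<Sum>j<N. smult (- of_real ((-1) ^ j / fact (2 * j) * (T / 2) ^ (2 * j))) ([:0, 0, 1:] ^ j - ?y ^ j))"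
      unfolding cosp_def by (simp add: sum_subtractf[symmetric] smult_diff_right)
    have "[:0, 0, 1:] - ?y = smult 4 W" unfolding W by simp
    then have "W dvd [:0, 0, 1:] - ?y" by (simp add: dvd_smult)
    then have "W dvd [:0, 0, 1:] ^ j - ?y ^ j" for j using pd dvd_trans by blast
    then show ?thesis unfolding eq by (intro dvd_sum dvd_smult) auto
  qed
  then obtain P where P: "[:of_real \<kappa>:] - cosp T N = W * P" by (elim dvdE)
  have eq: "pf (W * smult (1 / of_real \<kappa>) (P * H) - H) x = (- 1 / of_real \<kappa>) * pf (cosp T N * H) x" for x
  proof -
    have "W * smult (1 / of_real \<kappa>) (P * H) - H = smult (- 1 / of_real \<kappa>) (cosp T N * H)"
    proof -
      have "W * smult (1 / of_real \<kappa>) (P * H) = smult (1 / of_real \<kappa>) ((W * P) * H)" by (simp add: mult.assoc)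
      also have "\<dots> = smult (1 / of_real \<kappa>) (smult (of_real \<kappa>) H - cosp T N * H)"
        unfolding P[symmetric] left_diff_distrib by simp
      also have "\<dots> = H - smult (1 / of_real \<kappa>) (cosp T N * H)" using \<kappa>0 by (simp add: smult_diff_right)
      finally show ?thesis by simp
    qed
    then show ?thesis by (simp add: pf_def)
  qed
  have "(LINT x|lborel. (cmod (pf (W * smult (1 / of_real \<kappa>) (P * H) - H) x))\<^sup>2) = (LINT x|lborel. (cmod (pf (cosp T N * H) x))\<^sup>2) / \<kappa>\<^sup>2"
    unfolding eq norm_mult power_mult_distrib using \<kappa>0 by (simp add: norm_divide power_divide)
  also have "\<dots> \<le> (A + 1) / ((a * T)\<^sup>2 / 2)\<^sup>2"
    using N aT \<kappa> A by (intro frac_le power_mono) auto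
  also have "\<dots> = (A + 1) * 4 / (a * T) ^ 4" by (simp add: power_divide power2_eq_square power4_eq_xxxx mult_ac)
  also note T(1)
  finally show ?thesis by blast
qed

subsection \<open>The inverse of \<open>g\<^sub>0\<close>\<close>

context gaussian_vacuum
begin

lemma norm_el: "(LINT x|lborel. (cmod (el P x))\<^sup>2) = (LINT x|lborel. (cmod (pf P x))\<^sup>2)"
  using ip0_self[of "el P"] ip0_self[of "pf P"] by (simp add: ip0_el ip0_pf)

lemma norm_el_diff: "(LINT x|lborel. (cmod (el P x - el Q x))\<^sup>2) = (LINT x|lborel. (cmod (pf P x - pf Q x))\<^sup>2)"
  unfolding el_diff[symmetric] pf_diff[symmetric] by (rule norm_el)

lemma W_pos: "a\<^sup>2 + x\<^sup>2 / 4 > 0"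
  using a_pos by (simp add: add_pos_nonneg)

text \<open>Convergence of g_0 F_j to H is tested against G/W, where W cancels and the scalar
  product of G with F_j is left. Hence every u that the choice operator in \<open>Sinv\<close> may
  return gives the same entry.\<close>

lemma g0bar_graph_ip0:
  assumes "g0bar_graph a \<psi>0 t u (el H)"
  shows "ip0 (el G) u = (LINT x|lborel. poly (cpoly G * H) (of_real x) * gw x / of_real (a\<^sup>2 + x\<^sup>2 / 4))"
proof -
  from assms obtain F where u: "sq_int u" and F: "\<And>j. F j \<in> range el"
    and l1: "l2conv F u" and l2: "l2conv (\<lambda>j. g0op a (F j)) (el H)"
    unfolding g0bar_graph_def L0_eq by blast
  from F have "\<forall>j. \<exists>P. F j = el P" by blast
  then have "\<exists>P. \<forall>j. F j = el (P j)" by (rule choice)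
  then obtain P where P: "\<And>j. F j = el (P j)" by blast
  define f where "f x = of_real (1 / (a\<^sup>2 + x\<^sup>2 / 4)) * pf G x" for x
  have "gdec f" unfolding f_def[abs_def]
  proof (rule gdec_mult_bdd[OF pf_gdec, where K="1 / a\<^sup>2"])
    show "continuous_on UNIV (\<lambda>x. complex_of_real (1 / (a\<^sup>2 + x\<^sup>2 / 4)))"
      using W_pos by (intro continuous_intros) (auto simp: less_imp_neq[symmetric])
    show "cmod (complex_of_real (1 / (a\<^sup>2 + x\<^sup>2 / 4))) \<le> 1 / a\<^sup>2" for x
      unfolding norm_of_real using W_pos[of x] a_pos by (auto intro!: frac_le)
  qed
  then have f: "sq_int f" by (rule gdec_sq_int)
  have "l2conv (\<lambda>j. pf (W * P j)) (pf H)"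
    using l2 unfolding l2conv_def P g0op_el norm_el_diff .
  then have "(\<lambda>j. ip0 f (pf (W * P j))) \<longlonglongrightarrow> ip0 f (pf H)"
    by (intro ip0_l2conv f gdec_sq_int pf_gdec)
  moreover have "ip0 f (pf (W * P j)) = ip0 (el G) (F j)" for j
  proof -
    have "ip0 f (pf (W * P j)) = ip0 (pf G) (pf (P j))"
      unfolding ip0_def
    proof (intro Bochner_Integration.integral_cong refl)
      fix x
      have "cnj (f x) * pf (W * P j) x = of_real (1 / (a\<^sup>2 + x\<^sup>2 / 4) * (a\<^sup>2 + x\<^sup>2 / 4)) * (cnj (pf G x) * pf (P j) x)"
        unfolding f_def pf_def poly_mult poly_W of_real_mult by (simp only: complex_cnj_mult complex_cnj_complex_of_real mult_ac)
      then show "cnj (f x) * pf (W * P j) x = cnj (pf G x) * pf (P j) x" using W_pos[of x] by simp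
    qed
    then show ?thesis by (simp add: P ip0_el ip0_pf)
  qed
  ultimately have "(\<lambda>j. ip0 (el G) (F j)) \<longlonglongrightarrow> ip0 f (pf H)" by simp
  moreover have "(\<lambda>j. ip0 (el G) (F j)) \<longlonglongrightarrow> ip0 (el G) u"
    by (rule ip0_l2conv[OF _ _ u l1]) (simp_all only: P gdec_sq_int el_gdec)
  ultimately have "ip0 (el G) u = ip0 f (pf H)" by (rule LIMSEQ_unique[rotated])
  also have "\<dots> = (LINT x|lborel. poly (cpoly G * H) (of_real x) * gw x / of_real (a\<^sup>2 + x\<^sup>2 / 4))"
    unfolding ip0_def f_def pf_def
    by (intro Bochner_Integration.integral_cong refl) (simp add: poly_cpoly sgw_sq[symmetric])
  finally show ?thesis .
qed

text \<open>In the polynomial picture the Sobolev norm has the weight 1 + \<xi>^2/4, which is at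
  most (1/a^4 + 1/a^2) W^2.\<close>

lemma el_pointwise_bound:
  "(cmod (el D x))\<^sup>2 \<le> (1 / a ^ 4 + 1 / a\<^sup>2) * (LINT x|lborel. (cmod (pf (W * D) x))\<^sup>2)"
proof -
  have "(cmod (el D x))\<^sup>2 \<le> (LINT x|lborel. (cmod (el D x))\<^sup>2) + (LINT x|lborel. (cmod (d1 (el D) x))\<^sup>2)"
    by (rule sobolev_bound[OF el_gdec _ el_d1_deriv]) (simp only: el_d1' el_gdec)
  also have "\<dots> = (LINT x|lborel. (cmod (pf D x))\<^sup>2 + (cmod (pf (smult (- \<i> / 2) (pCons 0 D)) x))\<^sup>2)"
    unfolding el_d1' norm_el
    by (rule Bochner_Integration.integral_add[symmetric]) (intro gdec_integrable_sq pf_gdec)+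
  also have "\<dots> \<le> (LINT x|lborel. (1 / a ^ 4 + 1 / a\<^sup>2) * (cmod (pf (W * D) x))\<^sup>2)"
  proof (rule integral_mono)
    fix x
    define m v :: real where "m = a\<^sup>2" and "v = x\<^sup>2 / 4"
    have mv: "m > 0" "v \<ge> 0" using a_pos by (auto simp: m_def v_def)
    have "1 + v \<le> (1 / m\<^sup>2 + 1 / m) * (m + v)\<^sup>2"
    proof -
      have "m\<^sup>2 \<le> (m + v)\<^sup>2" using mv by (intro power_mono) auto
      then have "1 \<le> 1 / m\<^sup>2 * (m + v)\<^sup>2" using mv by (simp add: field_simps)
      moreover have "m * v \<le> (m + v)\<^sup>2" using mv by (simp add: power2_eq_square algebra_simps)
      then have "v \<le> 1 / m * (m + v)\<^sup>2" using mv by (simp add: field_simps)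
      ultimately show ?thesis by (simp add: algebra_simps)
    qed
    then have 1: "(1 + v) * (cmod (pf D x))\<^sup>2 \<le> (1 / m\<^sup>2 + 1 / m) * (m + v)\<^sup>2 * (cmod (pf D x))\<^sup>2"
      by (rule mult_right_mono) simp
    have 2: "(cmod (pf (smult (- \<i> / 2) (pCons 0 D)) x))\<^sup>2 = v * (cmod (pf D x))\<^sup>2"
      by (simp add: pf_def norm_mult norm_divide power_mult_distrib power_divide v_def)
    have 3: "(cmod (pf (W * D) x))\<^sup>2 = (m + v)\<^sup>2 * (cmod (pf D x))\<^sup>2"
      unfolding pf_def poly_mult poly_W norm_mult norm_of_real by (simp add: power_mult_distrib m_def v_def)
    have 4: "a ^ 4 = m\<^sup>2" "a\<^sup>2 = m" unfolding m_def by simp_all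
    show "(cmod (pf D x))\<^sup>2 + (cmod (pf (smult (- \<i> / 2) (pCons 0 D)) x))\<^sup>2
        \<le> (1 / a ^ 4 + 1 / a\<^sup>2) * (cmod (pf (W * D) x))\<^sup>2"
      using 1 unfolding 2 3 4 by (simp only: distrib_right mult_1 mult.assoc)
  qed (intro integrable_mult_right Bochner_Integration.integrable_add gdec_integrable_sq pf_gdec)+
  finally show ?thesis by simp
qed

lemma pf_le_W: "(LINT x|lborel. (cmod (pf D x))\<^sup>2) \<le> 1 / a ^ 4 * (LINT x|lborel. (cmod (pf (W * D) x))\<^sup>2)"
proof -
  have "(LINT x|lborel. (cmod (pf D x))\<^sup>2) \<le> (LINT x|lborel. 1 / a ^ 4 * (cmod (pf (W * D) x))\<^sup>2)"
  proof (rule integral_mono)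
    fix x
    have "a ^ 4 \<le> (a\<^sup>2 + x\<^sup>2 / 4)\<^sup>2"
      using power_mono[of "a\<^sup>2" "a\<^sup>2 + x\<^sup>2 / 4" 2] by (simp add: power_mult[symmetric])
    then have "a ^ 4 * (cmod (pf D x))\<^sup>2 \<le> (a\<^sup>2 + x\<^sup>2 / 4)\<^sup>2 * (cmod (pf D x))\<^sup>2"
      by (rule mult_right_mono) simp
    also have "\<dots> = (cmod (pf (W * D) x))\<^sup>2"
      unfolding pf_def poly_mult poly_W norm_mult norm_of_real by (simp add: power_mult_distrib)
    finally show "(cmod (pf D x))\<^sup>2 \<le> 1 / a ^ 4 * (cmod (pf (W * D) x))\<^sup>2"
      using a_pos by (simp add: field_simps)
  qed (intro integrable_mult_right gdec_integrable_sq pf_gdec)+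
  then show ?thesis by simp
qed

text \<open>Density supplies P_j with W P_j close to H. By \<open>el_pointwise_bound\<close> the
  functions \<open>el (P j)\<close> are then Cauchy at every x, which produces u as a pointwise
  limit; \<open>pf_le_W\<close> makes this limit an L^2 limit.\<close>

lemma g0bar_graph_exists: "\<exists>u. g0bar_graph a \<psi>0 t u (el H)"
proof -
  have "\<exists>P. \<forall>j. (LINT x|lborel. (cmod (pf (W * P j - H) x))\<^sup>2) < 1 / real (Suc j)"
    using weighted_density[OF a_pos _ W_def, of "1 / real (Suc _)" H] by (intro choice allI) simp
  then obtain P where P: "\<And>j. (LINT x|lborel. (cmod (pf (W * P j - H) x))\<^sup>2) < 1 / real (Suc j)" by blast
  have cauchy: "(LINT x|lborel. (cmod (pf (W * (P i - P j)) x))\<^sup>2) \<le> 4 / real (Suc i)" if "i \<le> j" for i j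
  proof -
    have "(LINT x|lborel. (cmod (pf (W * (P i - P j)) x))\<^sup>2)
        \<le> (LINT x|lborel. 2 * (cmod (pf (W * P i - H) x))\<^sup>2 + 2 * (cmod (pf (W * P j - H) x))\<^sup>2)"
    proof (rule integral_mono)
      fix x
      have "pf (W * (P i - P j)) x = pf (W * P i - H) x - pf (W * P j - H) x"
        by (simp add: pf_def algebra_simps)
      then have "(cmod (pf (W * (P i - P j)) x))\<^sup>2 \<le> (cmod (pf (W * P i - H) x) + cmod (pf (W * P j - H) x))\<^sup>2"
        by (auto intro!: power_mono norm_triangle_ineq4)
      also have "\<dots> \<le> 2 * (cmod (pf (W * P i - H) x))\<^sup>2 + 2 * (cmod (pf (W * P j - H) x))\<^sup>2"
        using zero_le_power2[of "cmod (pf (W * P i - H) x) - cmod (pf (W * P j - H) x)"]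
        by (simp add: power2_eq_square algebra_simps)
      finally show "(cmod (pf (W * (P i - P j)) x))\<^sup>2 \<le> 2 * (cmod (pf (W * P i - H) x))\<^sup>2 + 2 * (cmod (pf (W * P j - H) x))\<^sup>2" .
    qed (intro integrable_mult_right Bochner_Integration.integrable_add gdec_integrable_sq pf_gdec)+
    also have "\<dots> = 2 * (LINT x|lborel. (cmod (pf (W * P i - H) x))\<^sup>2) + 2 * (LINT x|lborel. (cmod (pf (W * P j - H) x))\<^sup>2)"
      by (simp add: gdec_integrable_sq pf_gdec)
    also have "\<dots> \<le> 2 * (1 / real (Suc i)) + 2 * (1 / real (Suc j))"
      using P[of i] P[of j] by (intro add_mono mult_left_mono) auto
    also have "\<dots> \<le> 2 * (1 / real (Suc i)) + 2 * (1 / real (Suc i))"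
      using that by (intro add_mono mult_left_mono frac_le) auto
    finally show ?thesis by simp
  qed
  have to0: "(\<lambda>i. c * (4 / real (Suc i))) \<longlonglongrightarrow> 0" for c :: real by real_asymp
  define c where "c = 1 / a ^ 4 + 1 / a\<^sup>2"
  have c: "c \<ge> 0" using a_pos by (simp add: c_def)
  have "Cauchy (\<lambda>j. el (P j) x)" for x
  proof (rule metric_CauchyI)
    fix e :: real assume e: "e > 0"
    have "eventually (\<lambda>i. c * (4 / real (Suc i)) < e\<^sup>2) sequentially"
      using e by (intro order_tendstoD(2)[OF to0]) auto
    then obtain M where M: "\<And>i. i \<ge> M \<Longrightarrow> c * (4 / real (Suc i)) < e\<^sup>2" unfolding eventually_sequentially by blast
    have d: "dist (el (P i) x) (el (P j) x) < e" if "M \<le> i" "i \<le> j" for i j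
    proof -
      have "(cmod (el (P i - P j) x))\<^sup>2 \<le> c * (4 / real (Suc i))"
        using el_pointwise_bound[of "P i - P j" x] cauchy[OF that(2)] c
        unfolding c_def[symmetric] by (meson mult_left_mono order_trans)
      also have "\<dots> < e\<^sup>2" using M that by blast
      finally have "cmod (el (P i - P j) x) < e" by (rule power_less_imp_less_base) (use e in simp)
      then show ?thesis unfolding dist_norm el_diff .
    qed
    show "\<exists>M. \<forall>m\<ge>M. \<forall>n\<ge>M. dist (el (P m) x) (el (P n) x) < e"
      by (rule exI[of _ M]) (metis d dist_commute nat_le_linear)
  qed
  then have "\<exists>u. \<forall>x. (\<lambda>j. el (P j) x) \<longlonglongrightarrow> u x"
    using Cauchy_convergent unfolding convergent_def by (intro choice) blast
  then obtain u where u: "\<And>x. (\<lambda>j. el (P j) x) \<longlonglongrightarrow> u x" by blast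
  have L: "sq_int u" "l2conv (\<lambda>j. el (P j)) u"
  proof -
    have b: "(LINT x|lborel. (cmod (el (P i) x - el (P j) x))\<^sup>2) \<le> 1 / a ^ 4 * (4 / real (Suc i))" if "i \<le> j" for i j
    proof -
      have "(LINT x|lborel. (cmod (pf (P i - P j) x))\<^sup>2) \<le> 1 / a ^ 4 * (LINT x|lborel. (cmod (pf (W * (P i - P j)) x))\<^sup>2)"
        by (rule pf_le_W)
      also have "\<dots> \<le> 1 / a ^ 4 * (4 / real (Suc i))"
        using cauchy[OF that] by (rule mult_left_mono) simp
      finally show ?thesis unfolding norm_el_diff pf_diff .
    qed
    show "sq_int u"
      by (rule l2_limit_of_pointwise(1)[OF gdec_sq_int[OF el_gdec] u b to0])
    show "l2conv (\<lambda>j. el (P j)) u"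
      by (rule l2_limit_of_pointwise(2)[OF gdec_sq_int[OF el_gdec] u b to0])
  qed
  have "l2conv (\<lambda>j. g0op a (el (P j))) (el H)"
    unfolding l2conv_def g0op_el norm_el_diff pf_diff[symmetric]
  proof (rule tendsto_sandwich[where f="\<lambda>_. 0" and h="\<lambda>j. 1 / real (Suc j)"])
    show "(\<lambda>j. 1 / real (Suc j)) \<longlonglongrightarrow> 0" by real_asymp
    show "\<forall>\<^sub>F j in sequentially. (LINT x|lborel. (cmod (pf (W * P j - H) x))\<^sup>2) \<le> 1 / real (Suc j)"
      using P less_imp_le by (intro always_eventually) blast
    show "\<forall>\<^sub>F j in sequentially. 0 \<le> (LINT x|lborel. (cmod (pf (W * P j - H) x))\<^sup>2)"
      by (intro always_eventually allI integral_nonneg_AE) simp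
  qed (rule tendsto_const)
  then show ?thesis unfolding g0bar_graph_def L0_eq
    by (intro exI[of _ u] conjI L gdec_sq_int[OF el_gdec] exI[of _ "\<lambda>j. el (P j)"] allI rangeI)
qed

lemma Sinv_eq:
  "Sinv a \<psi>0 t n k = of_real (1 / sqrt (fact n) * (1 / sqrt (fact k))) *
     (LINT x|lborel. poly (He n * He k) (of_real x) * gw x / of_real (a\<^sup>2 + x\<^sup>2 / 4))"
proof -
  let ?h = "\<lambda>n. smult (of_real (1 / sqrt (fact n))) (He n)"
  have cp: "cpoly (?h n) = ?h n"
    by (simp add: cpoly_smult He_real)
  have "g0bar_graph a \<psi>0 t (SOME u. g0bar_graph a \<psi>0 t u (el (?h k))) (el (?h k))"
    by (rule someI_ex[OF g0bar_graph_exists])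
  then have "Sinv a \<psi>0 t n k = (LINT x|lborel. poly (?h n * ?h k) (of_real x) * gw x / of_real (a\<^sup>2 + x\<^sup>2 / 4))"
    unfolding Sinv_def slice_psin using g0bar_graph_ip0[of _ "?h k" "?h n"] unfolding cp by blast
  also have "\<dots> = (LINT x|lborel. of_real (1 / sqrt (fact n) * (1 / sqrt (fact k))) * (poly (He n * He k) (of_real x) * gw x / of_real (a\<^sup>2 + x\<^sup>2 / 4)))"
    by (intro Bochner_Integration.integral_cong refl) (simp add: mult_ac)
  also have "\<dots> = of_real (1 / sqrt (fact n) * (1 / sqrt (fact k))) *
     (LINT x|lborel. poly (He n * He k) (of_real x) * gw x / of_real (a\<^sup>2 + x\<^sup>2 / 4))"
    by (rule integral_mult_right_zero)
  finally show ?thesis .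
qed

lemma moment_problem:
  "of_real (1 / sqrt (fact n) * (1 / sqrt (fact k))) *
     mu_int a (\<lambda>z. of_real ((cmod (exp (- of_real ((cmod z)\<^sup>2 / 2))))\<^sup>2) * z ^ n * cnj z ^ k) = Sinv a \<psi>0 t n k"
proof -
  let ?e = "\<lambda>i j. if i = n then (if j = k then 1 else 0) else (0::complex)"
  have w: "(cmod (exp (- complex_of_real ((cmod z)\<^sup>2 / 2))))\<^sup>2 = exp (- (cmod z)\<^sup>2)" for z
    by (simp add: power2_eq_square flip: exp_add)
  have s: "(\<Sum>i<Suc n. \<Sum>j<Suc k. ?e i j * (z ^ i * cnj z ^ j)) = z ^ n * cnj z ^ k" for z
  proof -
    have "(\<Sum>i<Suc n. \<Sum>j<Suc k. ?e i j * (z ^ i * cnj z ^ j)) =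
      (\<Sum>i<Suc n. if i = n then (\<Sum>j<Suc k. if j = k then z ^ i * cnj z ^ j else 0) else 0)"
      by (intro sum.cong refl) (auto intro!: sum.cong)
    then show ?thesis by simp
  qed
  have s': "(\<Sum>i<Suc n. \<Sum>j<Suc k. smult (?e i j) (He i * He j)) = He n * He k"
  proof -
    have "(\<Sum>i<Suc n. \<Sum>j<Suc k. smult (?e i j) (He i * He j)) =
      (\<Sum>i<Suc n. if i = n then (\<Sum>j<Suc k. if j = k then He i * He j else 0) else 0)"
      by (intro sum.cong refl) (auto intro!: sum.cong)
    then show ?thesis by simp
  qed
  have "mu_int a (\<lambda>z. of_real ((cmod (exp (- of_real ((cmod z)\<^sup>2 / 2))))\<^sup>2) * z ^ n * cnj z ^ k)
    = (LINT x|lborel. poly (He n * He k) (of_real x) * gw x / of_real (a\<^sup>2 + x\<^sup>2 / 4))"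
    using mu_int_poly[OF a_pos, where N="Suc n" and M="Suc k" and e="?e"] unfolding s s' w by (simp only: mult.assoc)
  then show ?thesis by (simp only: Sinv_eq)
qed

subsection \<open>The resolution of the identity\<close>

lemma L1_eq: "L1 a \<psi>0 t = range (\<lambda>P. L1op a (el P))"
  unfolding L1_def L0_eq by auto

text \<open>Because of the factorisation of \<open>g\<^sub>0\<close>, the value of \<open>ip1\<close> does not depend on the chosen preimages under \<open>L\<close>.\<close>
lemma ip1_L1:
  assumes "f \<in> L1 a \<psi>0 t" "h \<in> L1 a \<psi>0 t" shows "ip1 a \<psi>0 t f h = ip0 f h"
proof -
  have pre: "\<exists>P. (SOME u. u \<in> L0 \<psi>0 t \<and> L1op a u = f) = el P \<and> L1op a (el P) = f" if "f \<in> L1 a \<psi>0 t" for f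
  proof -
    have "\<exists>u. u \<in> L0 \<psi>0 t \<and> L1op a u = f" using that unfolding L1_def by blast
    from someI_ex[OF this] show ?thesis unfolding L0_eq by auto
  qed
  obtain P where P: "(SOME u. u \<in> L0 \<psi>0 t \<and> L1op a u = f) = el P" "L1op a (el P) = f"
    using pre[OF assms(1)] by blast
  obtain Q where Q: "(SOME u. u \<in> L0 \<psi>0 t \<and> L1op a u = h) = el Q" "L1op a (el Q) = h"
    using pre[OF assms(2)] by blast
  show ?thesis unfolding ip1_def P(1) Q(1) ip0_L1op[symmetric] P(2) Q(2) ..
qed

lemma slice_phin: "slice (phin a \<psi>0 n) t = L1op a (el (smult (of_real (1 / sqrt (fact n))) (He n)))"
  unfolding slice_psin[symmetric] by (simp add: slice_def phin_def Lop_def L1op_def dx_def d1_def fun_eq_iff)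

lemma braphi_el:
  assumes "W * Q = (\<Sum>n<N. smult (c n) (He n))"
  shows "braphi a \<psi>0 t z (L1op a (el Q)) = of_real (exp (- (cmod z)\<^sup>2 / 2)) * (\<Sum>n<N. c n * cnj z ^ n)"
proof -
  let ?h = "\<lambda>n. smult (of_real (1 / sqrt (fact n))) (He n)"
  have cp: "cpoly (?h n) = ?h n" for n
    by (simp add: cpoly_smult He_real)
  have ip: "ip1 a \<psi>0 t (slice (phin a \<psi>0 n) t) (L1op a (el Q)) = of_real (1 / sqrt (fact n)) * (if n < N then fact n * c n else 0)" for n
  proof -
    have "ip1 a \<psi>0 t (slice (phin a \<psi>0 n) t) (L1op a (el Q)) = gm (cpoly (?h n) * (W * Q))"
      unfolding slice_phin by (subst ip1_L1) (auto simp: L1_eq ip0_L1op g0ip_el)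
    also have "\<dots> = of_real (1 / sqrt (fact n)) * gm (He n * (W * Q))" unfolding cp by (simp only: mult_smult_left gm_smult)
    finally show ?thesis by (simp only: He_coeff[OF assms])
  qed
  have sf: "complex_of_real (sqrt (fact n)) * of_real (sqrt (fact n)) = fact n" for n
    by (simp flip: of_real_mult)
  have "braphi a \<psi>0 t z (L1op a (el Q)) = (\<Sum>n<N. cnj (exp (- of_real ((cmod z)\<^sup>2 / 2)) * of_real (1 / sqrt (fact n)) * z ^ n)
        * (of_real (1 / sqrt (fact n)) * (if n < N then fact n * c n else 0)))"
    unfolding braphi_def ip by (rule suminf_finite) auto
  also have "\<dots> = (\<Sum>n<N. of_real (exp (- (cmod z)\<^sup>2 / 2)) * (c n * cnj z ^ n))"
  proof (intro sum.cong refl)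
    fix n assume n: "n \<in> {..<N}"
    have e: "cnj (exp (- complex_of_real ((cmod z)\<^sup>2 / 2))) = of_real (exp (- (cmod z)\<^sup>2 / 2))"
      unfolding of_real_minus[symmetric] exp_of_real by simp
    \<comment> \<open>One root comes from a_n, the other from the normalisation of phi_n; together
      they cancel the n! of \<open>He_coeff\<close>.\<close>
    have "complex_of_real (1 / sqrt (fact n)) * of_real (1 / sqrt (fact n)) * fact n = 1"
      unfolding sf[of n, symmetric] by simp
    then have "cnj (exp (- of_real ((cmod z)\<^sup>2 / 2))) * (complex_of_real (1 / sqrt (fact n)) * of_real (1 / sqrt (fact n)) * fact n) * (c n * cnj z ^ n)
      = of_real (exp (- (cmod z)\<^sup>2 / 2)) * (c n * cnj z ^ n)" unfolding e by simp
    then show "cnj (exp (- of_real ((cmod z)\<^sup>2 / 2)) * of_real (1 / sqrt (fact n)) * z ^ n)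
        * (of_real (1 / sqrt (fact n)) * (if n < N then fact n * c n else 0)) = of_real (exp (- (cmod z)\<^sup>2 / 2)) * (c n * cnj z ^ n)"
      using n by (simp only: complex_cnj_mult complex_cnj_power complex_cnj_complex_of_real lessThan_iff if_True mult_ac)
  qed
  finally show ?thesis by (simp add: sum_distrib_left)
qed

lemma resolution_of_identity:
  assumes "f \<in> L1 a \<psi>0 t" "h \<in> L1 a \<psi>0 t"
  shows "mu_int a (\<lambda>z. cnj (braphi a \<psi>0 t z f) * braphi a \<psi>0 t z h) = ip1 a \<psi>0 t f h"
proof -
  obtain P Q where fh: "f = L1op a (el P)" "h = L1op a (el Q)" using assms unfolding L1_eq by blast
  obtain N c where c: "W * P = (\<Sum>n<N. smult (c n) (He n))" using He_span by blast
  obtain M d where d: "W * Q = (\<Sum>n<M. smult (d n) (He n))" using He_span by blast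
  have e: "cnj (braphi a \<psi>0 t z f) * braphi a \<psi>0 t z h =
      of_real (exp (- (cmod z)\<^sup>2)) * (\<Sum>n<N. \<Sum>k<M. cnj (c n) * d k * (z ^ n * cnj z ^ k))" for z
  proof -
    have x: "exp (- (cmod z)\<^sup>2 / 2) * exp (- (cmod z)\<^sup>2 / 2) = exp (- (cmod z)\<^sup>2)" by (simp flip: exp_add)
    have "cnj (braphi a \<psi>0 t z f) * braphi a \<psi>0 t z h = of_real (exp (- (cmod z)\<^sup>2 / 2) * exp (- (cmod z)\<^sup>2 / 2)) *
      ((\<Sum>n<N. cnj (c n) * z ^ n) * (\<Sum>k<M. d k * cnj z ^ k))"
      unfolding fh braphi_el[OF c] braphi_el[OF d] by simp
    then show ?thesis unfolding x sum_product by (simp only: mult_ac)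
  qed
  have cs: "cpoly (W * P) = (\<Sum>n<N. smult (cnj (c n)) (He n))"
  proof -
    have "cpoly (\<Sum>n<N. f n) = (\<Sum>n<N. cpoly (f n))" for f and N :: nat
      by (induction N) (auto simp: cpoly_add)
    then show ?thesis unfolding c by (simp only: cpoly_smult He_real)
  qed
  have "mu_int a (\<lambda>z. cnj (braphi a \<psi>0 t z f) * braphi a \<psi>0 t z h) =
    (LINT x|lborel. poly (\<Sum>n<N. \<Sum>k<M. smult (cnj (c n) * d k) (He n * He k)) (of_real x) * gw x / of_real (a\<^sup>2 + x\<^sup>2 / 4))"
    unfolding e by (rule mu_int_poly[OF a_pos])
  also have "(\<Sum>n<N. \<Sum>k<M. smult (cnj (c n) * d k) (He n * He k)) = cpoly (W * P) * (W * Q)"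
    unfolding cs d sum_product by (simp add: mult.commute)
  also have "(LINT x|lborel. poly (cpoly (W * P) * (W * Q)) (of_real x) * gw x / of_real (a\<^sup>2 + x\<^sup>2 / 4)) = gm (cpoly P * (W * Q))"
    unfolding gm_def
  proof (intro Bochner_Integration.integral_cong refl)
    fix x :: real
    have "poly (cpoly (W * P)) (of_real x) = of_real (a\<^sup>2 + x\<^sup>2 / 4) * poly (cpoly P) (of_real x)"
      unfolding poly_cpoly poly_mult poly_W by simp
    then show "poly (cpoly (W * P) * (W * Q)) (of_real x) * gw x / of_real (a\<^sup>2 + x\<^sup>2 / 4) = poly (cpoly P * (W * Q)) (of_real x) * gw x"
      unfolding poly_mult[of "cpoly (W * P)"] poly_mult[of "cpoly P"] using W_pos[of x] by (simp del: of_real_add)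
  qed
  also have "\<dots> = ip1 a \<psi>0 t f h"
    unfolding ip1_L1[OF assms] unfolding fh ip0_L1op g0ip_el ..
  finally show ?thesis .
qed

end

subsection \<open>The generating function of the Hermite recursion\<close>

text \<open>Hermite polynomials with a parameter; b = -1 gives the recurrence of He_n. The field is
  left open because the real version with b >= 0 and w >= 0 has nonnegative terms and serves as a
  majorant of the complex one.\<close>

fun hm :: "'a::real_normed_field \<Rightarrow> nat \<Rightarrow> 'a \<Rightarrow> 'a" where
  "hm b 0 w = 1"
| "hm b (Suc n) w = w * hm b n w + b * of_nat n * hm b (n - 1) w"

lemma hm_deriv: "(hm b n has_field_derivative of_nat n * hm b (n - 1) w) (at w)"
proof (induction n rule: less_induct)
  case (less n)
  show ?case
  proof (cases n)
    case (Suc m)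
    have d1: "(hm b m has_field_derivative of_nat m * hm b (m - 1) w) (at w)"
      and d2: "(hm b (m - 1) has_field_derivative of_nat (m - 1) * hm b (m - 1 - 1) w) (at w)"
      using less.IH[of m] less.IH[of "m - 1"] Suc by simp_all
    have "((\<lambda>w. w * hm b m w + b * of_nat m * hm b (m - 1) w) has_field_derivative
      (1 * hm b m w + (of_nat m * hm b (m - 1) w) * w + b * of_nat m * (of_nat (m - 1) * hm b (m - 1 - 1) w))) (at w)"
      by (intro DERIV_add DERIV_mult DERIV_cmult d1 d2 DERIV_ident)
    moreover have "1 * hm b m w + (of_nat m * hm b (m - 1) w) * w + b * of_nat m * (of_nat (m - 1) * hm b (m - 1 - 1) w)
        = of_nat n * hm b (n - 1) w"
      by (cases m) (simp_all add: Suc algebra_simps)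
    moreover have "hm b n = (\<lambda>w. w * hm b m w + b * of_nat m * hm b (m - 1) w)"
      by (simp add: Suc fun_eq_iff)
    ultimately show ?thesis by (simp only:)
  qed (simp add: fun_eq_iff)
qed

text \<open>The n-th derivative of f(v) = exp(w v + b v^2/2) is hm_n(w + b v) f(v), so the series is
  the Taylor expansion of this entire function at 0.\<close>

lemma hm_sums:
  fixes b w z :: complex
  shows "(\<lambda>n. hm b n w * z ^ n / fact n) sums exp (w * z + b * z\<^sup>2 / 2)"
proof -
  define f where "f v = exp (w * v + b * v\<^sup>2 / 2)" for v
  have "(deriv ^^ n) f = (\<lambda>v. hm b n (w + b * v) * f v)" for n
  proof (induction n)
    case (Suc n)
    have f': "(f has_field_derivative (w + b * v) * f v) (at v)" for v
      unfolding f_def by (auto intro!: derivative_eq_intros)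
    have h': "((\<lambda>v. hm b n (w + b * v)) has_field_derivative (of_nat n * hm b (n - 1) (w + b * v)) * b) (at v)" for v
      by (rule DERIV_chain2[OF hm_deriv]) (auto intro!: derivative_eq_intros)
    have "((\<lambda>v. hm b n (w + b * v) * f v) has_field_derivative hm b (Suc n) (w + b * v) * f v) (at v)" for v
      by (rule DERIV_cong[OF DERIV_mult[OF h' f']]) (simp add: algebra_simps)
    then show ?case by (simp only: funpow.simps o_apply Suc) (rule ext, rule DERIV_imp_deriv)
  qed (auto simp: fun_eq_iff)
  moreover have "(\<lambda>n. (deriv ^^ n) f 0 / fact n * (z - 0) ^ n) sums f z"
    by (rule holomorphic_power_series[where r="cmod z + 1"]) (auto simp: f_def[abs_def] intro!: holomorphic_intros)
  ultimately show ?thesis by (simp add: f_def)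
qed

lemma hm_of_real: "hm (of_real b) n (of_real w) = (of_real (hm b n w) :: complex)"
  by (induction b n w rule: hm.induct) auto

lemma hm_nonneg: "b \<ge> 0 \<Longrightarrow> w \<ge> 0 \<Longrightarrow> hm b n w \<ge> (0::real)"
  by (induction b n w rule: hm.induct) auto

lemma norm_hm_le: "norm (hm b n w) \<le> hm (norm b) n (norm w)" for b w :: complex
proof (induction b n w rule: hm.induct)
  case (2 b n w)
  have "norm (hm b (Suc n) w) \<le> norm (w * hm b n w) + norm (b * of_nat n * hm b (n - 1) w)"
    unfolding hm.simps by (rule norm_triangle_ineq)
  also have "\<dots> \<le> norm w * hm (norm b) n (norm w) + norm b * of_nat n * hm (norm b) (n - 1) (norm w)"
    unfolding norm_mult norm_of_nat using 2 by (intro add_mono mult_left_mono) auto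
  finally show ?case by simp
qed simp

text \<open>Putting norms on b, w and z gives a majorant with nonnegative terms that sums by the
  same generating function, hence a bound uniform in N.\<close>

lemma hm_partial_bound:
  fixes b w z :: complex
  shows "(\<Sum>n<N. norm (hm b n w * z ^ n / fact n)) \<le> exp (norm w * norm z + norm b * (norm z)\<^sup>2 / 2)"
proof -
  let ?f = "\<lambda>n. hm (norm b) n (norm w) * norm z ^ n / fact n"
  have "(\<lambda>n. complex_of_real (?f n)) sums exp (of_real (norm w) * of_real (norm z) + of_real (norm b) * (of_real (norm z))\<^sup>2 / 2)"
    using hm_sums[of "of_real (norm b)" "of_real (norm w)" "of_real (norm z)"] by (simp add: hm_of_real)
  also have "exp (of_real (norm w) * of_real (norm z) + of_real (norm b) * (of_real (norm z))\<^sup>2 / 2)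
      = complex_of_real (exp (norm w * norm z + norm b * (norm z)\<^sup>2 / 2))" by (simp add: exp_of_real[symmetric])
  finally have s: "?f sums exp (norm w * norm z + norm b * (norm z)\<^sup>2 / 2)" by (simp only: sums_of_real_iff)
  have "(\<Sum>n<N. norm (hm b n w * z ^ n / fact n)) \<le> (\<Sum>n<N. ?f n)"
    unfolding norm_mult norm_divide norm_power norm_fact
    by (intro sum_mono divide_right_mono mult_right_mono norm_hm_le) auto
  also have "\<dots> \<le> exp (norm w * norm z + norm b * (norm z)\<^sup>2 / 2)"
    using sum_le_suminf[OF sums_summable[OF s], of "{..<N}"] sums_unique[OF s] by (auto simp: hm_nonneg)
  finally show ?thesis .
qed

subsection \<open>The coherent states in closed form\<close>

context gaussian_vacuum
begin

definition \<sigma> :: complex where "\<sigma> = 1 / s"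

definition pz :: "complex \<Rightarrow> real \<Rightarrow> complex" where
  "pz z x = of_real (exp (- (cmod z)\<^sup>2 / 2)) *
     (C * exp (- \<i> * \<sigma> * of_real x * z + (2 * \<sigma> - 1) * z\<^sup>2 / 2 - \<sigma> * (of_real x)\<^sup>2 / 4))"

definition pp :: "complex \<Rightarrow> real \<Rightarrow> complex" where
  "pp z x = - \<i> * \<sigma> * z - \<sigma> * of_real x / 2"

lemma pz_g: "pz z x = of_real (exp (- (cmod z)\<^sup>2 / 2)) * (exp ((- \<i> * \<sigma> * of_real x) * z + (2 * \<sigma> - 1) * z\<^sup>2 / 2) * g x)"
proof -
  have "exp (- \<i> * \<sigma> * of_real x * z + (2 * \<sigma> - 1) * z\<^sup>2 / 2 - \<sigma> * (of_real x)\<^sup>2 / 4)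
     = exp ((- \<i> * \<sigma> * of_real x) * z + (2 * \<sigma> - 1) * z\<^sup>2 / 2) * exp (- of_real (x\<^sup>2) / (4 * s))"
    unfolding exp_add[symmetric] by (rule arg_cong[where f=exp]) (simp add: \<sigma>_def)
  then show ?thesis by (simp only: pz_def g_def mult_ac)
qed

text \<open>\<open>pderiv_U\<close> eliminates the derivative from \<open>Xi\<close> and leaves a
  three-term recurrence. In its parameter 2\<sigma> - 1 the part 2\<sigma> stems from 2i d/dx, the
  -1 from the derivative subtracted in the recursion of \<open>He\<close>.\<close>

lemma el_He: "el (He n) x = hm (2 * \<sigma> - 1) n (- \<i> * \<sigma> * of_real x) * g x"
proof (induction n rule: less_induct)
  case (less n)
  show ?case
  proof (cases n)
    case (Suc m)
    have pd: "pderiv (He m) = smult (of_nat m) (He (m - 1))"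
      by (cases m) (auto simp: pderiv_He simp del: He.simps(2))
    have "\<i> * s * poly (pderiv (U (He m))) (of_real x) = poly (U (pderiv (He m))) (of_real x)"
      by (simp flip: pderiv_U)
    also have "\<dots> = of_nat m * poly (U (He (m - 1))) (of_real x)" unfolding pd U_smult by simp
    finally have U': "poly (pderiv (U (He m))) (of_real x) = - \<i> * \<sigma> * of_nat m * poly (U (He (m - 1))) (of_real x)"
    proof -
      assume eq: "\<i> * s * poly (pderiv (U (He m))) (of_real x) = of_nat m * poly (U (He (m - 1))) (of_real x)"
      have "poly (pderiv (U (He m))) (of_real x) = (- \<i> * \<sigma>) * (\<i> * s * poly (pderiv (U (He m))) (of_real x))"
        by (simp add: \<sigma>_def)
      also have "\<dots> = - \<i> * \<sigma> * of_nat m * poly (U (He (m - 1))) (of_real x)"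
        unfolding eq by (simp only: mult.assoc)
      finally show ?thesis .
    qed
    have "el (He (Suc m)) x = el (pCons 0 (He m)) x - of_nat m * el (He (m - 1)) x"
      by (simp add: el_diff pd el_smult)
    also have "el (pCons 0 (He m)) x = 2 * \<i> * poly (pderiv (U (He m))) (of_real x) * g x - \<i> * \<sigma> * of_real x * el (He m) x"
      by (simp add: el_def U_pCons Xi_def \<sigma>_def algebra_simps)
    also have "\<dots> = 2 * \<sigma> * of_nat m * el (He (m - 1)) x - \<i> * \<sigma> * of_real x * el (He m) x"
      unfolding U' by (simp add: el_def)
    finally have "el (He (Suc m)) x = (2 * \<sigma> - 1) * of_nat m * el (He (m - 1)) x - \<i> * \<sigma> * of_real x * el (He m) x"
      by (simp add: algebra_simps)
    moreover have "el (He m) x = hm (2 * \<sigma> - 1) m (- \<i> * \<sigma> * of_real x) * g x"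
      "el (He (m - 1)) x = hm (2 * \<sigma> - 1) (m - 1) (- \<i> * \<sigma> * of_real x) * g x"
      using less Suc by simp_all
    ultimately show ?thesis by (simp add: Suc algebra_simps del: He.simps)
  qed (simp add: el_1)
qed

lemma psiz_closed: "psiz \<psi>0 z x t = pz z x"
proof -
  have sf: "complex_of_real (1 / sqrt (fact n)) * of_real (1 / sqrt (fact n)) = 1 / fact n" for n
  proof -
    have "1 / sqrt (fact n) * (1 / sqrt (fact n)) = 1 / fact n" by simp
    then have "complex_of_real (1 / sqrt (fact n) * (1 / sqrt (fact n))) = of_real (1 / fact n)" by (rule arg_cong)
    then show ?thesis unfolding of_real_mult by simp
  qed
  have "of_real (1 / sqrt (fact n)) * z ^ n * psin \<psi>0 n x t = hm (2 * \<sigma> - 1) n (- \<i> * \<sigma> * of_real x) * z ^ n / fact n * g x" for n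
  proof -
    have "of_real (1 / sqrt (fact n)) * z ^ n * psin \<psi>0 n x t = (of_real (1 / sqrt (fact n)) * of_real (1 / sqrt (fact n))) * (z ^ n * el (He n) x)"
      unfolding psin_el by (simp only: mult_ac)
    then show ?thesis unfolding sf el_He by simp
  qed
  then have "(\<Sum>n. of_real (1 / sqrt (fact n)) * z ^ n * psin \<psi>0 n x t) = exp ((- \<i> * \<sigma> * of_real x) * z + (2 * \<sigma> - 1) * z\<^sup>2 / 2) * g x"
    using sums_unique[OF sums_mult2[OF hm_sums[of "2 * \<sigma> - 1" "- \<i> * \<sigma> * of_real x" z], of "g x"]] by simp
  moreover have "exp (- complex_of_real ((cmod z)\<^sup>2 / 2)) = of_real (exp (- (cmod z)\<^sup>2 / 2))"
    unfolding of_real_minus[symmetric] exp_of_real by simp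
  ultimately show ?thesis unfolding psiz_def pz_g by simp
qed

lemma pz_deriv: "(pz z has_vector_derivative pp z x * pz z x) (at x)"
  unfolding pz_def[abs_def]
  by (rule has_vector_derivative_real_field) (auto intro!: derivative_eq_intros simp: pp_def algebra_simps)

lemma pp_deriv: "(pp z has_vector_derivative - \<sigma> / 2) (at x)"
  unfolding pp_def[abs_def]
  by (rule has_vector_derivative_real_field) (auto intro!: derivative_eq_intros)

lemma pz_gdec: "gdec (pz z)"
proof -
  have "pz z = (\<lambda>x. (of_real (exp (- (cmod z)\<^sup>2 / 2)) * C * exp ((2 * \<sigma> - 1) * z\<^sup>2 / 2)) *
      exp (of_real x * (- \<i> * \<sigma> * z) - \<sigma> / 4 * of_real (x\<^sup>2)))"
  proof
    fix x
    have "exp (- \<i> * \<sigma> * of_real x * z + (2 * \<sigma> - 1) * z\<^sup>2 / 2 - \<sigma> * (of_real x)\<^sup>2 / 4)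
      = exp ((2 * \<sigma> - 1) * z\<^sup>2 / 2) * exp (of_real x * (- \<i> * \<sigma> * z) - \<sigma> / 4 * of_real (x\<^sup>2))"
      unfolding exp_add[symmetric] by (rule arg_cong[where f=exp]) (simp add: algebra_simps)
    then show "pz z x = (of_real (exp (- (cmod z)\<^sup>2 / 2)) * C * exp ((2 * \<sigma> - 1) * z\<^sup>2 / 2)) *
      exp (of_real x * (- \<i> * \<sigma> * z) - \<sigma> / 4 * of_real (x\<^sup>2))"
      by (simp only: pz_def mult_ac)
  qed
  moreover have "Re (\<sigma> / 4) > 0"
  proof -
    have "\<sigma> / 4 = 1 / (4 * s)" by (simp add: \<sigma>_def)
    then show ?thesis using Re_inv_s by (simp only:)
  qed
  ultimately show ?thesis by (simp only: gdec_cmult gdec_gauss)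
qed

lemma gdec_pp: assumes "gdec f" shows "gdec (\<lambda>x. pp z x * f x)"
proof -
  have "gdec (\<lambda>x. (- \<i> * \<sigma> * z) * f x - (\<sigma> / 2) * (of_real x * f x))"
    by (intro gdec_diff gdec_cmult gdec_x assms)
  then show ?thesis by (simp add: pp_def left_diff_distrib mult.assoc)
qed

text \<open>\<open>R1\<close> and \<open>R2\<close> are the factors in front of \<open>pz\<close> in
  the first two x-derivatives of phi_z. By w' = a^2 - w^2 and p' = -\<sigma>/2 they are polynomials
  in w and p, so multiplication by them preserves Gaussian decay.\<close>

definition R1 :: "complex \<Rightarrow> real \<Rightarrow> complex" where
  "R1 z x = (wt x)\<^sup>2 - of_real (a\<^sup>2) - \<sigma> / 2 + (- wt x + pp z x) * pp z x"

definition R2 :: "complex \<Rightarrow> real \<Rightarrow> complex" where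
  "R2 z x = 2 * wt x * (of_real (a\<^sup>2) - (wt x)\<^sup>2) + (of_real (a\<^sup>2) * (-1) + (wt x)\<^sup>2 - \<sigma> / 2) * pp z x
     + (- wt x + pp z x) * (- \<sigma> / 2) + R1 z x * pp z x"

lemma phiz_closed: "phiz a \<psi>0 z x t = (- wt x + pp z x) * pz z x"
  unfolding phiz_def Lop_def dx_def psiz_closed
  by (simp add: vector_derivative_at[OF pz_deriv] wt_def algebra_simps)

lemma phiz_deriv: "((\<lambda>x. phiz a \<psi>0 z x t) has_vector_derivative R1 z x * pz z x) (at x)"
proof -
  have "((\<lambda>x. (- wt x + pp z x) * pz z x) has_vector_derivative
     (- wt x + pp z x) * (pp z x * pz z x) + (- (of_real (a\<^sup>2) - (wt x)\<^sup>2) + (- \<sigma> / 2)) * pz z x) (at x)"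
    by (intro has_vector_derivative_mult has_vector_derivative_add has_vector_derivative_minus wt_deriv pp_deriv pz_deriv)
  then show ?thesis unfolding phiz_closed by (simp add: R1_def algebra_simps)
qed

lemma R1_deriv: "((\<lambda>x. R1 z x * pz z x) has_vector_derivative R2 z x * pz z x) (at x)"
proof -
  have "((\<lambda>x. (wt x * wt x - of_real (a\<^sup>2) - \<sigma> / 2 + (- wt x + pp z x) * pp z x) * pz z x) has_vector_derivative
     (wt x * wt x - of_real (a\<^sup>2) - \<sigma> / 2 + (- wt x + pp z x) * pp z x) * (pp z x * pz z x) +
     ((wt x * (of_real (a\<^sup>2) - (wt x)\<^sup>2) + (of_real (a\<^sup>2) - (wt x)\<^sup>2) * wt x - 0 - 0) +
      ((- wt x + pp z x) * (- \<sigma> / 2) + (- (of_real (a\<^sup>2) - (wt x)\<^sup>2) + (- \<sigma> / 2)) * pp z x)) * pz z x) (at x)"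
    by (intro has_vector_derivative_mult has_vector_derivative_add has_vector_derivative_diff has_vector_derivative_const
        has_vector_derivative_minus wt_deriv pp_deriv pz_deriv)
  then show ?thesis unfolding R2_def R1_def by (simp add: power2_eq_square algebra_simps)
qed

lemma dx_phiz: "dx (phiz a \<psi>0 z) x t = R1 z x * pz z x"
  unfolding dx_def by (rule vector_derivative_at[OF phiz_deriv])

lemma dx_dx_phiz: "dx (dx (phiz a \<psi>0 z)) x t = R2 z x * pz z x"
  unfolding dx_def[of "dx _"] dx_phiz by (rule vector_derivative_at[OF R1_deriv])

lemma phiz_gdec: "gdec (slice (phiz a \<psi>0 z) t)"
  unfolding slice_def phiz_closed distrib_right mult_minus_left
  by (intro gdec_add gdec_uminus gdec_wt gdec_pp pz_gdec)

lemma phiz_in_dom: "in_dom_h1 (slice (phiz a \<psi>0 z) t)"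
proof -
  have d1: "d1 (slice (phiz a \<psi>0 z) t) = (\<lambda>x. R1 z x * pz z x)"
    using dx_phiz by (simp add: dx_def d1_def slice_def fun_eq_iff)
  have d2: "d1 (\<lambda>x. R1 z x * pz z x) = (\<lambda>x. R2 z x * pz z x)"
    unfolding d1_def by (rule ext, rule vector_derivative_at[OF R1_deriv])
  have g1: "gdec (\<lambda>x. R1 z x * f x)" if f: "gdec f" for f
  proof -
    have "gdec (\<lambda>x. wt x * (wt x * f x) - of_real (a\<^sup>2) * f x - \<sigma> / 2 * f x + (- (wt x * (pp z x * f x)) + pp z x * (pp z x * f x)))"
      by (intro gdec_add gdec_diff gdec_uminus gdec_wt gdec_pp gdec_cmult f)
    then show ?thesis by (simp add: R1_def power2_eq_square algebra_simps)
  qed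
  have "gdec (\<lambda>x. 2 * (wt x * (of_real (a\<^sup>2) * pz z x - wt x * (wt x * pz z x)))
     + (of_real (a\<^sup>2) * (-1) * (pp z x * pz z x) + wt x * (wt x * (pp z x * pz z x)) - \<sigma> / 2 * (pp z x * pz z x))
     + (- \<sigma> / 2) * (- (wt x * pz z x) + pp z x * pz z x) + R1 z x * (pp z x * pz z x))"
    by (intro gdec_add gdec_diff gdec_uminus gdec_wt gdec_pp gdec_cmult g1 pz_gdec)
  also have "(\<lambda>x. 2 * (wt x * (of_real (a\<^sup>2) * pz z x - wt x * (wt x * pz z x)))
     + (of_real (a\<^sup>2) * (-1) * (pp z x * pz z x) + wt x * (wt x * (pp z x * pz z x)) - \<sigma> / 2 * (pp z x * pz z x))
     + (- \<sigma> / 2) * (- (wt x * pz z x) + pp z x * pz z x) + R1 z x * (pp z x * pz z x)) = (\<lambda>x. R2 z x * pz z x)"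
    by (rule ext) (simp add: R2_def power2_eq_square algebra_simps)
  finally have "sq_int (\<lambda>x. R2 z x * pz z x)" by (rule gdec_sq_int)
  then show ?thesis unfolding in_dom_h1_def d1 d2
    using differentiableI_vector[OF phiz_deriv] differentiableI_vector[OF R1_deriv] gdec_sq_int[OF phiz_gdec]
    by (simp add: slice_def)
qed

subsection \<open>The coherent states lie in \<open>H\<^sub>1\<close>\<close>

text \<open>A consequence of the factorisation: the Cauchy condition of H_1 becomes an ordinary L^2
  estimate.\<close>

lemma norm1_L1: "f \<in> L1 a \<psi>0 t \<Longrightarrow> norm1 a \<psi>0 t f = sqrt (LINT x|lborel. (cmod (f x))\<^sup>2)"
  unfolding norm1_def by (simp add: ip1_L1 ip0_self)

lemma L1op_el_diff: "(\<lambda>x. L1op a (el P) x - L1op a (el Q) x) = L1op a (el (P - Q))"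
proof -
  have "el (pCons 0 (P - Q)) x = el (pCons 0 P) x - el (pCons 0 Q) x" for x
    using el_diff[of "pCons 0 P" "pCons 0 Q" x] by simp
  then show ?thesis by (intro ext) (simp only: L1op_el el_diff right_diff_distrib, simp)
qed

text \<open>\<open>el (Pz z N)\<close> is the N-th partial sum of the series for psi_z. The full
  1/n! combines a_n with the normalisation of psi_n.\<close>

definition Pz :: "complex \<Rightarrow> nat \<Rightarrow> complex poly" where
  "Pz z N = (\<Sum>n<N. smult (of_real (exp (- (cmod z)\<^sup>2 / 2)) * z ^ n / fact n) (He n))"

text \<open>Both the undifferentiated and the differentiated part are expressed by partial sums of
  one generating series, so that \<open>hm_sums\<close> gives the limit and
  \<open>hm_partial_bound\<close> the majorant.\<close>

lemma L1op_Pz: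
  "L1op a (el (Pz z N)) x = of_real (exp (- (cmod z)\<^sup>2 / 2)) * g x *
    ((- wt x - \<sigma> * of_real x / 2) * (\<Sum>n<N. hm (2 * \<sigma> - 1) n (- \<i> * \<sigma> * of_real x) * z ^ n / fact n)
     - \<i> * \<sigma> * z * (\<Sum>n<N - 1. hm (2 * \<sigma> - 1) n (- \<i> * \<sigma> * of_real x) * z ^ n / fact n))"
proof -
  let ?b = "2 * \<sigma> - 1" and ?y = "\<lambda>x. - \<i> * \<sigma> * of_real x" and ?c = "of_real (exp (- (cmod z)\<^sup>2 / 2)) :: complex"
  have d: "d1 (el (He n)) x = (- \<i> * \<sigma> * of_nat n * hm ?b (n - 1) (?y x) - \<sigma> * of_real x / 2 * hm ?b n (?y x)) * g x" for n x
  proof -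
    have "((\<lambda>v. hm ?b n (- \<i> * \<sigma> * v)) has_field_derivative (of_nat n * hm ?b (n - 1) (?y x)) * (- \<i> * \<sigma>)) (at (of_real x))"
      by (rule DERIV_chain2[OF hm_deriv]) (auto intro!: derivative_eq_intros)
    from has_vector_derivative_mult[OF has_vector_derivative_real_field[OF this] g_deriv]
    have "((\<lambda>x. hm ?b n (?y x) * g x) has_vector_derivative
      hm ?b n (?y x) * (- of_real x / (2 * s) * g x) + (of_nat n * hm ?b (n - 1) (?y x)) * (- \<i> * \<sigma>) * g x) (at x)" .
    moreover have "(\<lambda>x. hm ?b n (?y x) * g x) = el (He n)" by (simp add: el_He fun_eq_iff)
    ultimately show ?thesis unfolding d1_def by (simp add: vector_derivative_at \<sigma>_def algebra_simps)
  qed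
  have "L1op a (el (Pz z N)) x = (\<Sum>n<N. ?c * z ^ n / fact n * L1op a (el (He n)) x)"
  proof -
    have "L1op a (el P) x = - wt x * el P x + (- \<i> / 2) * el (pCons 0 P) x" for P by (simp add: L1op_el)
    moreover have "pCons 0 (p + q) = pCons 0 p + pCons 0 q" for p q :: "complex poly" by simp
    note pC = this
    moreover have "pCons 0 (Pz z N) = (\<Sum>n<N. smult (?c * z ^ n / fact n) (pCons 0 (He n)))"
      unfolding Pz_def by (induction N) (simp_all add: pC del: add_pCons)
    ultimately show ?thesis
      by (simp only: Pz_def el_sum el_smult sum_distrib_left sum.distrib[symmetric]) (simp add: algebra_simps)
  qed
  also have "\<dots> = (\<Sum>n<N. ?c * g x * ((- wt x - \<sigma> * of_real x / 2) * (hm ?b n (?y x) * z ^ n / fact n)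
      - \<i> * \<sigma> * (of_nat n * hm ?b (n - 1) (?y x) * z ^ n / fact n)))"
  proof (intro sum.cong refl)
    fix n
    have L: "L1op a (el (He n)) x = - wt x * (hm ?b n (?y x) * g x) +
        (- \<i> * \<sigma> * of_nat n * hm ?b (n - 1) (?y x) - \<sigma> * of_real x / 2 * hm ?b n (?y x)) * g x"
      unfolding d[symmetric] el_He[symmetric] by (simp add: L1op_def wt_def)
    show "?c * z ^ n / fact n * L1op a (el (He n)) x = ?c * g x * ((- wt x - \<sigma> * of_real x / 2) * (hm ?b n (?y x) * z ^ n / fact n)
      - \<i> * \<sigma> * (of_nat n * hm ?b (n - 1) (?y x) * z ^ n / fact n))"
      unfolding L by (simp add: algebra_simps add_divide_distrib diff_divide_distrib)
  qed
  also have "\<dots> = ?c * g x * ((- wt x - \<sigma> * of_real x / 2) * (\<Sum>n<N. hm ?b n (?y x) * z ^ n / fact n)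
      - \<i> * \<sigma> * (\<Sum>n<N. of_nat n * hm ?b (n - 1) (?y x) * z ^ n / fact n))"
    by (simp only: sum_distrib_left sum_subtractf right_diff_distrib)
  \<comment> \<open>The term n = 0 vanishes and n/n! becomes 1/(n-1)!, so the shifted sum has N - 1
    terms.\<close>
  also have "(\<Sum>n<N. of_nat n * hm ?b (n - 1) (?y x) * z ^ n / fact n) = z * (\<Sum>n<N - 1. hm ?b n (?y x) * z ^ n / fact n)"
  proof (cases N)
    case (Suc M)
    have "of_nat (Suc n) * hm ?b n (?y x) * z ^ Suc n / fact (Suc n) = z * (hm ?b n (?y x) * z ^ n / fact n)" for n
      by (simp del: of_nat_Suc)
    then show ?thesis unfolding Suc by (subst sum.lessThan_Suc_shift) (simp add: sum_distrib_left del: of_nat_Suc fact_Suc power_Suc)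
  qed simp
  finally show ?thesis by (simp only: mult.assoc)
qed

lemma Pz_tendsto: "(\<lambda>N. L1op a (el (Pz z N)) x) \<longlonglongrightarrow> slice (phiz a \<psi>0 z) t x"
proof -
  let ?S = "\<lambda>N. \<Sum>n<N. hm (2 * \<sigma> - 1) n (- \<i> * \<sigma> * of_real x) * z ^ n / fact n"
  let ?E = "exp ((- \<i> * \<sigma> * of_real x) * z + (2 * \<sigma> - 1) * z\<^sup>2 / 2)"
  have S: "?S \<longlonglongrightarrow> ?E" using hm_sums unfolding sums_def .
  have S': "(\<lambda>N. ?S (N - 1)) \<longlonglongrightarrow> ?E"
    by (rule LIMSEQ_offset[where k=1]) (simp only: add_diff_cancel_right' S)
  have "(\<lambda>N. L1op a (el (Pz z N)) x) \<longlonglongrightarrow> of_real (exp (- (cmod z)\<^sup>2 / 2)) * g x *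
    ((- wt x - \<sigma> * of_real x / 2) * ?E - \<i> * \<sigma> * z * ?E)"
    unfolding L1op_Pz by (intro tendsto_intros S S')
  also have "of_real (exp (- (cmod z)\<^sup>2 / 2)) * g x * ((- wt x - \<sigma> * of_real x / 2) * ?E - \<i> * \<sigma> * z * ?E)
    = slice (phiz a \<psi>0 z) t x"
    unfolding slice_def phiz_closed pz_g pp_def by (simp add: algebra_simps)
  finally show ?thesis .
qed

text \<open>By \<open>hm_partial_bound\<close> the partial sums grow at most like an exponential of
  |x|, uniformly in N, which the Gaussian \<open>g\<close> absorbs.\<close>

lemma Pz_dominated: "\<exists>h. gdec h \<and> (\<forall>N x. cmod (L1op a (el (Pz z N)) x) \<le> cmod (h x))"
proof -
  define E where "E x = exp (norm (- \<i> * \<sigma> * of_real x) * norm z + norm (2 * \<sigma> - 1) * (norm z)\<^sup>2 / 2)" for x :: real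
  define k where "k x = a + cmod \<sigma> * \<bar>x\<bar> / 2 + cmod \<sigma> * cmod z" for x
  define c where "c = exp (- (cmod z)\<^sup>2 / 2)"
  have S: "cmod (\<Sum>n<N. hm (2 * \<sigma> - 1) n (- \<i> * \<sigma> * of_real x) * z ^ n / fact n) \<le> E x" for N x
    using order_trans[OF norm_sum hm_partial_bound] unfolding E_def .
  have E0: "E x \<ge> 0" for x unfolding E_def by simp
  have k0: "k x \<ge> 0" for x using a_pos by (simp add: k_def)
  have le: "cmod (L1op a (el (Pz z N)) x) \<le> cmod (of_real (k x * c * E x) * g x)" for N x
  proof -
    let ?S = "\<lambda>N. \<Sum>n<N. hm (2 * \<sigma> - 1) n (- \<i> * \<sigma> * of_real x) * z ^ n / fact n"
    have "cmod ((- wt x - \<sigma> * of_real x / 2) * ?S N - \<i> * \<sigma> * z * ?S (N - 1))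
      \<le> cmod ((- wt x - \<sigma> * of_real x / 2) * ?S N) + cmod (\<i> * \<sigma> * z * ?S (N - 1))" by (rule norm_triangle_ineq4)
    also have "\<dots> \<le> (a + cmod \<sigma> * \<bar>x\<bar> / 2) * E x + cmod \<sigma> * cmod z * E x"
    proof (rule add_mono)
      have "cmod (- wt x - \<sigma> * of_real x / 2) \<le> cmod (- wt x) + cmod (\<sigma> * of_real x / 2)" by (rule norm_triangle_ineq4)
      also have "\<dots> \<le> a + cmod \<sigma> * \<bar>x\<bar> / 2" using wt_bdd[of x] by (simp add: norm_mult norm_divide)
      finally show "cmod ((- wt x - \<sigma> * of_real x / 2) * ?S N) \<le> (a + cmod \<sigma> * \<bar>x\<bar> / 2) * E x"
        unfolding norm_mult using a_pos by (intro mult_mono S) auto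
      show "cmod (\<i> * \<sigma> * z * ?S (N - 1)) \<le> cmod \<sigma> * cmod z * E x"
        unfolding norm_mult[of "\<i> * \<sigma> * z"] using S[of x "N - 1"]
        by (intro mult_mono) (auto simp: norm_mult)
    qed
    also have "\<dots> = k x * E x" by (simp add: k_def algebra_simps)
    finally have "c * cmod (g x) * cmod ((- wt x - \<sigma> * of_real x / 2) * ?S N - \<i> * \<sigma> * z * ?S (N - 1)) \<le> c * cmod (g x) * (k x * E x)"
      by (intro mult_left_mono) (auto simp: c_def)
    moreover have "cmod (L1op a (el (Pz z N)) x) = c * cmod (g x) * cmod ((- wt x - \<sigma> * of_real x / 2) * ?S N - \<i> * \<sigma> * z * ?S (N - 1))"
      unfolding L1op_Pz norm_mult[of "_ * g x"] norm_mult[of _ "g x"] by (simp add: c_def)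
    moreover have "cmod (of_real (k x * c * E x) * g x) = c * cmod (g x) * (k x * E x)"
      unfolding norm_mult norm_of_real using E0[of x] k0[of x] by (simp add: c_def abs_mult)
    ultimately show ?thesis by simp
  qed
  have kE: "k x \<le> (a + cmod \<sigma> / 2 + cmod \<sigma> * cmod z) * exp (1 * \<bar>x\<bar>)" for x
  proof -
    have 1: "1 \<le> exp \<bar>x\<bar>" "\<bar>x\<bar> \<le> exp \<bar>x\<bar>" using exp_ge_add_one_self[of "\<bar>x\<bar>"] by (auto simp del: exp_ge_add_one_self)
    have "k x = a * 1 + cmod \<sigma> / 2 * \<bar>x\<bar> + cmod \<sigma> * cmod z * 1" by (simp add: k_def)
    also have "\<dots> \<le> a * exp \<bar>x\<bar> + cmod \<sigma> / 2 * exp \<bar>x\<bar> + cmod \<sigma> * cmod z * exp \<bar>x\<bar>"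
      using 1 a_pos by (intro add_mono mult_left_mono) auto
    finally show ?thesis by (simp add: algebra_simps)
  qed
  have "gdec (\<lambda>x. of_real (E x) * g x)"
  proof (rule gdec_mult_exp[OF g_gdec, where b="cmod \<sigma> * cmod z" and K="exp (norm (2 * \<sigma> - 1) * (norm z)\<^sup>2 / 2)"])
    show "continuous_on UNIV (\<lambda>x. complex_of_real (E x))" unfolding E_def by (auto intro!: continuous_intros)
    show "cmod (of_real (E x)) \<le> exp (norm (2 * \<sigma> - 1) * (norm z)\<^sup>2 / 2) * exp (cmod \<sigma> * cmod z * \<bar>x\<bar>)" for x
      by (simp add: E_def norm_mult exp_add[symmetric] algebra_simps)
  qed
  then have "gdec (\<lambda>x. of_real (k x * c) * (of_real (E x) * g x))"
  proof (rule gdec_mult_exp[where b=1 and K="(a + cmod \<sigma> / 2 + cmod \<sigma> * cmod z) * c"])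
    show "continuous_on UNIV (\<lambda>x. complex_of_real (k x * c))" unfolding k_def by (auto intro!: continuous_intros)
    show "cmod (of_real (k x * c)) \<le> (a + cmod \<sigma> / 2 + cmod \<sigma> * cmod z) * c * exp (1 * \<bar>x\<bar>)" for x
    proof -
      have "k x * c \<le> (a + cmod \<sigma> / 2 + cmod \<sigma> * cmod z) * exp (1 * \<bar>x\<bar>) * c"
        by (rule mult_right_mono[OF kE]) (simp add: c_def)
      moreover have "cmod (complex_of_real (k x * c)) = k x * c"
        unfolding norm_of_real using k0[of x] by (simp add: c_def abs_mult)
      ultimately show ?thesis by (simp only: mult_ac)
    qed
  qed
  then have "gdec (\<lambda>x. of_real (k x * c * E x) * g x)" by (simp add: mult.assoc)
  with le show ?thesis by blast
qed

lemma Pz_l2conv: "l2conv (\<lambda>N. L1op a (el (Pz z N))) (slice (phiz a \<psi>0 z) t)"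
proof -
  let ?\<phi> = "slice (phiz a \<psi>0 z) t"
  obtain h where h: "gdec h" "\<And>N x. cmod (L1op a (el (Pz z N)) x) \<le> cmod (h x)" using Pz_dominated by blast
  have \<phi>h: "cmod (?\<phi> x) \<le> cmod (h x)" for x
    by (rule tendsto_upperbound[OF tendsto_norm[OF Pz_tendsto]]) (auto simp: h(2))
  have "(\<lambda>N. LINT x|lborel. (cmod (L1op a (el (Pz z N)) x - ?\<phi> x))\<^sup>2) \<longlonglongrightarrow> (LINT x|(lborel :: real measure). (0 :: real))"
  proof (rule integral_dominated_convergence[where w="\<lambda>x. 4 * (cmod (h x))\<^sup>2"])
    show "(\<lambda>x. (cmod (L1op a (el (Pz z N)) x - ?\<phi> x))\<^sup>2) \<in> borel_measurable lborel" for N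
      using gdec_integrable_sq[OF gdec_diff[OF L1op_el_gdec phiz_gdec]] by blast
    show "integrable lborel (\<lambda>x. 4 * (cmod (h x))\<^sup>2)" using gdec_integrable_sq[OF h(1)] by simp
    show "AE x in lborel. (\<lambda>N. (cmod (L1op a (el (Pz z N)) x - ?\<phi> x))\<^sup>2) \<longlonglongrightarrow> 0"
    proof (intro AE_I2)
      fix x
      have "(\<lambda>N. (cmod (L1op a (el (Pz z N)) x - ?\<phi> x))\<^sup>2) \<longlonglongrightarrow> (cmod (?\<phi> x - ?\<phi> x))\<^sup>2"
        by (intro tendsto_intros Pz_tendsto)
      then show "(\<lambda>N. (cmod (L1op a (el (Pz z N)) x - ?\<phi> x))\<^sup>2) \<longlonglongrightarrow> 0" by simp
    qed
    show "AE x in lborel. norm ((cmod (L1op a (el (Pz z N)) x - ?\<phi> x))\<^sup>2) \<le> 4 * (cmod (h x))\<^sup>2" for N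
    proof (intro AE_I2)
      fix x
      have "cmod (L1op a (el (Pz z N)) x - ?\<phi> x) \<le> 2 * cmod (h x)"
        using norm_triangle_ineq4[of "L1op a (el (Pz z N)) x" "?\<phi> x"] h(2)[of N x] \<phi>h[of x] by linarith
      then have "(cmod (L1op a (el (Pz z N)) x - ?\<phi> x))\<^sup>2 \<le> (2 * cmod (h x))\<^sup>2" by (rule power_mono) simp
      then show "norm ((cmod (L1op a (el (Pz z N)) x - ?\<phi> x))\<^sup>2) \<le> 4 * (cmod (h x))\<^sup>2" by (simp add: power_mult_distrib)
    qed
  qed simp
  then show ?thesis unfolding l2conv_def by simp
qed

lemma phiz_in_H1: "in_H1 a \<psi>0 t (slice (phiz a \<psi>0 z) t)"
proof -
  let ?\<phi> = "slice (phiz a \<psi>0 z) t" and ?F = "\<lambda>N. L1op a (el (Pz z N))"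
  let ?B = "\<lambda>N. LINT x|lborel. (cmod (?F N x - ?\<phi> x))\<^sup>2"
  have B: "?B \<longlonglongrightarrow> 0" using Pz_l2conv unfolding l2conv_def .
  have "\<exists>N. \<forall>m\<ge>N. \<forall>n\<ge>N. norm1 a \<psi>0 t (\<lambda>x. ?F m x - ?F n x) < e" if e: "e > 0" for e
  proof -
    have "eventually (\<lambda>N. ?B N < e\<^sup>2 / 4) sequentially"
      using e by (intro order_tendstoD(2)[OF B]) auto
    then obtain N where N: "\<And>n. n \<ge> N \<Longrightarrow> ?B n < e\<^sup>2 / 4" unfolding eventually_sequentially by blast
    have "norm1 a \<psi>0 t (\<lambda>x. ?F m x - ?F n x) < e" if mn: "m \<ge> N" "n \<ge> N" for m n
    proof -
      have i: "integrable lborel (\<lambda>x. (cmod (?F k x - ?\<phi> x))\<^sup>2)" for k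
        by (intro gdec_integrable_sq gdec_diff L1op_el_gdec phiz_gdec)
      have "(LINT x|lborel. (cmod (?F m x - ?F n x))\<^sup>2) \<le> (LINT x|lborel. 2 * (cmod (?F m x - ?\<phi> x))\<^sup>2 + 2 * (cmod (?F n x - ?\<phi> x))\<^sup>2)"
      proof (rule integral_mono)
        show "integrable lborel (\<lambda>x. (cmod (?F m x - ?F n x))\<^sup>2)"
          by (intro gdec_integrable_sq gdec_diff L1op_el_gdec)
        show "integrable lborel (\<lambda>x. 2 * (cmod (?F m x - ?\<phi> x))\<^sup>2 + 2 * (cmod (?F n x - ?\<phi> x))\<^sup>2)"
          using i by simp
        fix x
        have "cmod (?F m x - ?F n x) \<le> cmod (?F m x - ?\<phi> x) + cmod (?F n x - ?\<phi> x)"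
          using norm_triangle_ineq4[of "?F m x - ?\<phi> x" "?F n x - ?\<phi> x"] by simp
        then have "(cmod (?F m x - ?F n x))\<^sup>2 \<le> (cmod (?F m x - ?\<phi> x) + cmod (?F n x - ?\<phi> x))\<^sup>2"
          by (rule power_mono) simp
        also have "\<dots> \<le> 2 * (cmod (?F m x - ?\<phi> x))\<^sup>2 + 2 * (cmod (?F n x - ?\<phi> x))\<^sup>2"
          using zero_le_power2[of "cmod (?F m x - ?\<phi> x) - cmod (?F n x - ?\<phi> x)"]
          by (simp add: power2_eq_square algebra_simps)
        finally show "(cmod (?F m x - ?F n x))\<^sup>2 \<le> 2 * (cmod (?F m x - ?\<phi> x))\<^sup>2 + 2 * (cmod (?F n x - ?\<phi> x))\<^sup>2" .
      qed
      also have "\<dots> = 2 * ?B m + 2 * ?B n" using i by simp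
      also have "\<dots> < e\<^sup>2" using N[OF mn(1)] N[OF mn(2)] by linarith
      finally have "sqrt (LINT x|lborel. (cmod (?F m x - ?F n x))\<^sup>2) < sqrt (e\<^sup>2)" by (rule real_sqrt_less_mono)
      moreover have "(\<lambda>x. ?F m x - ?F n x) \<in> L1 a \<psi>0 t" unfolding L1op_el_diff L1_eq by blast
      ultimately show ?thesis using e by (simp add: norm1_L1)
    qed
    then show ?thesis by blast
  qed
  moreover have "?F N \<in> L1 a \<psi>0 t" for N unfolding L1_eq by blast
  ultimately show ?thesis unfolding in_H1_def using Pz_l2conv
    by (intro exI[of _ ?F] conjI allI impI)
qed

end

subsection \<open>The time evolution\<close>

text \<open>Apart from the amplitude \<open>C(t)\<close>, the time enters \<open>\<phi>\<^sub>z\<close> only through \<open>v = 1/(1 + i t)\<close>;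
  \<open>tf'\<close> is the derivative of \<open>tf\<close> in \<open>v\<close>.\<close>
definition tf :: "real \<Rightarrow> complex \<Rightarrow> real \<Rightarrow> complex \<Rightarrow> complex" where
  "tf a z x v = (- of_real (a * tanh (a * x)) + (- \<i> * v * z - v * of_real x / 2)) *
     exp (- \<i> * v * of_real x * z + (2 * v - 1) * z\<^sup>2 / 2 - v * (of_real x)\<^sup>2 / 4)"

definition tf' :: "real \<Rightarrow> complex \<Rightarrow> real \<Rightarrow> complex \<Rightarrow> complex" where
  "tf' a z x v = ((- \<i> * z - of_real x / 2) + (- of_real (a * tanh (a * x)) + (- \<i> * v * z - v * of_real x / 2)) *
       (- \<i> * of_real x * z + z\<^sup>2 - (of_real x)\<^sup>2 / 4)) *
     exp (- \<i> * v * of_real x * z + (2 * v - 1) * z\<^sup>2 / 2 - v * (of_real x)\<^sup>2 / 4)"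

lemma tf_deriv: "(tf a z x has_field_derivative tf' a z x v) (at v)"
proof -
  define E where "E v = exp (- \<i> * v * of_real x * z + (2 * v - 1) * z\<^sup>2 / 2 - v * (of_real x)\<^sup>2 / 4)" for v
  have dE: "(E has_field_derivative (- \<i> * of_real x * z + z\<^sup>2 - (of_real x)\<^sup>2 / 4) * E v) (at v)"
    unfolding E_def by (auto intro!: derivative_eq_intros)
  show ?thesis
    unfolding tf_def[abs_def] tf'_def E_def[symmetric]
    by (auto intro!: derivative_eq_intros dE simp: field_simps)
qed

lemma inv_s_deriv: "((\<lambda>t. 1 / Complex 1 t) has_vector_derivative - \<i> * (1 / Complex 1 t)\<^sup>2) (at t)"
proof -
  have nz: "1 + \<i> * of_real t \<noteq> 0" by (simp add: complex_eq_iff)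
  have "((\<lambda>v. 1 / (1 + \<i> * v)) has_field_derivative - \<i> * (1 / (1 + \<i> * of_real t))\<^sup>2) (at (of_real t))"
    using nz by (auto intro!: derivative_eq_intros simp: power2_eq_square)
  from has_vector_derivative_real_field[OF this]
  have "((\<lambda>t. 1 / (1 + \<i> * of_real t)) has_vector_derivative - \<i> * (1 / (1 + \<i> * of_real t))\<^sup>2) (at t)" .
  then show ?thesis by (simp add: Complex_eq)
qed

context gaussian_vacuum
begin

lemma phiz_tf: "phiz a \<psi>0 z x t = of_real (exp (- (cmod z)\<^sup>2 / 2)) * (C * tf a z x (1 / s))"
  unfolding phiz_closed pz_def pp_def wt_def tf_def \<sigma>_def[symmetric] by (simp only: mult_ac)

lemma sech_wt: "of_real (2 * a\<^sup>2 / (cosh (a * x))\<^sup>2) = 2 * (of_real (a\<^sup>2) - (wt x)\<^sup>2)"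
proof -
  have "2 * a\<^sup>2 / (cosh (a * x))\<^sup>2 = 2 * (a\<^sup>2 - (a * tanh (a * x))\<^sup>2)"
  proof -
    have "a\<^sup>2 - (a * tanh (a * x))\<^sup>2 = a\<^sup>2 * ((cosh (a * x))\<^sup>2 - (sinh (a * x))\<^sup>2) / (cosh (a * x))\<^sup>2"
      by (simp add: tanh_def power_mult_distrib power_divide field_simps)
    then show ?thesis unfolding hyperbolic_pythagoras by simp
  qed
  then show ?thesis unfolding wt_def by (simp only: of_real_mult of_real_diff of_real_power of_real_numeral)
qed

text \<open>With v = 1/s the right-hand side is i times the time derivative of the state, written
  out by the chain rule with i C' = (v/2) C and i v' = v^2. No time derivative has to be taken
  inside the fixed-time locale.\<close>

lemma phiz_hamiltonian:
  "- dx (dx (phiz a \<psi>0 z)) x t - of_real (2 * a\<^sup>2 / (cosh (a * x))\<^sup>2) * phiz a \<psi>0 z x t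
   = of_real (exp (- (cmod z)\<^sup>2 / 2)) * (C * ((1 / s) / 2) * tf a z x (1 / s) + C * (1 / s)\<^sup>2 * tf' a z x (1 / s))"
proof -
  define E where "E = exp (- \<i> * \<sigma> * of_real x * z + (2 * \<sigma> - 1) * z\<^sup>2 / 2 - \<sigma> * (of_real x)\<^sup>2 / 4)"
  define p w A where "p = pp z x" and "w = wt x" and "A = complex_of_real (a\<^sup>2)"
  have k1: "\<sigma>\<^sup>2 * (- \<i> * z - of_real x / 2) = \<sigma> * p"
    by (simp add: p_def pp_def power2_eq_square algebra_simps)
  have k2: "\<sigma>\<^sup>2 * (- \<i> * of_real x * z + z\<^sup>2 - (of_real x)\<^sup>2 / 4) = - p\<^sup>2"
    by (simp add: p_def pp_def power2_eq_square field_simps)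
  have T: "tf a z x (1 / s) = (- w + p) * E"
    unfolding tf_def \<sigma>_def[symmetric] E_def p_def pp_def w_def wt_def ..
  have T': "tf' a z x (1 / s) = ((- \<i> * z - of_real x / 2) + (- w + p) * (- \<i> * of_real x * z + z\<^sup>2 - (of_real x)\<^sup>2 / 4)) * E"
    unfolding tf'_def \<sigma>_def[symmetric] E_def p_def pp_def w_def wt_def ..
  have "(1 / s)\<^sup>2 * tf' a z x (1 / s) = (\<sigma>\<^sup>2 * (- \<i> * z - of_real x / 2) +
      (- w + p) * (\<sigma>\<^sup>2 * (- \<i> * of_real x * z + z\<^sup>2 - (of_real x)\<^sup>2 / 4))) * E"
    unfolding T' unfolding \<sigma>_def[symmetric] by (simp only: distrib_left mult_ac)
  then have T2: "(1 / s)\<^sup>2 * tf' a z x (1 / s) = (\<sigma> * p - (- w + p) * p\<^sup>2) * E"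
    unfolding k1 k2 by simp
  \<comment> \<open>The intertwining relation h_1 L = -L d^2/dx^2 evaluated on \<open>pz\<close>,
    whose second derivative is (p^2 - \<sigma>/2) \<open>pz\<close>.\<close>
  have R: "- R2 z x - 2 * (A - w\<^sup>2) * (- w + p) = \<sigma> / 2 * (- w + p) + (\<sigma> * p - (- w + p) * p\<^sup>2)"
    unfolding R2_def R1_def p_def[symmetric] w_def[symmetric] A_def[symmetric]
    by (simp add: power2_eq_square field_simps)
  have pz: "pz z x = of_real (exp (- (cmod z)\<^sup>2 / 2)) * (C * E)" unfolding pz_def E_def ..
  have "- dx (dx (phiz a \<psi>0 z)) x t - of_real (2 * a\<^sup>2 / (cosh (a * x))\<^sup>2) * phiz a \<psi>0 z x t
    = (- R2 z x - 2 * (A - w\<^sup>2) * (- w + p)) * pz z x"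
    unfolding dx_dx_phiz sech_wt phiz_closed A_def p_def w_def by (simp add: algebra_simps)
  also have "\<dots> = of_real (exp (- (cmod z)\<^sup>2 / 2)) * (C * (\<sigma> / 2) * ((- w + p) * E) + C * ((\<sigma> * p - (- w + p) * p\<^sup>2) * E))"
    unfolding R pz by (simp only: distrib_left distrib_right mult_ac)
  also have "\<dots> = of_real (exp (- (cmod z)\<^sup>2 / 2)) * (C * ((1 / s) / 2) * tf a z x (1 / s) + C * (1 / s)\<^sup>2 * tf' a z x (1 / s))"
    unfolding mult.assoc[of C "(1 / s)\<^sup>2"] T2 T by (simp only: \<sigma>_def)
  finally show ?thesis .
qed

lemma phiz_dx_differentiable:
  "(\<lambda>x. phiz a \<psi>0 z x t) differentiable (at x)" "(\<lambda>x. dx (phiz a \<psi>0 z) x t) differentiable (at x)"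
  using differentiableI_vector[OF phiz_deriv] differentiableI_vector[OF R1_deriv] by (simp_all add: dx_phiz)

end

section \<open>The vacuum: its profile from A psi_0 = 0, its amplitude from the Schroedinger
  equation\<close>

lemma vacuum_deriv:
  assumes psi0_diff: "\<forall>x t. (\<lambda>s. \<psi>0 s t) differentiable (at x) \<and>
                          (\<lambda>s. dx \<psi>0 s t) differentiable (at x) \<and>
                          (\<lambda>s. \<psi>0 x s) differentiable (at t)"
    and psi0_vacuum: "\<forall>x t. Aop \<psi>0 x t = 0"
  shows "dx \<psi>0 x t = - of_real x / (2 * Complex 1 t) * \<psi>0 x t"
    and "((\<lambda>x. \<psi>0 x t) has_vector_derivative - of_real x / (2 * Complex 1 t) * \<psi>0 x t) (at x)"
proof -
  have nz: "Complex 1 t \<noteq> 0" by (simp add: complex_eq_iff)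
  have "\<i> - of_real t = \<i> * Complex 1 t" by (simp add: complex_eq_iff)
  then have "\<i> * Complex 1 t * dx \<psi>0 x t + \<i> * of_real (x / 2) * \<psi>0 x t = 0"
    using psi0_vacuum unfolding Aop_def by metis
  then have "\<i> * (Complex 1 t * dx \<psi>0 x t + of_real (x / 2) * \<psi>0 x t) = 0" by (simp only: distrib_left mult.assoc)
  then have "Complex 1 t * dx \<psi>0 x t = - of_real x / 2 * \<psi>0 x t" by (simp add: eq_neg_iff_add_eq_0)
  then show dx: "dx \<psi>0 x t = - of_real x / (2 * Complex 1 t) * \<psi>0 x t" using nz by (simp add: field_simps)
  show "((\<lambda>x. \<psi>0 x t) has_vector_derivative - of_real x / (2 * Complex 1 t) * \<psi>0 x t) (at x)"
    using psi0_diff unfolding dx[symmetric] dx_def by (simp add: vector_derivative_works)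
qed

text \<open>The inverse Gaussian is an integrating factor for A psi_0 = 0: the product with psi_0
  has derivative 0 in x.\<close>

lemma vacuum_gaussian:
  assumes psi0_diff: "\<forall>x t. (\<lambda>s. \<psi>0 s t) differentiable (at x) \<and>
                          (\<lambda>s. dx \<psi>0 s t) differentiable (at x) \<and>
                          (\<lambda>s. \<psi>0 x s) differentiable (at t)"
    and psi0_vacuum: "\<forall>x t. Aop \<psi>0 x t = 0"
  shows "\<psi>0 x t = \<psi>0 0 t * exp (- of_real (x\<^sup>2) / (4 * Complex 1 t))"
proof -
  have nz: "Complex 1 t \<noteq> 0" by (simp add: complex_eq_iff)
  let ?e = "\<lambda>x. exp ((of_real x)\<^sup>2 / (4 * Complex 1 t))"
  have de: "(?e has_vector_derivative of_real x / (2 * Complex 1 t) * ?e x) (at x)" for x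
    by (rule has_vector_derivative_real_field) (use nz in \<open>auto intro!: derivative_eq_intros simp: field_simps\<close>)
  have "((\<lambda>x. \<psi>0 x t * ?e x) has_vector_derivative 0) (at x)" for x
    using has_vector_derivative_mult[OF vacuum_deriv(2)[OF assms, of t x] de[of x]] by (simp add: mult.left_commute)
  then obtain c where c: "\<And>x. \<psi>0 x t * ?e x = c"
    using has_vector_derivative_zero_constant[of UNIV "\<lambda>x. \<psi>0 x t * ?e x"] by auto
  have "\<psi>0 x t * ?e x = \<psi>0 0 t" using c[of x] c[of 0] by simp
  then show ?thesis by (simp add: exp_minus field_simps)
qed

text \<open>At x = 0 the second x-derivative of the Gaussian is -1/(2s) times the amplitude, so the
  Schroedinger equation there is an ordinary differential equation for C(t).\<close>

lemma vacuum_amplitude_deriv: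
  assumes psi0_diff: "\<forall>x t. (\<lambda>s. \<psi>0 s t) differentiable (at x) \<and>
                          (\<lambda>s. dx \<psi>0 s t) differentiable (at x) \<and>
                          (\<lambda>s. \<psi>0 x s) differentiable (at t)"
    and psi0_vacuum: "\<forall>x t. Aop \<psi>0 x t = 0"
    and psi0_schroedinger: "\<forall>x t. \<i> * dt \<psi>0 x t = - dx (dx \<psi>0) x t"
  shows "((\<lambda>t. \<psi>0 0 t) has_vector_derivative - \<i> * ((1 / Complex 1 t) / 2) * \<psi>0 0 t) (at t)"
proof -
  have nz: "Complex 1 t \<noteq> 0" by (simp add: complex_eq_iff)
  have lin: "((\<lambda>x. - of_real x / (2 * Complex 1 t)) has_vector_derivative - 1 / (2 * Complex 1 t)) (at 0)"
    by (rule has_vector_derivative_real_field) (use nz in \<open>auto intro!: derivative_eq_intros\<close>)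
  have "((\<lambda>x. dx \<psi>0 x t) has_vector_derivative - 1 / (2 * Complex 1 t) * \<psi>0 0 t) (at 0)"
    unfolding vacuum_deriv(1)[OF assms(1,2)]
    using has_vector_derivative_mult[OF lin vacuum_deriv(2)[OF assms(1,2), of t 0]] by simp
  then have "dx (dx \<psi>0) 0 t = - 1 / (2 * Complex 1 t) * \<psi>0 0 t"
    unfolding dx_def[of "dx \<psi>0"] by (rule vector_derivative_at)
  then have "\<i> * dt \<psi>0 0 t = 1 / (2 * Complex 1 t) * \<psi>0 0 t" using psi0_schroedinger by simp
  then have "(- \<i>) * (\<i> * dt \<psi>0 0 t) = (- \<i>) * (1 / (2 * Complex 1 t) * \<psi>0 0 t)" by (rule arg_cong)
  then have "dt \<psi>0 0 t = - \<i> * ((1 / Complex 1 t) / 2) * \<psi>0 0 t" by simp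
  moreover have "((\<lambda>t. \<psi>0 0 t) has_vector_derivative dt \<psi>0 0 t) (at t)"
    using psi0_diff unfolding dt_def by (simp add: vector_derivative_works)
  ultimately show ?thesis by simp
qed

theorem theorem3:
  fixes a :: real and \<psi>0 :: "real \<Rightarrow> real \<Rightarrow> complex"
  assumes a_pos: "a > 0"
    and psi0_diff: "\<forall>x t. (\<lambda>s. \<psi>0 s t) differentiable (at x) \<and>
                          (\<lambda>s. dx \<psi>0 s t) differentiable (at x) \<and>
                          (\<lambda>s. \<psi>0 x s) differentiable (at t)"
    and psi0_schroedinger: "\<forall>x t. \<i> * dt \<psi>0 x t = - dx (dx \<psi>0) x t"
    and psi0_vacuum: "\<forall>x t. Aop \<psi>0 x t = 0"
    and psi0_normalized: "\<forall>t. sq_int (slice \<psi>0 t) \<and> ip0 (slice \<psi>0 t) (slice \<psi>0 t) = 1"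
  shows
    "(\<forall>z t. in_H1 a \<psi>0 t (slice (phiz a \<psi>0 z) t) \<and> in_dom_h1 (slice (phiz a \<psi>0 z) t))
   \<and> (\<forall>z x t. (\<lambda>s. phiz a \<psi>0 z s t) differentiable (at x) \<and>
              (\<lambda>s. dx (phiz a \<psi>0 z) s t) differentiable (at x) \<and>
              (\<lambda>s. phiz a \<psi>0 z x s) differentiable (at t) \<and>
              \<i> * dt (phiz a \<psi>0 z) x t
                = - dx (dx (phiz a \<psi>0 z)) x t
                  - of_real (2 * a\<^sup>2 / (cosh (a * x))\<^sup>2) * phiz a \<psi>0 z x t)
   \<and> (\<forall>t. \<forall>f\<in>L1 a \<psi>0 t. \<forall>g\<in>L1 a \<psi>0 t.
        mu_int a (\<lambda>z. cnj (braphi a \<psi>0 t z f) * braphi a \<psi>0 t z g) = ip1 a \<psi>0 t f g)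
   \<and> (\<forall>t n k. of_real (1 / sqrt (fact n) * (1 / sqrt (fact k))) *
        mu_int a (\<lambda>z. of_real ((cmod (exp (- of_real ((cmod z)\<^sup>2 / 2))))\<^sup>2) * z ^ n * cnj z ^ k)
        = Sinv a \<psi>0 t n k)"
proof -
  have vac: "gaussian_vacuum \<psi>0 t (\<psi>0 0 t) a" for t
  proof
    show "\<psi>0 x t = \<psi>0 0 t * exp (- of_real (x\<^sup>2) / (4 * Complex 1 t))" for x
      by (rule vacuum_gaussian[OF psi0_diff psi0_vacuum])
  qed (use a_pos psi0_normalized in auto)
  have time: "((\<lambda>s. phiz a \<psi>0 z x s) has_vector_derivative
      - \<i> * (- dx (dx (phiz a \<psi>0 z)) x t - of_real (2 * a\<^sup>2 / (cosh (a * x))\<^sup>2) * phiz a \<psi>0 z x t)) (at t)" for z x t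
  proof -
    have "((\<lambda>t. tf a z x (1 / Complex 1 t)) has_vector_derivative (- \<i> * (1 / Complex 1 t)\<^sup>2) * tf' a z x (1 / Complex 1 t)) (at t)"
      using field_vector_diff_chain_at[OF inv_s_deriv tf_deriv] by (simp add: o_def)
    note has_vector_derivative_mult[OF has_vector_derivative_const
        has_vector_derivative_mult[OF vacuum_amplitude_deriv[OF psi0_diff psi0_vacuum psi0_schroedinger] this]]
    then show ?thesis
      \<comment> \<open>The Hamiltonian identity is applied first, since \<open>phiz_tf\<close>
        would rewrite the occurrence of \<open>phiz\<close> on its left-hand side.\<close>
      unfolding vac[THEN gaussian_vacuum.phiz_hamiltonian] unfolding vac[THEN gaussian_vacuum.phiz_tf]
      by (rule has_vector_derivative_eq_rhs) (simp add: algebra_simps)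
  qed
  have schroedinger: "\<i> * dt (phiz a \<psi>0 z) x t = - dx (dx (phiz a \<psi>0 z)) x t
      - of_real (2 * a\<^sup>2 / (cosh (a * x))\<^sup>2) * phiz a \<psi>0 z x t" for z x t
    unfolding dt_def vector_derivative_at[OF time] by (simp add: mult.assoc[symmetric] del: of_real_divide)
  show ?thesis
    by (intro conjI allI ballI)
       (assumption | rule schroedinger differentiableI_vector[OF time]
          vac[THEN gaussian_vacuum.phiz_in_H1] vac[THEN gaussian_vacuum.phiz_in_dom]
          vac[THEN gaussian_vacuum.phiz_dx_differentiable(1)] vac[THEN gaussian_vacuum.phiz_dx_differentiable(2)]
          vac[THEN gaussian_vacuum.resolution_of_identity] vac[THEN gaussian_vacuum.moment_problem])+
qed

end
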